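(* Let $X$ be a finite dimensional Euclidean space with its distance $d$, let $\mu$ be a Borel probability measure on $X$ and let $f\colon X\to X$ be a measurable map preserving $\mu$. Assume that the metric entropy satisfies $h_\mu(f)>0$, that $f$ is Lipschitz or, more generally, piecewise Lipschitz with finite average Lipschitz exponent, and that $(X,f,\mu)$ has super-polynomial decay of correlations or, more generally, that its local decay of correlations is super-polynomial. Then $$\underline{R}(x)=\underline{d}_\mu(x)\quad\text{and}\quad \overline{R}(x)=\overline{d}_\mu(x)\quad\text{for }\mu\text{-a.e. }x\in X.$$
   Context: Return time and recurrence rates: for $x\in X$ and $r>0$, $\tau_r(x)=\inf\{n\ge 1: d(f^n x,x)<r\}$, and $$\underline{R}(x)=\liminf_{r\to0}\frac{\log\tau_r(x)}{\log(1/r)},\qquad \overline{R}(x)=\limsup_{r\to0}\frac{\log\tau_r(x)}{\log(1/r)}.$$ Pointwise dimensions: with $B(x,r)$ the ball of center $x$ and radius $r$, $$\underline{d}_\mu(x)=\liminf_{r\to0}\frac{\log\mu(B(x,r))}{\log r},\qquad \overline{d}_\mu(x)=\limsup_{r\to0}\frac{\log\mu(B(x,r))}{\log r}.$$ Decay of correlations: let $\|\cdot\|$ be the Lipschitz norm on real (bounded) Lipschitz functions on $X$, i.e. sup norm plus best Lipschitz constant. The system has super-polynomial decay of correlations if there is a sequence $\theta_n$ with $\lim_{n\to\infty} n^p\theta_n=0$ for all $p>0$ such that for all Lipschitz $\varphi,\psi$ and all $n$ $$\left|\int \varphi\circ f^n\,\psi\, d\mu-\int\varphi\, d\mu\int\psi\,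 d\mu\right|\le \|\varphi\|\,\|\psi\|\,\theta_n. \qquad ( * )$$ The local decay of correlations is super-polynomial if there exist a partition (modulo $\mu$) of $X$ into open sets $V_i$ (pairwise disjoint open sets whose union has full $\mu$-measure) and sequences $(\theta^i_n)_n$, with $\lim_{n\to\infty} n^p\theta^i_n=0$ for all $p>0$ and each $i$, such that for every $i$ the inequality $( * )$ with $\theta_n$ replaced by $\theta_n^i$ holds whenever $\operatorname{supp}\varphi\subset V_i$ and $\operatorname{supp}\psi\subset V_i$. Piecewise Lipschitz: $f$ is piecewise Lipschitz if there exists a partition $\mathcal{A}$ (modulo $\mu$) of $X$ into open sets such that on each $A\in\mathcal{A}$ the map $f$ is Lipschitz with constant $L_f(A)$, and the singularity set $\partial\mathcal{A}=\bigcup_{A\in\mathcal{A}}\partial A$ satisfies $\mu(\{x\in X: d(x,\partial\mathcal{A})<\epsilon\})\le c\,\epsilon^a$ for all $\epsilon>0$, for some constants $c>0$ and $a>0$. Its average Lipschitz exponent is $\log L_f=\int\log^+ L_f(\mathcal{A}(x))\,d\mu(x)=\sum_{A\in\mathcal{A}}\log^+L_f(A)\,\mu(A)$, where $\mathcal{A}(x)$ is the element of $\mathcal{A}$ containing $x$ and $\log^+=\max(\log,0)$. *)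

theory Defs
  imports "HOL-Probability.Probability"
begin

(* Logarithm with the conventions ln 0 = -\<infinity> and ln \<infinity> = \<infinity>, so that infinite return
   times and balls of measure zero need no separate treatment. *)
definition eln :: "ennreal \<Rightarrow> ereal" where
  "eln t = (if t = 0 then -\<infinity> else if t = \<infinity> then \<infinity> else ereal (ln (enn2real t)))"

definition return_time :: "('a::metric_space \<Rightarrow> 'a) \<Rightarrow> real \<Rightarrow> 'a \<Rightarrow> ennreal" where
  "return_time f r x = (INF n\<in>{n::nat. 1 \<le> n \<and> dist ((f ^^ n) x) x < r}. of_nat n)"

definition lower_recurrence_rate :: "('a::metric_space \<Rightarrow> 'a) \<Rightarrow> 'a \<Rightarrow> ereal" where
  "lower_recurrence_rate f x =
     Liminf (at_right 0) (\<lambda>r::real. eln (return_time f r x) / ereal (ln (1 / r)))"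

definition upper_recurrence_rate :: "('a::metric_space \<Rightarrow> 'a) \<Rightarrow> 'a \<Rightarrow> ereal" where
  "upper_recurrence_rate f x =
     Limsup (at_right 0) (\<lambda>r::real. eln (return_time f r x) / ereal (ln (1 / r)))"

definition lower_pointwise_dim :: "('a::metric_space) measure \<Rightarrow> 'a \<Rightarrow> ereal" where
  "lower_pointwise_dim M x =
     Liminf (at_right 0) (\<lambda>r::real. eln (emeasure M (ball x r)) / ereal (ln r))"

definition upper_pointwise_dim :: "('a::metric_space) measure \<Rightarrow> 'a \<Rightarrow> ereal" where
  "upper_pointwise_dim M x =
     Limsup (at_right 0) (\<lambda>r::real. eln (emeasure M (ball x r)) / ereal (ln r))"

(* A finite measurable partition is represented by a labelling: a simple function whose
   nonempty level sets are the atoms.  The first n iterates of the labelling, collected in a list,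
   label the join of the partitions f^{-i}(P), i < n. *)
definition itinerary :: "('a \<Rightarrow> 'a) \<Rightarrow> ('a \<Rightarrow> nat) \<Rightarrow> nat \<Rightarrow> 'a \<Rightarrow> nat list" where
  "itinerary f P n x = map (\<lambda>i. P ((f ^^ i) x)) [0..<n]"

definition partition_entropy :: "'a measure \<Rightarrow> ('a \<Rightarrow> 'b) \<Rightarrow> real" where
  "partition_entropy M P = prob_space.entropy M (exp 1) (count_space (P ` space M)) P"

lemma partition_entropy_eq:
  assumes "prob_space M" "simple_function M P"
  shows "partition_entropy M P =
    - (\<Sum>i\<in>P ` space M. measure M (P -` {i} \<inter> space M) * ln (measure M (P -` {i} \<inter> space M)))"
proof -
  interpret information_space M "exp 1"
    using assms(1) by (simp add: information_space_def information_space_axioms_def)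
  have "simple_distributed M P (\<lambda>i. measure M (P -` {i} \<inter> space M))"
    using assms(2) by (rule simple_distributedI) auto
  then show ?thesis
    by (simp add: partition_entropy_def entropy_simple_distributed log_def)
qed

(* The limit exists by subadditivity when f preserves the probability measure M. *)
definition entropy_wrt_partition :: "'a measure \<Rightarrow> ('a \<Rightarrow> 'a) \<Rightarrow> ('a \<Rightarrow> nat) \<Rightarrow> real" where
  "entropy_wrt_partition M f P = lim (\<lambda>n. partition_entropy M (itinerary f P n) / real n)"

definition metric_entropy :: "'a measure \<Rightarrow> ('a \<Rightarrow> 'a) \<Rightarrow> ereal" where
  "metric_entropy M f = (SUP P\<in>{P. simple_function M P}. ereal (entropy_wrt_partition M f P))"

definition bounded_lipschitz :: "('a::metric_space \<Rightarrow> real) \<Rightarrow> bool" where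
  "bounded_lipschitz \<phi> \<longleftrightarrow> bounded (range \<phi>) \<and> (\<exists>L. L-lipschitz_on UNIV \<phi>)"

definition lipschitz_norm :: "('a::metric_space \<Rightarrow> real) \<Rightarrow> real" where
  "lipschitz_norm \<phi> = (SUP x. \<bar>\<phi> x\<bar>) + Inf {L. L-lipschitz_on UNIV \<phi>}"

definition closed_support :: "('a::topological_space \<Rightarrow> real) \<Rightarrow> 'a set" where
  "closed_support \<phi> = closure {x. \<phi> x \<noteq> 0}"

definition superpoly_null :: "(nat \<Rightarrow> real) \<Rightarrow> bool" where
  "superpoly_null \<theta> \<longleftrightarrow> (\<forall>p::real>0. (\<lambda>n. real n powr p * \<theta> n) \<longlonglongrightarrow> 0)"

definition correlation_bound ::
  "('a::metric_space) measure \<Rightarrow> ('a \<Rightarrow> 'a) \<Rightarrow> (nat \<Rightarrow> real) \<Rightarrow> ('a \<Rightarrow> real) \<Rightarrow> ('a \<Rightarrow> real) \<Rightarrow> bool" where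
  "correlation_bound M f \<theta> \<phi> \<psi> \<longleftrightarrow>
     (\<forall>n. \<bar>(\<integral>x. \<phi> ((f ^^ n) x) * \<psi> x \<partial>M) - (\<integral>x. \<phi> x \<partial>M) * (\<integral>x. \<psi> x \<partial>M)\<bar>
            \<le> lipschitz_norm \<phi> * lipschitz_norm \<psi> * \<theta> n)"

definition superpoly_decay :: "('a::metric_space) measure \<Rightarrow> ('a \<Rightarrow> 'a) \<Rightarrow> bool" where
  "superpoly_decay M f \<longleftrightarrow>
     (\<exists>\<theta>. superpoly_null \<theta> \<and>
        (\<forall>\<phi> \<psi>. bounded_lipschitz \<phi> \<longrightarrow> bounded_lipschitz \<psi> \<longrightarrow> correlation_bound M f \<theta> \<phi> \<psi>))"

(* Countability is automatic in a separable space, so it is not required here. *)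
definition open_partition_mod :: "('a::topological_space) measure \<Rightarrow> 'a set set \<Rightarrow> bool" where
  "open_partition_mod M \<V> \<longleftrightarrow>
     (\<forall>V\<in>\<V>. open V) \<and> disjoint \<V> \<and> (AE x in M. x \<in> \<Union>\<V>)"

definition local_superpoly_decay :: "('a::metric_space) measure \<Rightarrow> ('a \<Rightarrow> 'a) \<Rightarrow> bool" where
  "local_superpoly_decay M f \<longleftrightarrow>
     (\<exists>\<V> \<theta>. open_partition_mod M \<V> \<and>
        (\<forall>V\<in>\<V>. superpoly_null (\<theta> V) \<and>
           (\<forall>\<phi> \<psi>. bounded_lipschitz \<phi> \<longrightarrow> bounded_lipschitz \<psi> \<longrightarrow>
              closed_support \<phi> \<subseteq> V \<longrightarrow> closed_support \<psi> \<subseteq> V \<longrightarrow>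
              correlation_bound M f (\<theta> V) \<phi> \<psi>)))"

definition singularity_set :: "('a::topological_space) set set \<Rightarrow> 'a set" where
  "singularity_set \<A> = (\<Union>A\<in>\<A>. frontier A)"

(* The neighbourhood of the singularity set is not written with infdist, because
   infdist x {} = 0 whereas the distance to an empty singularity set must be infinite. *)
definition piecewise_lipschitz_wrt ::
  "('a::metric_space) measure \<Rightarrow> ('a \<Rightarrow> 'a) \<Rightarrow> 'a set set \<Rightarrow> ('a set \<Rightarrow> real) \<Rightarrow> bool" where
  "piecewise_lipschitz_wrt M f \<A> L \<longleftrightarrow>
     open_partition_mod M \<A> \<and>
     (\<forall>A\<in>\<A>. (L A)-lipschitz_on A f) \<and>
     (\<exists>c>0. \<exists>a>0. \<forall>\<epsilon>>0.
        measure M {x. \<exists>y\<in>singularity_set \<A>. dist x y < \<epsilon>} \<le> c * \<epsilon> powr a)"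

(* ln 0 = 0, so a constant branch (L A = 0) contributes 0, in accordance with log^+ 0 = 0. *)
definition avg_lipschitz_exponent :: "'a measure \<Rightarrow> 'a set set \<Rightarrow> ('a set \<Rightarrow> real) \<Rightarrow> ennreal" where
  "avg_lipschitz_exponent M \<A> L = (\<Sum>\<^sub>\<infinity>A\<in>\<A>. ennreal (max (ln (L A)) 0) * emeasure M A)"

end

theory Submission
  imports Defs
begin

text \<open>
  \<^emph>\<open>Upper bounds.\<close> Cut the space into a grid of cells of diameter \<open>exp (- m)\<close>. The points of a cell
  \<open>Q\<close> that do not return to \<open>Q\<close> before time \<open>T\<close> have disjoint preimages up to time \<open>T\<close>, so their
  measure is at most \<open>1 / (T + 1)\<close>. With \<open>T = exp (\<epsilon> m) / \<mu>(Q)\<close> this is summable over the cells and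
  over \<open>m\<close>, and almost every point returns to its cell within time \<open>exp (\<epsilon> m) / \<mu>(Q)\<close>.

  \<^emph>\<open>Lower bounds.\<close> For \<open>n \<ge> exp (a m)\<close> the decay of correlations, applied to bump functions around a
  cell, bounds the measure of the points of \<open>Q\<close> that come back close to \<open>Q\<close> at time \<open>n\<close> by essentially
  \<open>\<mu>(Q)\<^sup>2\<close>, because the decay is faster than any power of \<open>exp m\<close>. Hence almost no point has a close
  return between \<open>exp (a m)\<close> and \<open>exp (- \<epsilon> m) / \<mu>(Q)\<close>.

  \<^emph>\<open>Exclusion of fast returns.\<close> Let \<open>Z\<close> be the set of points that, for every \<open>a > 0\<close>, come
  \<open>exp (- m)\<close>-close before time \<open>exp (a m)\<close> for infinitely many \<open>m\<close>. It is forward invariant, and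
  local decay of correlations forces ergodicity, so \<open>Z\<close> is null or of full measure. In the second
  case, let a partition be given by rounding a Lipschitz function: nearby orbits have the same itinerary
  for a time proportional to \<open>m\<close> (a maximal inequality controls the product of the Lipschitz constants),
  so itineraries consist, up to a small fraction, of blocks copied from a place that is cheap to
  encode. There are then at most \<open>exp (\<delta> N)\<close> itineraries of length \<open>N\<close> up to small probability. As every
  partition is close to such a partition, all entropies vanish, contrary to the assumption.
\<close>

subsection \<open>Measure preserving maps\<close>

text \<open>Correlation bounds are paid for in Lipschitz norms: a bump at scale
  \<open>exp (- m)\<close> has norm of order \<open>exp m\<close>, so at time \<open>n\<close> the
  error is of order \<open>exp (2 * m) * \<theta> n\<close> per cell, and in dimension
  \<open>d\<close> a bounded region has about \<open>exp (d * m)\<close> cells. Superpolynomial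
  decay beats this only when \<open>n\<close> is at least a fixed positive power of
  \<open>exp m\<close>. Earlier returns are out of reach of mixing, and they are the one place where
  positive entropy enters. The model for that part is the return-time formula of Ornstein and Weiss:
  blocks of length \<open>n\<close> reappear after a time of about \<open>exp (h * n)\<close>. Only
  one consequence is needed, that subexponential reappearance forces \<open>h = 0\<close>, and
  counting suffices for it: naming the shift to the copy costs a small multiple of the block length.
  To turn close returns into repeated labels, an orbit must avoid both the singularities of
  \<open>f\<close> and the jumps of the labelling. Its distance to them at time \<open>k\<close> is
  at least a constant times \<open>exp (- k)\<close>, which is enough since agreement is asked only
  for a time proportional to \<open>m\<close>. The measure need not be doubling; a cell and its
  neighbourhood have comparable mass only almost everywhere and up to factors
  \<open>exp (\<epsilon> * m)\<close>.\<close>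

locale measure_preserving = prob_space M for M :: "('a::euclidean_space) measure" +
  fixes f :: "'a \<Rightarrow> 'a"
  assumes sets_M: "sets M = sets borel"
    and f_meas [measurable]: "f \<in> measurable M M"
    and f_inv: "distr M M f = M"
begin

lemma space_M [simp]: "space M = UNIV"
  using sets_eq_imp_space_eq[OF sets_M] by simp

lemma UNIV_sets [simp, measurable]: "UNIV \<in> sets M"
  using sets.top[of M] by simp

lemma prob_UNIV [simp]: "prob UNIV = 1"
  using prob_space by simp

lemma iter_meas [measurable]: "(f ^^ n) \<in> measurable M M"
proof (induction n)
  case (Suc n)
  then show ?case using measurable_comp[OF Suc f_meas] by (simp add: comp_def)
qed (simp add: id_def)

lemma iter_inv: "distr M M (f ^^ n) = M"
proof (induction n)
  case 0
  then show ?case by (simp add: id_def distr_id)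
next
  case (Suc n)
  have "distr M M (f ^^ Suc n) = distr (distr M M (f ^^ n)) M f"
    by (subst distr_distr) (auto simp: f_meas iter_meas)
  then show ?case by (simp only: Suc f_inv)
qed

lemma emeasure_iter: "A \<in> sets M \<Longrightarrow> emeasure M ((f ^^ n) -` A) = emeasure M A"
  using emeasure_distr[OF iter_meas, of A n] iter_inv[of n] by simp

lemma measure_iter: "A \<in> sets M \<Longrightarrow> prob ((f ^^ n) -` A) = prob A"
  by (simp add: measure_def emeasure_iter)

lemma iter_sets [measurable]: "A \<in> sets M \<Longrightarrow> (f ^^ n) -` A \<in> sets M"
  using measurable_sets[OF iter_meas, of A n] by simp

lemma integral_iter:
  fixes h :: "'a \<Rightarrow> real"
  assumes "h \<in> borel_measurable M"
  shows "(\<integral>x. h ((f ^^ n) x) \<partial>M) = (\<integral>x. h x \<partial>M)"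
  using integral_distr[OF iter_meas assms, of n] iter_inv[of n] by simp

lemma integrable_iter:
  fixes h :: "'a \<Rightarrow> real"
  assumes "integrable M h"
  shows "integrable M (\<lambda>x. h ((f ^^ n) x))"
  using integrable_distr[OF iter_meas, of n h] iter_inv[of n] assms by simp

lemma AE_iter:
  assumes "AE x in M. P x"
  shows "AE x in M. \<forall>n. P ((f ^^ n) x)"
proof -
  have "AE x in M. P ((f ^^ n) x)" for n
    by (rule AE_distrD[OF iter_meas]) (simp only: iter_inv assms)
  then show ?thesis by (simp add: AE_all_countable)
qed

lemma borel_meas_M: "h \<in> borel_measurable borel \<Longrightarrow> h \<in> borel_measurable M"
  using measurable_cong_sets[OF sets_M refl] by blast

lemma dist_iter_meas [measurable]: "(\<lambda>x. dist ((f ^^ n) x) x) \<in> borel_measurable M"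
proof -
  have "(f ^^ n) \<in> measurable M borel"
    using iter_meas[of n] measurable_cong_sets[OF refl sets_M] by blast
  moreover have "(\<lambda>x. x) \<in> measurable M borel"
    using measurable_ident_sets[OF sets_M] .
  ultimately show ?thesis by measurable
qed

text \<open>The preimages of the set below under the first \<open>T\<close> iterates are pairwise disjoint.\<close>

lemma measure_no_return_le:
  assumes A: "A \<in> sets M"
  shows "prob {y\<in>A. \<forall>n. 1 \<le> n \<and> n \<le> T \<longrightarrow> (f ^^ n) y \<notin> A} \<le> 1 / real (T + 1)"
proof -
  let ?B = "{y\<in>A. \<forall>n. 1 \<le> n \<and> n \<le> T \<longrightarrow> (f ^^ n) y \<notin> A}"
  have "?B = A - (\<Union>n\<in>{1..T}. (f ^^ n) -` A)" by auto
  then have B: "?B \<in> sets M" using A by auto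
  have dis: "disjoint_family_on (\<lambda>i. (f ^^ i) -` ?B) {..T}"
  proof -
    have key: "(f ^^ i) -` ?B \<inter> (f ^^ j) -` ?B = {}" if "i < j" "j \<le> T" for i j
    proof -
      have eq: "(f ^^ j) z = (f ^^ (j - i)) ((f ^^ i) z)" for z
        using that comp_apply[of "f ^^ (j - i)" "f ^^ i" z] by (simp flip: funpow_add)
      have "(f ^^ j) z \<notin> ?B" if "(f ^^ i) z \<in> ?B" for z
      proof -
        have "1 \<le> j - i" "j - i \<le> T" using \<open>i < j\<close> \<open>j \<le> T\<close> by auto
        then have "(f ^^ (j - i)) ((f ^^ i) z) \<notin> A" using that by blast
        then show ?thesis unfolding eq[of z] by blast
      qed
      then show ?thesis by blast
    qed
    have "(f ^^ i) -` ?B \<inter> (f ^^ j) -` ?B = {}" if "i \<in> {..T}" "j \<in> {..T}" "i \<noteq> j" for i j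
    proof (cases "i < j")
      case True
      then show ?thesis using key[of i j] that by simp
    next
      case False
      then show ?thesis using key[of j i] that by (simp add: Int_commute)
    qed
    then show ?thesis unfolding disjoint_family_on_def by blast
  qed
  have "prob (\<Union>i\<in>{..T}. (f ^^ i) -` ?B) = (\<Sum>i\<in>{..T}. prob ((f ^^ i) -` ?B))"
    using iter_sets[OF B] by (intro finite_measure_finite_Union dis) blast+
  also have "\<dots> = real (T + 1) * prob ?B"
    using measure_iter[OF B] by simp
  finally have "real (T + 1) * prob ?B \<le> 1"
    using prob_le_1[of "\<Union>i\<in>{..T}. (f ^^ i) -` ?B"] by (simp only:)
  then have "prob ?B * real (T + 1) \<le> 1" by (simp only: mult.commute)
  then show ?thesis by (simp only: pos_le_divide_eq of_nat_0_less_iff zero_less_Suc Suc_eq_plus1[symmetric])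
qed

end

subsection \<open>Grid cells\<close>

text \<open>The index of the cube of side \<open>s\<close> that contains \<open>y\<close>. It is an
  integer vector and not a corner of the cube, so that differences of indices count cells at every
  scale.\<close>

definition cell :: "real \<Rightarrow> 'a::euclidean_space \<Rightarrow> 'a" where
  "cell s y = (\<Sum>b\<in>Basis. of_int \<lfloor>(y \<bullet> b) / s\<rfloor> *\<^sub>R b)"

text \<open>The block of \<open>2 * K + 1\<close> cells per direction around the cell with index
  \<open>q\<close>. It stands in for a ball: it depends on a point only through its cell, and blocks
  of different cells overlap boundedly often.\<close>

definition nbhd :: "real \<Rightarrow> nat \<Rightarrow> 'a::euclidean_space \<Rightarrow> 'a set" where
  "nbhd s K q = {z. \<forall>b\<in>Basis. \<bar>(cell s z - q) \<bullet> b\<bar> \<le> real K}"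

definition int_box :: "nat \<Rightarrow> 'a::euclidean_space set" where
  "int_box K = {v. \<forall>b\<in>Basis. v \<bullet> b \<in> \<int> \<and> \<bar>v \<bullet> b\<bar> \<le> real K}"

lemma cell_inner: "b \<in> Basis \<Longrightarrow> cell s y \<bullet> b = of_int \<lfloor>(y \<bullet> b) / s\<rfloor>"
  unfolding cell_def by simp

lemma cell_Ints: "b \<in> Basis \<Longrightarrow> cell s y \<bullet> b \<in> \<int>"
  by (simp add: cell_inner)

lemma int_box_card:
  "finite (int_box K :: 'a::euclidean_space set)"
  "card (int_box K :: 'a::euclidean_space set) \<le> (2 * K + 1) ^ DIM('a)"
proof -
  let ?P = "PiE (Basis :: 'a set) (\<lambda>_. {- int K..int K})"
  let ?h = "\<lambda>v :: 'a. restrict (\<lambda>b. \<lfloor>v \<bullet> b\<rfloor>) Basis"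
  have inj: "inj_on ?h (int_box K)"
  proof (rule inj_onI)
    fix v w :: 'a assume vw: "v \<in> int_box K" "w \<in> int_box K" "?h v = ?h w"
    show "v = w"
    proof (rule euclidean_eqI)
      fix b :: 'a assume b: "b \<in> Basis"
      then have "\<lfloor>v \<bullet> b\<rfloor> = \<lfloor>w \<bullet> b\<rfloor>" using fun_cong[OF vw(3), of b] by simp
      then show "v \<bullet> b = w \<bullet> b" using vw(1,2) b
        unfolding int_box_def by (metis (mono_tags, lifting) Ints_cases floor_of_int mem_Collect_eq)
    qed
  qed
  have sub: "?h ` int_box K \<subseteq> ?P"
  proof (clarsimp simp: PiE_iff)
    fix v b :: 'a assume "v \<in> int_box K" "b \<in> Basis"
    then have "\<bar>v \<bullet> b\<bar> \<le> real K" by (auto simp: int_box_def)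
    then show "- int K \<le> \<lfloor>v \<bullet> b\<rfloor> \<and> \<lfloor>v \<bullet> b\<rfloor> \<le> int K" by (simp add: le_floor_iff floor_le_iff abs_le_iff)
  qed
  have fin: "finite ?P" by (intro finite_PiE) auto
  then show "finite (int_box K :: 'a set)" using finite_imageD[OF finite_subset[OF sub] inj] by auto
  have "card (int_box K :: 'a set) \<le> card ?P"
    by (rule card_inj_on_le[OF inj sub fin])
  also have "\<dots> = (2 * K + 1) ^ DIM('a)"
    by (subst card_PiE) (auto simp: nat_add_distrib nat_mult_distrib)
  finally show "card (int_box K :: 'a set) \<le> (2 * K + 1) ^ DIM('a)" .
qed

lemma cell_measurable [measurable]: "cell s \<in> borel_measurable borel"
  unfolding cell_def by measurable

lemma countable_range_cell: "countable (range (cell s :: 'a::euclidean_space \<Rightarrow> 'a))"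
proof -
  have "range (cell s :: 'a \<Rightarrow> 'a) \<subseteq> (\<Union>K. int_box K)"
  proof clarify
    fix y :: 'a
    obtain K where K: "norm (cell s y) \<le> real K" using real_arch_simple by blast
    have "cell s y \<in> int_box K"
      unfolding int_box_def using Basis_le_norm[of _ "cell s y"] K cell_Ints by fastforce
    then show "cell s y \<in> (\<Union>K. int_box K)" by blast
  qed
  moreover have "countable (\<Union>K. int_box K :: 'a set)"
    using int_box_card(1) by (intro countable_UN) (auto intro: countable_finite)
  ultimately show ?thesis using countable_subset by blast
qed

text \<open>A countable union of cells. This makes every condition on the masses of cells and
  blocks, read as a condition on the point, measurable at once.\<close>

lemma cell_Collect_borel: "{y :: 'a::euclidean_space. R (cell s y)} \<in> sets borel"
proof -
  have "{y :: 'a. R (cell s y)} = (\<Union>q\<in>{q\<in>range (cell s). R q}. cell s -` {q})" by auto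
  moreover have "cell s -` {q} \<in> sets borel" for q :: 'a
    using measurable_sets[OF cell_measurable, of "{q}" s] by simp
  ultimately show ?thesis
    using countable_subset[OF _ countable_range_cell, of "{q\<in>range (cell s). R q}" s]
    by (auto intro!: sets.countable_UN')
qed

text \<open>Reals whose floors differ by at most \<open>K\<close> differ by less than
  \<open>K + 1\<close>. The dimension enters because the distance is estimated by the sum of the
  coordinates.\<close>

lemma dist_less_of_cell_coords:
  fixes y z :: "'a::euclidean_space"
  fixes s K :: real
  assumes s: "s > 0" and K: "\<And>b. b \<in> Basis \<Longrightarrow> \<bar>(cell s y - cell s z) \<bullet> b\<bar> \<le> K"
  shows "dist y z < DIM('a) * ((K + 1) * s)"
proof -
  have 1: "\<bar>(y - z) \<bullet> b\<bar> < (K + 1) * s" if b: "b \<in> Basis" for b :: 'a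
  proof -
    have "\<bar>of_int \<lfloor>(y \<bullet> b) / s\<rfloor> - of_int \<lfloor>(z \<bullet> b) / s\<rfloor>\<bar> \<le> K"
      using K[OF b] b by (simp add: inner_diff_left cell_inner)
    then have "\<bar>(y \<bullet> b) / s - (z \<bullet> b) / s\<bar> < K + 1"
      using floor_correct[of "(y \<bullet> b) / s"] floor_correct[of "(z \<bullet> b) / s"] by linarith
    then have "\<bar>((y - z) \<bullet> b) / s\<bar> < K + 1" by (simp add: inner_diff_left diff_divide_distrib)
    then show ?thesis using s by (simp add: field_simps)
  qed
  have "dist y z \<le> (\<Sum>b\<in>Basis. \<bar>(y - z) \<bullet> b\<bar>)" unfolding dist_norm by (rule norm_le_l1)
  also have "\<dots> < (\<Sum>b\<in>(Basis :: 'a set). (K + 1) * s)" by (intro sum_strict_mono) (use 1 in auto)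
  finally show ?thesis by simp
qed

lemma cell_coords_le:
  fixes y z :: "'a::euclidean_space"
  assumes s: "s > 0" and d: "dist y z \<le> real k * s" and b: "b \<in> Basis"
  shows "\<bar>(cell s y - cell s z) \<bullet> b\<bar> \<le> real (k + 1)"
proof -
  have "\<bar>(y - z) \<bullet> b\<bar> \<le> real k * s"
    using Basis_le_norm[OF b, of "y - z"] d by (simp add: dist_norm)
  then have "\<bar>((y - z) \<bullet> b) / s\<bar> \<le> real k" using s by (simp add: field_simps)
  then have "\<bar>(y \<bullet> b) / s - (z \<bullet> b) / s\<bar> \<le> real k" by (simp add: inner_diff_left diff_divide_distrib)
  then have "\<bar>real_of_int \<lfloor>(y \<bullet> b) / s\<rfloor> - real_of_int \<lfloor>(z \<bullet> b) / s\<rfloor>\<bar> \<le> real k + 1"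
    using floor_correct[of "(y \<bullet> b) / s"] floor_correct[of "(z \<bullet> b) / s"] by linarith
  then show ?thesis using b by (simp add: inner_diff_left cell_inner)
qed

lemma nbhd_subset_ball:
  fixes y :: "'a::euclidean_space"
  assumes "s > 0" shows "nbhd s K (cell s y) \<subseteq> ball y (DIM('a) * ((real K + 1) * s))"
  using dist_less_of_cell_coords[OF assms, of _ y K] by (auto simp: nbhd_def dist_commute)

lemma cball_subset_nbhd:
  fixes y :: "'a::euclidean_space"
  assumes "s > 0" shows "cball y (real k * s) \<subseteq> nbhd s (k + 1) (cell s y)"
  using cell_coords_le[OF assms, of _ y k] by (auto simp: nbhd_def dist_commute simp del: of_nat_add)

lemma dist_cell_eq:
  fixes y z :: "'a::euclidean_space" and s :: real
  assumes "s > 0" "cell s y = cell s z" shows "dist y z < DIM('a) * s"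
  using dist_less_of_cell_coords[of s y z 0] assms by simp

lemma nbhd_borel [measurable]: "nbhd s K q \<in> sets borel"
  unfolding nbhd_def by (rule cell_Collect_borel)

lemma nn_integral_indicator_count_space_le:
  assumes "finite F"
  shows "(\<integral>\<^sup>+q. indicator F q \<partial>count_space I) \<le> of_nat (card F)"
proof -
  have "(\<integral>\<^sup>+q. indicator F q \<partial>count_space I) = emeasure (count_space I) (F \<inter> I)"
    by (subst nn_integral_indicator') auto
  also have "\<dots> = of_nat (card (F \<inter> I))"
    by (rule emeasure_count_space_finite) (use assms in auto)
  also have "\<dots> \<le> of_nat (card F)"
    by (intro of_nat_mono card_mono assms) auto
  finally show ?thesis .
qed

context measure_preserving begin

lemma nbhd_sets [measurable]: "nbhd s K q \<in> sets M"
  by (simp add: sets_M nbhd_borel)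

lemma cell_Collect_sets: "{y. R (cell s y)} \<in> sets M"
  by (simp add: sets_M cell_Collect_borel)

lemma cell_vimage_sets [measurable]: "cell s -` Q \<in> sets M"
  using cell_Collect_sets[of "\<lambda>q. q \<in> Q" s] by (simp add: vimage_def)

text \<open>Double counting: a point \<open>z\<close> lies in the block of \<open>q\<close> only if
  \<open>cell s z - q\<close> is in an integer box, so it is counted at most as often as the box has
  elements.\<close>

lemma nbhd_overlap:
  "(\<integral>\<^sup>+q. emeasure M (nbhd s K q) \<partial>count_space (range (cell s))) \<le> of_nat ((2 * K + 1) ^ DIM('a))"
proof -
  let ?I = "range (cell s) :: 'a set"
  have "(\<integral>\<^sup>+q. emeasure M (nbhd s K q) \<partial>count_space ?I)
      = (\<integral>\<^sup>+q. (\<integral>\<^sup>+z. indicator (nbhd s K q) z \<partial>M) \<partial>count_space ?I)"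
    by (simp)
  also have "\<dots> = (\<integral>\<^sup>+z. (\<integral>\<^sup>+q. indicator (nbhd s K q) z \<partial>count_space ?I) \<partial>M)"
    by (rule nn_integral_count_space_nn_integral[symmetric]) (auto simp: countable_range_cell)
  also have "\<dots> \<le> (\<integral>\<^sup>+z. of_nat ((2 * K + 1) ^ DIM('a)) \<partial>M)"
  proof (rule nn_integral_mono)
    fix z
    let ?F = "(\<lambda>v. cell s z - v) ` int_box K :: 'a set"
    have "q \<in> ?F" if q: "q \<in> ?I" and z: "z \<in> nbhd s K q" for q
    proof -
      have "cell s z - q \<in> int_box K"
        using z q by (auto simp: int_box_def nbhd_def inner_diff_left cell_Ints)
      then show ?thesis by (intro image_eqI[of _ _ "cell s z - q"]) auto
    qed
    then have "(\<integral>\<^sup>+q. indicator (nbhd s K q) z \<partial>count_space ?I) \<le> (\<integral>\<^sup>+q. indicator ?F q \<partial>count_space ?I)"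
      by (intro nn_integral_mono) (auto simp: indicator_def)
    also have "\<dots> \<le> of_nat (card ?F)"
      by (rule nn_integral_indicator_count_space_le) (auto simp: int_box_card)
    also have "\<dots> \<le> of_nat ((2 * K + 1) ^ DIM('a))"
      by (intro of_nat_mono order_trans[OF card_image_le int_box_card(2)] int_box_card(1))
    finally show "(\<integral>\<^sup>+q. indicator (nbhd s K q) z \<partial>count_space ?I) \<le> of_nat ((2 * K + 1) ^ DIM('a))" .
  qed
  also have "\<dots> = of_nat ((2 * K + 1) ^ DIM('a))" by (simp add: emeasure_space_1[simplified])
  finally show ?thesis .
qed

text \<open>The common frame of the Borel-Cantelli estimates. A bound proportional to the mass of
  the block sums over all cells thanks to bounded overlap; an absolute error \<open>E\<close> does
  not, and is therefore confined to a finite set \<open>F\<close> of cells.\<close>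

lemma measure_le_cellwise:
  assumes B: "B \<in> sets M" and c: "0 \<le> c" "0 \<le> E" and F: "finite F"
    and bd: "\<And>q. q \<in> range (cell s) \<Longrightarrow>
      prob (B \<inter> cell s -` {q}) \<le> c * prob (nbhd s K q) + (if q \<in> F then E else 0)"
  shows "prob B \<le> c * real ((2 * K + 1) ^ DIM('a)) + real (card F) * E"
proof -
  let ?I = "range (cell s) :: 'a set"
  have "emeasure M B = emeasure M (\<Union>q\<in>?I. B \<inter> cell s -` {q})"
    by (rule arg_cong[where f="emeasure M"]) auto
  also have "\<dots> = (\<integral>\<^sup>+q. emeasure M (B \<inter> cell s -` {q}) \<partial>count_space ?I)"
    by (rule emeasure_UN_countable) (use B countable_range_cell in \<open>auto simp: disjoint_family_on_def\<close>)
  also have "\<dots> \<le> (\<integral>\<^sup>+q. ennreal c * emeasure M (nbhd s K q) + ennreal E * indicator F q \<partial>count_space ?I)"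
  proof (rule nn_integral_mono)
    fix q assume q: "q \<in> space (count_space ?I)"
    have "emeasure M (B \<inter> cell s -` {q}) \<le> ennreal (c * prob (nbhd s K q) + (if q \<in> F then E else 0))"
      using bd[of q] q by (simp add: emeasure_eq_measure ennreal_leI)
    also have "\<dots> = ennreal c * emeasure M (nbhd s K q) + ennreal E * indicator F q"
      using c by (auto simp: emeasure_eq_measure ennreal_mult' ennreal_plus indicator_def)
    finally show "emeasure M (B \<inter> cell s -` {q}) \<le> ennreal c * emeasure M (nbhd s K q) + ennreal E * indicator F q" .
  qed
  also have "\<dots> = ennreal c * (\<integral>\<^sup>+q. emeasure M (nbhd s K q) \<partial>count_space ?I)
       + ennreal E * (\<integral>\<^sup>+q. indicator F q \<partial>count_space ?I)"
    by (simp add: nn_integral_add nn_integral_cmult)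
  also have "\<dots> \<le> ennreal c * of_nat ((2 * K + 1) ^ DIM('a)) + ennreal E * of_nat (card F)"
  proof (intro add_mono mult_left_mono nbhd_overlap)
    show "(\<integral>\<^sup>+q. indicator F q \<partial>count_space ?I) \<le> of_nat (card F)"
      by (rule nn_integral_indicator_count_space_le[OF F])
  qed auto
  also have "\<dots> = ennreal (c * real ((2 * K + 1) ^ DIM('a)) + real (card F) * E)"
    using c by (simp add: ennreal_plus ennreal_mult' ennreal_of_nat_eq_real_of_nat mult.commute del: of_nat_power of_nat_mult of_nat_add)
  finally have "ennreal (prob B) \<le> ennreal (c * real ((2 * K + 1) ^ DIM('a)) + real (card F) * E)"
    by (simp only: emeasure_eq_measure)
  moreover have "0 \<le> c * real ((2 * K + 1) ^ DIM('a)) + real (card F) * E" using c by simp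
  ultimately show ?thesis by (simp only: ennreal_le_iff)
qed

end

subsection \<open>Upper bounds for return times\<close>

lemma summable_exp_neg: "c > 0 \<Longrightarrow> summable (\<lambda>m::nat. exp (- (c * real m)))"
proof -
  assume "c > 0"
  then have "summable (\<lambda>m::nat. exp (- c) ^ m)" by (intro summable_geometric) auto
  then show ?thesis by (simp add: exp_of_nat_mult[symmetric] mult.commute)
qed

lemma nat_floor_bounds:
  fixes x :: real
  assumes "0 \<le> x" shows "real (nat \<lfloor>x\<rfloor>) \<le> x" "x < real (nat \<lfloor>x\<rfloor> + 1)"
proof -
  show "real (nat \<lfloor>x\<rfloor>) \<le> x" using assms by (rule of_nat_floor)
  show "x < real (nat \<lfloor>x\<rfloor> + 1)"
    using real_nat_ceiling_ge[of x] assms by linarith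
qed

text \<open>The division by the dimension compensates the factor in \<open>dist_cell_eq\<close>:
  points of one cell are at distance less than \<open>exp (- m)\<close>. The type argument supplies
  the dimension.\<close>

definition cell_scale :: "'a::euclidean_space itself \<Rightarrow> nat \<Rightarrow> real" where
  "cell_scale _ m = exp (- real m) / DIM('a)"

lemma cell_scale_pos: "cell_scale TYPE('a::euclidean_space) m > 0"
  by (simp add: cell_scale_def)

lemma DIM_cell_scale: "DIM('a) * cell_scale TYPE('a::euclidean_space) m = exp (- real m)"
  by (simp add: cell_scale_def)

context measure_preserving begin

abbreviation grid :: "nat \<Rightarrow> 'a \<Rightarrow> 'a" where
  "grid m \<equiv> cell (cell_scale TYPE('a) m)"

abbreviation grid_nbhd :: "nat \<Rightarrow> nat \<Rightarrow> 'a \<Rightarrow> 'a set" where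
  "grid_nbhd m \<equiv> nbhd (cell_scale TYPE('a) m)"

abbreviation atom :: "nat \<Rightarrow> 'a \<Rightarrow> 'a set" where
  "atom m y \<equiv> grid m -` {grid m y}"

lemma borel_cantelli_eventually:
  assumes "\<And>m. B m \<in> sets M" and "summable (\<lambda>m. prob (B m))"
  shows "AE y in M. eventually (\<lambda>m. y \<notin> B m) sequentially"
  using borel_cantelli_AE1[of B M] assms by (simp add: less_top[symmetric])

lemma cell_iter_eq_sets [measurable]: "{y. cell s ((f ^^ n) y) = cell s y} \<in> sets M"
proof -
  have f: "(f ^^ n) \<in> measurable M borel"
    using iter_meas[of n] measurable_cong_sets[OF refl sets_M] by blast
  have "cell s \<in> borel_measurable M" using borel_meas_M cell_measurable by blast
  moreover have "(\<lambda>y. cell s ((f ^^ n) y)) \<in> borel_measurable M"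
    using measurable_compose[OF f cell_measurable] .
  ultimately have "{y \<in> space M. cell s ((f ^^ n) y) = cell s y} \<in> sets M" by measurable
  then show ?thesis by simp
qed

lemma AE_atom_return:
  assumes "\<epsilon> > 0"
  shows "AE y in M. eventually (\<lambda>m. \<exists>n\<ge>1. real n * prob (atom m y) \<le> exp (\<epsilon> * real m)
           \<and> grid m ((f ^^ n) y) = grid m y) sequentially"
proof -
  define R where "R m n q \<longleftrightarrow> 1 \<le> n \<and> real n * prob (grid m -` {q}) \<le> exp (\<epsilon> * real m)" for m n q
  define B where "B m = - (\<Union>n. {y. R m n (grid m y)} \<inter> {y. grid m ((f ^^ n) y) = grid m y})" for m
  have "(\<Union>n. {y. R m n (grid m y)} \<inter> {y. grid m ((f ^^ n) y) = grid m y}) \<in> sets M" for m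
    using cell_Collect_sets cell_iter_eq_sets by (intro sets.countable_UN sets.Int) blast
  then have B: "B m \<in> sets M" for m
    unfolding B_def using sets.compl_sets[of _ M] by (simp add: Compl_eq_Diff_UNIV)
  \<comment> \<open>With \<open>K = 0\<close> the block is the cell itself, and no cell carries an
    error term.\<close>
  have "prob (B m) \<le> exp (- (\<epsilon> * real m)) * real ((2 * 0 + 1) ^ DIM('a)) + real (card ({} :: 'a set)) * 0" for m
  proof (rule measure_le_cellwise[OF B])
    fix q :: 'a assume "q \<in> range (grid m) "
    let ?Q = "grid m -` {q}"
    have sub: "?Q \<subseteq> grid_nbhd m 0 q" by (auto simp: nbhd_def)
    have "prob (B m \<inter> ?Q) \<le> exp (- (\<epsilon> * real m)) * prob ?Q"
    proof (cases "prob ?Q = 0")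
      case True
      moreover have "prob (B m \<inter> ?Q) \<le> prob ?Q" by (intro finite_measure_mono) auto
      ultimately show ?thesis by simp
    next
      case False
      then have pos: "prob ?Q > 0" by (simp add: measure_nonneg order_le_neq_trans)
      define T where "T = nat \<lfloor>exp (\<epsilon> * real m) / prob ?Q\<rfloor>"
      have T: "real T \<le> exp (\<epsilon> * real m) / prob ?Q" "exp (\<epsilon> * real m) / prob ?Q < real (T + 1)"
        unfolding T_def using nat_floor_bounds[of "exp (\<epsilon> * real m) / prob ?Q"] by auto
      have "prob (B m \<inter> ?Q) \<le> prob {y\<in>?Q. \<forall>n. 1 \<le> n \<and> n \<le> T \<longrightarrow> (f ^^ n) y \<notin> ?Q}"
      proof (intro finite_measure_mono)
        have "{y\<in>?Q. \<forall>n. 1 \<le> n \<and> n \<le> T \<longrightarrow> (f ^^ n) y \<notin> ?Q} = ?Q - (\<Union>n\<in>{1..T}. (f ^^ n) -` ?Q)"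
          by auto
        also have "\<dots> \<in> sets M" by auto
        finally show "{y\<in>?Q. \<forall>n. 1 \<le> n \<and> n \<le> T \<longrightarrow> (f ^^ n) y \<notin> ?Q} \<in> sets M" .
        show "B m \<inter> ?Q \<subseteq> {y\<in>?Q. \<forall>n. 1 \<le> n \<and> n \<le> T \<longrightarrow> (f ^^ n) y \<notin> ?Q}"
        proof (clarsimp simp: B_def R_def)
          fix y n assume h: "\<forall>n\<ge>Suc 0. real n * prob (atom m y) \<le> exp (\<epsilon> * real m) \<longrightarrow> grid m ((f ^^ n) y) \<noteq> grid m y"
            "q = grid m y" "Suc 0 \<le> n" "n \<le> T" "grid m ((f ^^ n) y) = grid m y"
          have "real n \<le> exp (\<epsilon> * real m) / prob ?Q" using T(1) h(4) by linarith
          then have "real n * prob ?Q \<le> exp (\<epsilon> * real m)" using pos by (simp add: field_simps)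
          then show False using h by auto
        qed
      qed
      also have "\<dots> \<le> 1 / real (T + 1)" by (rule measure_no_return_le) auto
      also have "\<dots> \<le> 1 / (exp (\<epsilon> * real m) / prob ?Q)"
        by (rule divide_left_mono) (use T(2) pos in auto)
      also have "\<dots> = exp (- (\<epsilon> * real m)) * prob ?Q" by (simp add: exp_minus field_simps)
      finally show ?thesis .
    qed
    also have "\<dots> \<le> exp (- (\<epsilon> * real m)) * prob (grid_nbhd m 0 q)"
      by (intro mult_left_mono finite_measure_mono sub) auto
    finally show "prob (B m \<inter> ?Q) \<le> exp (- (\<epsilon> * real m)) * prob (grid_nbhd m 0 q) + (if q \<in> {} then 0 else 0)"
      by simp
  qed auto
  then have "prob (B m) \<le> exp (- (\<epsilon> * real m))" for m by simp
  then have "summable (\<lambda>m. prob (B m))"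
    by (intro summable_comparison_test'[OF summable_exp_neg[OF assms]]) auto
  from borel_cantelli_eventually[OF B this] show ?thesis
  proof eventually_elim
    case (elim y)
    then show ?case
    proof eventually_elim
      case (elim m)
      then obtain n where "R m n (grid m y)"
        "grid m ((f ^^ n) y) = grid m y"
        unfolding B_def by blast
      then show ?case unfolding R_def by blast
    qed
  qed
qed

text \<open>Substitute for a doubling property: the cells that are much lighter than their block
  have small total mass, because the masses of all blocks add up to at most a constant. It allows
  balls and cells to be exchanged at the cost of a factor
  \<open>exp (\<epsilon> * m)\<close>.\<close>

lemma AE_atom_mass:
  assumes "\<epsilon> > 0"
  shows "AE y in M. eventually (\<lambda>m. exp (- (\<epsilon> * real m)) * prob (grid_nbhd m K (grid m y))
           \<le> prob (atom m y)) sequentially"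
proof -
  define B where "B m = {y. \<not> exp (- (\<epsilon> * real m)) * prob (grid_nbhd m K (grid m y))
           \<le> prob (atom m y)}" for m
  have B: "B m \<in> sets M" for m
    unfolding B_def by (rule cell_Collect_sets)
  have "prob (B m) \<le> exp (- (\<epsilon> * real m)) * real ((2 * K + 1) ^ DIM('a)) + real (card ({} :: 'a set)) * 0" for m
  proof (rule measure_le_cellwise[OF B])
    fix q :: 'a assume "q \<in> range (grid m)"
    let ?Q = "grid m -` {q}"
    show "prob (B m \<inter> ?Q) \<le> exp (- (\<epsilon> * real m)) * prob (grid_nbhd m K q) + (if q \<in> {} then 0 else 0)"
    proof (cases "B m \<inter> ?Q = {}")
      case False
      then obtain y where "y \<in> B m" "grid m y = q" by auto
      then have "prob ?Q \<le> exp (- (\<epsilon> * real m)) * prob (grid_nbhd m K q)"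
        by (auto simp: B_def)
      moreover have "prob (B m \<inter> ?Q) \<le> prob ?Q" by (intro finite_measure_mono) auto
      ultimately show ?thesis by simp
    qed simp
  qed auto
  then have "prob (B m) \<le> exp (- (\<epsilon> * real m)) * real ((2 * K + 1) ^ DIM('a))" for m by simp
  then have "summable (\<lambda>m. prob (B m))"
    by (intro summable_comparison_test'[OF summable_mult2[OF summable_exp_neg[OF assms]]]) auto
  from borel_cantelli_eventually[OF B this] show ?thesis
    unfolding B_def by simp
qed

lemma ball_sets [measurable]: "ball x r \<in> sets M"
  by (simp add: sets_M)

lemma AE_return_upper_eps:
  assumes "\<epsilon> > 0"
  shows "AE y in M. eventually (\<lambda>m. \<exists>n\<ge>1. real n * prob (ball y (cell_scale TYPE('a) m)) \<le> exp (\<epsilon> * real m)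
           \<and> dist ((f ^^ n) y) y < exp (- real m)) sequentially"
proof -
  \<comment> \<open>One half pays for the return to the cell, the other for replacing the cell by a
    ball.\<close>
  have e: "\<epsilon> / 2 > 0" using assms by simp
  show ?thesis
    using AE_atom_return[OF e] AE_atom_mass[OF e, of 2]
  proof eventually_elim
    case (elim y)
    from elim show ?case
    proof eventually_elim
      case (elim m)
      then obtain n where n: "n \<ge> 1" "real n * prob (atom m y) \<le> exp (\<epsilon> / 2 * real m)"
        "grid m ((f ^^ n) y) = grid m y" by blast
      let ?e = "exp (\<epsilon> / 2 * real m)"
      have ee: "?e * exp (- (\<epsilon> / 2 * real m)) = 1" by (simp add: exp_minus)
      have "prob (ball y (cell_scale TYPE('a) m)) \<le> prob (grid_nbhd m 2 (grid m y))"
        using cball_subset_nbhd[OF cell_scale_pos, of y 1 m] by (intro finite_measure_mono) (auto simp: numeral_2_eq_2)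
      also have "\<dots> = ?e * (exp (- (\<epsilon> / 2 * real m)) * prob (grid_nbhd m 2 (grid m y)))"
        using ee by (simp add: mult.assoc[symmetric])
      also have "\<dots> \<le> ?e * prob (atom m y)" by (intro mult_left_mono elim) simp
      finally have "real n * prob (ball y (cell_scale TYPE('a) m)) \<le> real n * (?e * prob (atom m y))"
        by (intro mult_left_mono) auto
      also have "\<dots> = ?e * (real n * prob (atom m y))" by simp
      also have "\<dots> \<le> ?e * ?e" by (intro mult_left_mono n) simp
      also have "\<dots> = exp (\<epsilon> * real m)" by (simp add: exp_add[symmetric])
      finally have "real n * prob (ball y (cell_scale TYPE('a) m)) \<le> exp (\<epsilon> * real m)" .
      moreover have "dist ((f ^^ n) y) y < exp (- real m)"
        using dist_cell_eq[OF cell_scale_pos n(3)] DIM_cell_scale[where 'a='a, of m] by simp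
      ultimately show ?case using n(1) by blast
    qed
  qed
qed

lemma AE_return_upper:
  "AE y in M. \<forall>\<epsilon>>0. eventually (\<lambda>m. \<exists>n\<ge>1. real n * prob (ball y (cell_scale TYPE('a) m)) \<le> exp (\<epsilon> * real m)
           \<and> dist ((f ^^ n) y) y < exp (- real m)) sequentially"
proof -
  have "AE y in M. \<forall>k. eventually (\<lambda>m. \<exists>n\<ge>1. real n * prob (ball y (cell_scale TYPE('a) m)) \<le> exp (1 / real (Suc k) * real m)
           \<and> dist ((f ^^ n) y) y < exp (- real m)) sequentially"
    unfolding AE_all_countable by (intro allI AE_return_upper_eps) simp
  then show ?thesis
  proof eventually_elim
    case (elim y)
    show ?case
    proof (intro allI impI)
      fix \<epsilon> :: real assume "\<epsilon> > 0"
      then obtain k where k: "1 / real (Suc k) < \<epsilon>" using reals_Archimedean[of \<epsilon>] by (auto simp: inverse_eq_divide)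
      have le: "exp (1 / real (Suc k) * real m) \<le> exp (\<epsilon> * real m)" for m :: nat
        using k by (intro iffD2[OF exp_le_cancel_iff] mult_right_mono) auto
      show "eventually (\<lambda>m. \<exists>n\<ge>1. real n * prob (ball y (cell_scale TYPE('a) m)) \<le> exp (\<epsilon> * real m)
           \<and> dist ((f ^^ n) y) y < exp (- real m)) sequentially"
        using spec[OF elim, of k]
      proof eventually_elim
        case (elim m)
        then show ?case using le[of m] by (meson order_trans)
      qed
    qed
  qed
qed

end

subsection \<open>Lower bounds for return times\<close>

lemma lipschitz_norm_bounds:
  fixes \<phi> :: "'a::metric_space \<Rightarrow> real"
  assumes b: "\<And>x. 0 \<le> \<phi> x" "\<And>x. \<phi> x \<le> 1" and L: "L-lipschitz_on UNIV \<phi>"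
  shows "bounded_lipschitz \<phi>" "0 \<le> lipschitz_norm \<phi>" "lipschitz_norm \<phi> \<le> 1 + L"
proof -
  have "bounded (range \<phi>)" unfolding bounded_iff using b by (intro exI[of _ 1]) auto
  then show "bounded_lipschitz \<phi>" unfolding bounded_lipschitz_def using L by blast
  have bdd: "bdd_above (range (\<lambda>x. \<bar>\<phi> x\<bar>))" using b by (intro bdd_aboveI[of _ 1]) auto
  have "0 \<le> (SUP x. \<bar>\<phi> x\<bar>)" by (rule cSUP_upper2[OF bdd]) auto
  moreover have "(SUP x. \<bar>\<phi> x\<bar>) \<le> 1" by (rule cSUP_least) (use b in auto)
  moreover have "0 \<le> Inf {L. L-lipschitz_on UNIV \<phi>}"
    by (rule cInf_greatest) (use L lipschitz_on_nonneg in auto)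
  moreover have "Inf {L. L-lipschitz_on UNIV \<phi>} \<le> L"
    by (rule cInf_lower) (use L in \<open>auto intro!: bdd_belowI[of _ 0] lipschitz_on_nonneg\<close>)
  ultimately show "0 \<le> lipschitz_norm \<phi>" "lipschitz_norm \<phi> \<le> 1 + L"
    unfolding lipschitz_norm_def by linarith+
qed

text \<open>Equal to 1 up to distance \<open>2 * r\<close> and to 0 from distance
  \<open>4 * r\<close> on. The plateau is wide enough for a point within \<open>r\<close> of
  \<open>y\<close> and also for its image, if that comes back within \<open>r\<close> of the
  point.\<close>

definition bump :: "real \<Rightarrow> 'a::metric_space \<Rightarrow> 'a \<Rightarrow> real" where
  "bump r y z = max 0 (min 1 (2 - dist z y / (2 * r)))"

lemma bump_lipschitz:
  assumes r: "r > 0"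
  shows "(1 / r)-lipschitz_on UNIV (bump r y)"
proof (rule lipschitz_onI)
  fix z w
  have "\<bar>dist z y / (2 * r) - dist w y / (2 * r)\<bar> \<le> dist z w / (2 * r)"
    using r abs_dist_diff_le[of z y w] by (simp add: dist_commute[of y w] diff_divide_distrib[symmetric] divide_right_mono)
  also have "\<dots> \<le> 1 / r * dist z w"
    using r by (simp add: field_simps)
  finally show "dist (bump r y z) (bump r y w) \<le> 1 / r * dist z w"
    unfolding bump_def dist_real_def by (auto simp: max_def min_def abs_le_iff)
qed (use r in simp)

lemma bump_bounds: "0 \<le> bump r y z" "bump r y z \<le> 1"
  by (auto simp: bump_def)

lemma bump_eq_1: "r > 0 \<Longrightarrow> dist z y \<le> 2 * r \<Longrightarrow> bump r y z = 1"
  by (simp add: bump_def)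

lemma bump_nonzero:
  assumes "r > 0" "bump r y z \<noteq> 0"
  shows "dist z y < 4 * r"
proof (rule ccontr)
  assume "\<not> dist z y < 4 * r"
  then have "2 \<le> dist z y / (2 * r)" using assms(1) by (simp add: field_simps)
  then show False using assms(2) by (simp add: bump_def)
qed

lemma bump_support: "r > 0 \<Longrightarrow> closed_support (bump r y) \<subseteq> cball y (4 * r)"
  unfolding closed_support_def
  by (rule closure_minimal) (auto dest: bump_nonzero simp: dist_commute less_imp_le)

definition decay_on :: "'a::metric_space measure \<Rightarrow> ('a \<Rightarrow> 'a) \<Rightarrow> (nat \<Rightarrow> real) \<Rightarrow> 'a set \<Rightarrow> bool" where
  "decay_on M f \<theta> V \<longleftrightarrow> (\<forall>\<phi> \<psi>. bounded_lipschitz \<phi> \<longrightarrow> bounded_lipschitz \<psi> \<longrightarrow>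
              closed_support \<phi> \<subseteq> V \<longrightarrow> closed_support \<psi> \<subseteq> V \<longrightarrow> correlation_bound M f \<theta> \<phi> \<psi>)"

text \<open>Taking \<open>\<psi> = \<phi>\<close> lets one bump test both the starting point and its
  image. The absolute value appears because \<open>superpoly_null\<close> does not prescribe the
  sign of \<open>\<theta>\<close>.\<close>

lemma decay_onD:
  fixes \<phi> :: "'a::metric_space \<Rightarrow> real"
  assumes "decay_on M f \<theta> V" and b: "\<And>x. 0 \<le> \<phi> x" "\<And>x. \<phi> x \<le> 1" and L: "L-lipschitz_on UNIV \<phi>"
    and supp: "closed_support \<phi> \<subseteq> V"
  shows "\<bar>(\<integral>x. \<phi> ((f ^^ n) x) * \<phi> x \<partial>M) - (\<integral>x. \<phi> x \<partial>M)\<^sup>2\<bar> \<le> (1 + L)\<^sup>2 * \<bar>\<theta> n\<bar>"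
proof -
  note N = lipschitz_norm_bounds[OF b L]
  have "correlation_bound M f \<theta> \<phi> \<phi>"
    using assms(1) N(1) supp unfolding decay_on_def by blast
  then have "\<bar>(\<integral>x. \<phi> ((f ^^ n) x) * \<phi> x \<partial>M) - (\<integral>x. \<phi> x \<partial>M)\<^sup>2\<bar> \<le> (lipschitz_norm \<phi>)\<^sup>2 * \<theta> n"
    by (simp add: correlation_bound_def power2_eq_square)
  also have "\<dots> \<le> (lipschitz_norm \<phi>)\<^sup>2 * \<bar>\<theta> n\<bar>" by (intro mult_left_mono) auto
  also have "\<dots> \<le> (1 + L)\<^sup>2 * \<bar>\<theta> n\<bar>" by (intro mult_right_mono power_mono N) auto
  finally show ?thesis .
qed

lemma superpoly_null_bound:
  assumes "superpoly_null \<theta>" "p > 0"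
  obtains c where "c > 0" "\<And>n. n \<ge> 1 \<Longrightarrow> \<bar>\<theta> n\<bar> \<le> c * real n powr - p"
proof -
  have "(\<lambda>n. real n powr p * \<theta> n) \<longlonglongrightarrow> 0" using assms by (auto simp: superpoly_null_def)
  then have "Bseq (\<lambda>n. real n powr p * \<theta> n)" by (rule convergent_imp_Bseq[OF convergentI])
  then obtain c where c: "c > 0" "\<And>n. norm (real n powr p * \<theta> n) \<le> c" by (auto elim: BseqE)
  show thesis
  proof (rule that[OF c(1)])
    fix n :: nat assume n: "n \<ge> 1"
    have "real n powr p * \<bar>\<theta> n\<bar> \<le> c" using c(2)[of n] by (simp add: abs_mult)
    then show "\<bar>\<theta> n\<bar> \<le> c * real n powr - p" using n by (simp add: powr_minus field_simps)
  qed
qed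

lemma superpoly_null_tail:
  assumes "superpoly_null \<theta>" "p > 0"
  obtains c where "c > 0"
    "\<And>A F. A > 0 \<Longrightarrow> finite F \<Longrightarrow> (\<And>n. n \<in> F \<Longrightarrow> A \<le> real n) \<Longrightarrow> (\<Sum>n\<in>F. \<bar>\<theta> n\<bar>) \<le> c * A powr - p"
proof -
  \<comment> \<open>Two of the \<open>p + 2\<close> powers make the series converge; the remaining
    \<open>p\<close> give the decay in the lower end \<open>A\<close> of the range.\<close>
  obtain c where c: "c > 0" "\<And>n. n \<ge> 1 \<Longrightarrow> \<bar>\<theta> n\<bar> \<le> c * real n powr - (p + 2)"
    using superpoly_null_bound[OF assms(1), of "p + 2"] assms(2) by auto
  have sm: "summable (\<lambda>n. real n powr - 2)" by (subst summable_real_powr_iff) auto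
  let ?S = "\<Sum>n. real n powr - 2"
  have S: "0 \<le> ?S" by (rule suminf_nonneg[OF sm]) auto
  show thesis
  proof (rule that[of "c * (?S + 1)"])
    show "0 < c * (?S + 1)" using c(1) S by simp
  next
    fix A :: real and F :: "nat set" assume A: "A > 0" "finite F" "\<And>n. n \<in> F \<Longrightarrow> A \<le> real n"
    have "(\<Sum>n\<in>F. \<bar>\<theta> n\<bar>) \<le> (\<Sum>n\<in>F. c * A powr - p * real n powr - 2)"
    proof (rule sum_mono)
      fix n assume n: "n \<in> F"
      then have n1: "real n > 0" using A by fastforce
      then have "\<bar>\<theta> n\<bar> \<le> c * real n powr - (p + 2)" using c(2)[of n] by simp
      also have "\<dots> = c * (real n powr - p * real n powr - 2)" by (simp add: powr_add[symmetric])
      also have "\<dots> \<le> c * (A powr - p * real n powr - 2)"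
        using c(1) A n assms(2) by (intro mult_left_mono mult_right_mono powr_mono2') auto
      finally show "\<bar>\<theta> n\<bar> \<le> c * A powr - p * real n powr - 2" by simp
    qed
    also have "\<dots> = c * A powr - p * (\<Sum>n\<in>F. real n powr - 2)" by (simp add: sum_distrib_left)
    also have "\<dots> \<le> c * A powr - p * (?S + 1)"
      using sum_le_suminf[OF sm A(2)] c(1) by (intro mult_left_mono) auto
    finally show "(\<Sum>n\<in>F. \<bar>\<theta> n\<bar>) \<le> c * (?S + 1) * A powr - p" by (simp add: mult_ac)
  qed
qed

section \<open>Close returns and correlations\<close>

context measure_preserving begin

lemma ball_inside_sets: "{y. ball y \<delta> \<subseteq> V} \<in> sets M"
proof -
  have "{y. ball y \<delta> \<subseteq> V} = - (\<Union>z\<in>- V. ball z \<delta>)" by (auto simp: dist_commute)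
  moreover have "open (\<Union>z\<in>- V. ball z \<delta>)" by blast
  ultimately have "closed {y. ball y \<delta> \<subseteq> V}" by (metis closed_Compl)
  then show ?thesis by (simp add: sets_M)
qed

lemma lipschitz_meas: "L-lipschitz_on UNIV (\<phi> :: 'a \<Rightarrow> real) \<Longrightarrow> \<phi> \<in> borel_measurable M"
  by (intro borel_meas_M borel_measurable_continuous_onI lipschitz_on_continuous_on)

lemma integrable_unit:
  fixes \<phi> :: "'a \<Rightarrow> real"
  assumes "\<phi> \<in> borel_measurable M" "\<And>x. 0 \<le> \<phi> x" "\<And>x. \<phi> x \<le> 1"
  shows "integrable M \<phi>"
  by (rule integrable_const_bound[of _ 1]) (use assms in auto)

definition close_return :: "nat \<Rightarrow> nat \<Rightarrow> 'a set" where
  "close_return m n = {y. dist ((f ^^ n) y) y < exp (- real m)}"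

lemma close_return_sets [measurable]: "close_return m n \<in> sets M"
proof -
  have "{y\<in>space M. dist ((f ^^ n) y) y < exp (- real m)} \<in> sets M" by measurable
  then show ?thesis by (simp add: close_return_def)
qed

text \<open>On the set to be measured both the point and its image lie in the plateau of the bump
  around \<open>y0\<close>, so its indicator is at most
  \<open>\<phi> ((f ^^ n) x) * \<phi> x\<close>. The support has radius
  \<open>4 * exp (- m)\<close>, that is \<open>4 * DIM('a)\<close> sides of a cell; one more cell
  accounts for the position of \<open>y0\<close> in its own cell. This gives
  \<open>K\<close>.\<close>

lemma measure_close_return_le:
  fixes K :: nat and y0 :: 'a
  defines "K \<equiv> 4 * DIM('a) + 1"
  assumes dec: "decay_on M f \<theta> V" and y0: "ball y0 \<delta> \<subseteq> V" and m: "4 * exp (- real m) < \<delta>"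
  shows "prob (atom m y0 \<inter> close_return m n)
    \<le> (prob (grid_nbhd m K (grid m y0)))\<^sup>2 + 4 * exp (2 * real m) * \<bar>\<theta> n\<bar>"
proof -
  define r where "r = exp (- real m)"
  have r: "r > 0" "1 / r = exp (real m)" by (auto simp: r_def exp_minus field_simps)
  define \<phi> where "\<phi> = bump r y0"
  have L: "(exp (real m))-lipschitz_on UNIV \<phi>" using bump_lipschitz[OF r(1), of y0] r by (simp add: \<phi>_def)
  have meas [measurable]: "\<phi> \<in> borel_measurable M" by (rule lipschitz_meas[OF L])
  note b = bump_bounds[of r y0, folded \<phi>_def]
  have "closed_support \<phi> \<subseteq> V"
    using bump_support[OF r(1), of y0] y0 m unfolding \<phi>_def r_def by (force simp: dist_commute)
  note cor = decay_onD[OF dec b L this, of n]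
  let ?A = "atom m y0 \<inter> close_return m n"
  let ?N = "grid_nbhd m K (grid m y0)"
  have int2: "integrable M (\<lambda>x. \<phi> ((f ^^ n) x) * \<phi> x)"
    by (rule integrable_unit) (use b in \<open>auto intro!: mult_nonneg_nonneg mult_le_one\<close>)
  have "prob ?A = (\<integral>x. (indicator ?A x :: real) \<partial>M)" by simp
  also have "\<dots> \<le> (\<integral>x. \<phi> ((f ^^ n) x) * \<phi> x \<partial>M)"
  proof (rule integral_mono[OF _ int2])
    fix x
    show "indicator ?A x \<le> \<phi> ((f ^^ n) x) * \<phi> x"
    proof (cases "x \<in> ?A")
      case True
      then have 1: "dist x y0 < r" using dist_cell_eq[OF cell_scale_pos[where 'a='a and m=m], of x y0] DIM_cell_scale[where 'a='a, of m]
        by (simp add: r_def)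
      have "dist ((f ^^ n) x) x < r" using True by (simp add: close_return_def r_def)
      then have "dist ((f ^^ n) x) y0 \<le> 2 * r" using 1 dist_triangle[of "(f ^^ n) x" y0 x] by linarith
      then show ?thesis using 1 True r(1) by (simp add: \<phi>_def bump_eq_1)
    qed (use b in auto)
  qed (intro integrable_unit borel_measurable_indicator sets.Int cell_vimage_sets close_return_sets, auto)
  also have "\<dots> \<le> (\<integral>x. \<phi> x \<partial>M)\<^sup>2 + (1 + exp (real m))\<^sup>2 * \<bar>\<theta> n\<bar>" using cor by linarith
  also have "\<dots> \<le> (prob ?N)\<^sup>2 + 4 * exp (2 * real m) * \<bar>\<theta> n\<bar>"
  proof (intro add_mono power_mono mult_right_mono)
    have sub: "cball y0 (4 * r) \<subseteq> ?N"
      using cball_subset_nbhd[OF cell_scale_pos[where 'a='a and m=m], of y0 "4 * DIM('a)"] DIM_cell_scale[where 'a='a, of m]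
      by (simp add: K_def r_def mult.assoc)
    have "(\<integral>x. \<phi> x \<partial>M) \<le> (\<integral>x. indicator ?N x \<partial>M)"
    proof (rule integral_mono[OF integrable_unit])
      show "integrable M (indicator ?N :: 'a \<Rightarrow> real)"
        by (intro integrable_unit borel_measurable_indicator nbhd_sets) auto
      show "\<phi> x \<le> indicator ?N x" for x
        using bump_nonzero[OF r(1), of y0 x] sub b[of x] by (cases "\<phi> x = 0") (force simp: \<phi>_def dist_commute indicator_def)+
    qed (use b in auto)
    then show "(\<integral>x. \<phi> x \<partial>M) \<le> prob ?N" by simp
    have "(1 + exp (real m))\<^sup>2 \<le> (2 * exp (real m))\<^sup>2" by (intro power_mono) auto
    also have "\<dots> = 4 * exp (2 * real m)" by (simp add: power2_eq_square exp_add[symmetric])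
    finally show "(1 + exp (real m))\<^sup>2 \<le> 4 * exp (2 * real m)" .
  qed (use b in auto)
  finally show ?thesis .
qed

lemma AE_no_return_window:
  fixes K :: nat
  defines "K \<equiv> 4 * DIM('a) + 1"
  assumes null: "superpoly_null \<theta>" and dec: "decay_on M f \<theta> V"
    and pos: "a > 0" "\<epsilon> > 0" "\<delta> > 0" "R > 0"
  shows "AE y in M. norm y \<le> R \<and> ball y \<delta> \<subseteq> V \<longrightarrow> eventually (\<lambda>m. \<forall>n. exp (a * real m) \<le> real n
     \<longrightarrow> real n * prob (grid_nbhd m K (grid m y)) \<le> exp (- (\<epsilon> * real m))
     \<longrightarrow> y \<notin> close_return m n) sequentially"
proof -
  define N where "N m q = grid_nbhd m K q" for m and q :: 'a
  let ?c = "\<lambda>m. grid m :: 'a \<Rightarrow> 'a"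
  define P where "P m n q \<longleftrightarrow> exp (a * real m) \<le> real n \<and> real n * prob (N m q) \<le> exp (- (\<epsilon> * real m))" for m n q
  \<comment> \<open>The condition on \<open>norm y\<close> leaves finitely many cells, as the
    absolute error term requires; the one on \<open>ball y \<delta>\<close> leaves room in
    \<open>V\<close> for the support of the bump.\<close>
  define B where "B m = {y. norm y \<le> R} \<inter> {y. ball y \<delta> \<subseteq> V} \<inter> (\<Union>n. {y. P m n (?c m y)} \<inter> close_return m n)" for m
  have "{y. norm y \<le> R} \<in> sets M"
  proof -
    have "{y :: 'a. norm y \<le> R} = cball 0 R" by auto
    then show ?thesis by (simp add: sets_M)
  qed
  then have B: "B m \<in> sets M" for m
    unfolding B_def using cell_Collect_sets close_return_sets ball_inside_sets
    by (intro sets.countable_UN sets.Int) blast+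
  define d where "d = DIM('a)"
  define p where "p = (real d + 3) / a"
    \<comment> \<open>beats the factor \<open>exp ((d + 2) m)\<close> due to the number of cells and the squared Lipschitz norms\<close>
  have p: "p > 0" using pos by (simp add: p_def)
  obtain c where c: "c > 0"
    "\<And>A F. A > 0 \<Longrightarrow> finite F \<Longrightarrow> (\<And>n. n \<in> F \<Longrightarrow> A \<le> real n) \<Longrightarrow> (\<Sum>n\<in>F. \<bar>\<theta> n\<bar>) \<le> c * A powr - p"
    using superpoly_null_tail[OF null p] by metis
  define E where "E m = 4 * exp (2 * real m) * (c * exp (a * real m) powr - p)" for m :: nat
  have E0: "0 \<le> E m" for m using c(1) by (simp add: E_def)
  \<comment> \<open>An index is a coordinate divided by the side \<open>exp (- m) / d\<close>, hence
    at most \<open>R * d * exp m\<close> in modulus before taking floors; the summand 1 accounts for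
    the floor.\<close>
  define k where "k m = nat \<lceil>R * real d * exp (real m)\<rceil> + 1" for m :: nat
  let ?F = "\<lambda>m. int_box (k m) :: 'a set"
  have card: "real (card (?F m)) \<le> (2 * R * real d + 5) ^ d * exp (real d * real m)" for m
  proof -
    have R: "0 \<le> R * real d * exp (real m)" using pos by simp
    then have "real (k m) \<le> R * real d * exp (real m) + 2" unfolding k_def by linarith
    then have "real (2 * k m + 1) \<le> 2 * R * real d * exp (real m) + 5" by simp
    also have "\<dots> \<le> (2 * R * real d + 5) * exp (real m)" using R by (simp add: algebra_simps)
    finally have 1: "real (2 * k m + 1) \<le> (2 * R * real d + 5) * exp (real m)" .
    have "real (card (?F m)) \<le> real ((2 * k m + 1) ^ d)"
      using int_box_card(2)[where 'a='a, of "k m"] unfolding d_def by (intro of_nat_mono)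
    also have "\<dots> = real (2 * k m + 1) ^ d" by simp
    also have "\<dots> \<le> ((2 * R * real d + 5) * exp (real m)) ^ d" by (intro power_mono 1) simp
    also have "\<dots> = (2 * R * real d + 5) ^ d * exp (real d * real m)"
      by (simp add: power_mult_distrib exp_of_nat_mult[symmetric])
    finally show ?thesis .
  qed
  have main: "prob (B m) \<le> exp (- (\<epsilon> * real m)) * real ((2 * K + 1) ^ DIM('a)) + real (card (?F m)) * E m"
    if m: "4 * exp (- real m) < \<delta>" for m
  proof (rule measure_le_cellwise[OF B _ E0])
    show "finite (?F m)" by (rule int_box_card)
    show "0 \<le> exp (- (\<epsilon> * real m))" by simp
    fix q :: 'a assume "q \<in> range (?c m)"
    let ?Q = "?c m -` {q}"
    show "prob (B m \<inter> ?Q) \<le> exp (- (\<epsilon> * real m)) * prob (grid_nbhd m K q) + (if q \<in> ?F m then E m else 0)"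
    proof (cases "B m \<inter> ?Q = {}")
      case True
      then show ?thesis using E0[of m] by simp
    next
      case False
      then obtain y0 where y0: "y0 \<in> B m" "q = ?c m y0" by auto
      then have y0': "norm y0 \<le> R" "ball y0 \<delta> \<subseteq> V" by (auto simp: B_def)
      have "q \<in> ?F m"
        unfolding int_box_def
      proof (intro CollectI ballI conjI)
        fix b :: 'a assume b: "b \<in> Basis"
        show "q \<bullet> b \<in> \<int>" using b by (simp add: y0(2) cell_Ints)
        have "\<bar>y0 \<bullet> b\<bar> \<le> R" using Basis_le_norm[OF b, of y0] y0'(1) by simp
        then have "\<bar>(y0 \<bullet> b) / cell_scale TYPE('a) m\<bar> \<le> R / cell_scale TYPE('a) m"
          by (simp add: abs_divide divide_right_mono cell_scale_pos less_imp_le)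
        also have "\<dots> = R * real d * exp (real m)" by (simp add: cell_scale_def d_def exp_minus field_simps)
        finally have "\<bar>of_int \<lfloor>(y0 \<bullet> b) / cell_scale TYPE('a) m\<rfloor>\<bar> \<le> R * real d * exp (real m) + 1"
          using floor_correct[of "(y0 \<bullet> b) / cell_scale TYPE('a) m"] by linarith
        also have "\<dots> \<le> real (k m)" unfolding k_def by linarith
        finally show "\<bar>q \<bullet> b\<bar> \<le> real (k m)" using b by (simp add: y0(2) cell_inner)
      qed
      moreover have "prob (B m \<inter> ?Q) \<le> exp (- (\<epsilon> * real m)) * prob (N m q) + E m"
      proof (cases "prob (N m q) = 0")
        case True
        have "prob (B m \<inter> ?Q) \<le> prob (N m q)"
          unfolding N_def by (rule finite_measure_mono[OF _ nbhd_sets]) (auto simp: nbhd_def)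
        then show ?thesis using True E0[of m] by simp
      next
        case False
        then have Npos: "prob (N m q) > 0" by (simp add: measure_nonneg order_le_neq_trans)
        define T where "T = nat \<lfloor>exp (- (\<epsilon> * real m)) / prob (N m q)\<rfloor>"
        have T: "real n \<le> exp (- (\<epsilon> * real m)) / prob (N m q) \<longleftrightarrow> n \<le> T" for n
          unfolding T_def by (simp add: le_nat_iff le_floor_iff)
        define I where "I = {n. n \<le> T \<and> exp (a * real m) \<le> real n}"
        have I: "finite I" unfolding I_def by simp
        have "B m \<inter> ?Q \<subseteq> (\<Union>n\<in>I. atom m y0 \<inter> close_return m n)"
        proof
          fix y assume "y \<in> B m \<inter> ?Q"
          then obtain n where n: "P m n q" "y \<in> close_return m n" "?c m y = q" by (auto simp: B_def)
          then have "real n \<le> exp (- (\<epsilon> * real m)) / prob (N m q)" using Npos by (simp add: P_def field_simps)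
          then have "n \<in> I" using n(1) T by (auto simp: I_def P_def)
          then show "y \<in> (\<Union>n\<in>I. atom m y0 \<inter> close_return m n)" using n y0 by auto
        qed
        then have "prob (B m \<inter> ?Q) \<le> prob (\<Union>n\<in>I. atom m y0 \<inter> close_return m n)"
          by (intro finite_measure_mono) auto
        also have "\<dots> \<le> (\<Sum>n\<in>I. prob (atom m y0 \<inter> close_return m n))"
          by (intro finite_measure_subadditive_finite I) auto
        also have "\<dots> \<le> (\<Sum>n\<in>I. (prob (N m q))\<^sup>2 + 4 * exp (2 * real m) * \<bar>\<theta> n\<bar>)"
          using measure_close_return_le[OF dec y0'(2) m] unfolding K_def N_def y0(2) by (intro sum_mono)
        also have "\<dots> = real (card I) * (prob (N m q))\<^sup>2 + 4 * exp (2 * real m) * (\<Sum>n\<in>I. \<bar>\<theta> n\<bar>)"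
          by (simp add: sum.distrib sum_distrib_left)
        \<comment> \<open>One factor \<open>prob (N m q)\<close> is used up by the number of times,
          which is at most \<open>exp (- (\<epsilon> * m)) / prob (N m q)\<close>; the other
          survives for the summation over cells.\<close>
        also have "\<dots> \<le> exp (- (\<epsilon> * real m)) * prob (N m q) + E m"
        proof (rule add_mono)
          have "card I \<le> card {1..T}"
          proof (rule card_mono)
            show "I \<subseteq> {1..T}"
            proof
              fix n assume n: "n \<in> I"
              then have "exp (a * real m) \<le> real n" by (simp add: I_def)
              then have "0 < real n" using exp_gt_zero[of "a * real m"] by linarith
              then show "n \<in> {1..T}" using n by (simp add: I_def)
            qed
          qed simp
          then have "real (card I) \<le> exp (- (\<epsilon> * real m)) / prob (N m q)" using T[of "card I"] by simp
          then have "real (card I) * prob (N m q) \<le> exp (- (\<epsilon> * real m))" using Npos by (simp add: field_simps)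
          then show "real (card I) * (prob (N m q))\<^sup>2 \<le> exp (- (\<epsilon> * real m)) * prob (N m q)"
            using Npos by (simp add: power2_eq_square mult.assoc[symmetric])
          have "(\<Sum>n\<in>I. \<bar>\<theta> n\<bar>) \<le> c * exp (a * real m) powr - p"
            by (rule c(2)[OF _ I]) (auto simp: I_def)
          then show "4 * exp (2 * real m) * (\<Sum>n\<in>I. \<bar>\<theta> n\<bar>) \<le> E m"
            unfolding E_def by (intro mult_left_mono) auto
        qed
        finally show ?thesis .
      qed
      ultimately show ?thesis by (simp add: N_def)
    qed
  qed
  have E_eq: "E m = 4 * c * exp (- (real d * real m) - real m)" for m
  proof -
    have "exp (a * real m) powr - p = exp (- (real d + 3) * real m)"
      using pos by (simp add: exp_powr_real p_def field_simps)
    then show ?thesis unfolding E_def by (simp add: exp_add[symmetric] algebra_simps)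
  qed
  let ?C1 = "real ((2 * K + 1) ^ DIM('a))" and ?C2 = "(2 * R * real d + 5) ^ d * (4 * c)"
  have bound: "prob (B m) \<le> exp (- (\<epsilon> * real m)) * ?C1 + exp (- (1 * real m)) * ?C2"
    if "4 * exp (- real m) < \<delta>" for m
  proof -
    have "real (card (?F m)) * E m \<le> (2 * R * real d + 5) ^ d * exp (real d * real m) * E m"
      by (intro mult_right_mono card E0)
    also have "\<dots> = exp (- (1 * real m)) * ?C2"
      unfolding E_eq by (simp add: exp_diff exp_minus field_simps)
    finally show ?thesis using main[OF that] by linarith
  qed
  have "((\<lambda>m::nat. 4 * exp (- real m)) \<longlongrightarrow> 4 * 0) sequentially"
    by (intro tendsto_mult tendsto_const filterlim_compose[OF exp_at_bot])
       (simp add: filterlim_uminus_at_bot filterlim_real_sequentially)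
  then have "eventually (\<lambda>m. 4 * exp (- real m) < \<delta>) sequentially"
    by (rule order_tendstoD(2)) (use pos(3) in simp)
  then have "eventually (\<lambda>m. norm (prob (B m)) \<le> exp (- (\<epsilon> * real m)) * ?C1 + exp (- (1 * real m)) * ?C2) sequentially"
    by (rule eventually_mono) (use bound in simp)
  then have "summable (\<lambda>m. prob (B m))"
    by (rule summable_comparison_test_ev)
       (intro summable_add summable_mult2 summable_exp_neg pos zero_less_one)
  from borel_cantelli_eventually[OF B this] show ?thesis
  proof eventually_elim
    case (elim y)
    show ?case
    proof
      assume y: "norm y \<le> R \<and> ball y \<delta> \<subseteq> V"
      from elim show "eventually (\<lambda>m. \<forall>n. exp (a * real m) \<le> real n
        \<longrightarrow> real n * prob (grid_nbhd m K (grid m y)) \<le> exp (- (\<epsilon> * real m))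
        \<longrightarrow> y \<notin> close_return m n) sequentially"
      proof eventually_elim
        case (elim m)
        show ?case
        proof (intro allI impI notI)
          fix n assume "exp (a * real m) \<le> real n"
            "real n * prob (grid_nbhd m K (grid m y)) \<le> exp (- (\<epsilon> * real m))"
            "y \<in> close_return m n"
          then have "y \<in> B m" unfolding B_def P_def N_def using y by blast
          then show False using elim by blast
        qed
      qed
    qed
  qed
qed

subsection \<open>Ergodicity from local decay of correlations\<close>

lemma sq_integral_le:
  fixes u :: "'a \<Rightarrow> real"
  assumes "integrable M u" "integrable M (\<lambda>x. (u x)\<^sup>2)"
  shows "(\<integral>x. u x \<partial>M)\<^sup>2 \<le> (\<integral>x. (u x)\<^sup>2 \<partial>M)"
  using variance_positive[of u] variance_eq[OF assms] by linarith

text \<open>\<open>E\<close> and its preimage have the same finite measure, so an inclusion between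
  them up to null sets is an equality up to null sets.\<close>

lemma AE_invariant:
  assumes E: "E \<in> sets M" and inv: "AE x in M. x \<in> E \<longrightarrow> f x \<in> E"
  shows "AE x in M. \<forall>n. (f ^^ n) x \<in> E \<longleftrightarrow> x \<in> E"
proof -
  let ?F = "(f ^^ 1) -` E"
  have F: "?F \<in> sets M" using E by (rule iter_sets)
  have "AE x in M. x \<in> E \<longrightarrow> x \<in> ?F" using inv by simp
  then have "AE x in M. x \<notin> E - ?F" by eventually_elim blast
  then have "E - ?F \<in> null_sets M" using AE_iff_null_sets sets.Diff[OF E F] by blast
  then have "prob (E - ?F) = 0" by (rule measure_eq_0_null_sets)
  then have "prob (E \<inter> ?F) = prob E"
    using finite_measure_Diff'[OF E F] by simp
  then have "prob (?F - E) = 0"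
    using finite_measure_Diff'[OF F E] measure_iter[OF E, of 1] by (simp add: Int_commute)
  then have "?F - E \<in> null_sets M"
    using E F by (auto simp: null_sets_def emeasure_eq_measure)
  then have "AE x in M. x \<notin> ?F - E" by (rule AE_not_in)
  then have "AE x in M. f x \<in> E \<longleftrightarrow> x \<in> E"
    using inv by eventually_elim auto
  from AE_iter[OF this] show ?thesis
  proof eventually_elim
    case (elim x)
    show ?case
    proof
      fix n show "(f ^^ n) x \<in> E \<longleftrightarrow> x \<in> E"
        by (induction n) (use elim in auto)
    qed
  qed
qed

text \<open>Averaging along the multiples of \<open>m\<close> makes all off-diagonal correlations small at once.\<close>

lemma variance_average_le:
  fixes \<phi> :: "'a \<Rightarrow> real"
  assumes meas: "\<phi> \<in> borel_measurable M" and b: "\<And>x. 0 \<le> \<phi> x" "\<And>x. \<phi> x \<le> 1"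
    and cor: "\<And>n. n \<ge> m \<Longrightarrow> \<bar>(\<integral>x. \<phi> ((f ^^ n) x) * \<phi> x \<partial>M) - (\<integral>x. \<phi> x \<partial>M)\<^sup>2\<bar> \<le> \<eta>" and m: "m \<ge> 1"
    and eta: "\<eta> \<ge> 0" and N: "N \<ge> 1"
  shows "(\<integral>x. ((\<Sum>i<N. \<phi> ((f ^^ (i * m)) x) - (\<integral>x. \<phi> x \<partial>M)) / real N)\<^sup>2 \<partial>M) \<le> 1 / real N + \<eta>"
proof -
  define c where "c = (\<integral>x. \<phi> x \<partial>M)"
  define D where "D i x = \<phi> ((f ^^ (i * m)) x) - c" for i x
  have D_meas [measurable]: "D i \<in> borel_measurable M" for i
    unfolding D_def using meas measurable_compose[OF iter_meas meas] by measurable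
  have c: "0 \<le> c" "c \<le> 1"
    using integral_nonneg_AE[of \<phi> M] integral_mono[OF integrable_unit[OF meas b], of "\<lambda>_. 1"] b prob_space
    by (auto simp: c_def)
  have Db: "\<bar>D i x\<bar> \<le> 1" for i x
    using b[of "(f ^^ (i * m)) x"] c unfolding D_def by (simp add: abs_le_iff)
  have DDb: "\<bar>D i x * D j x\<bar> \<le> 1" for i j x
    using mult_mono[OF Db[of i x] Db[of j x]] by (simp add: abs_mult)
  have int: "integrable M (\<lambda>x. D i x * D j x)" for i j
    by (rule integrable_const_bound[of _ 1]) (use DDb in auto)
  have DD_le1: "(\<integral>x. D i x * D j x \<partial>M) \<le> 1" for i j
  proof -
    have "(\<integral>x. D i x * D j x \<partial>M) \<le> (\<integral>x. 1 \<partial>M)"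
      by (rule integral_mono[OF int]) (use abs_le_D1[OF DDb] in auto)
    then show ?thesis by simp
  qed
  \<comment> \<open>By invariance of the measure the pair of times \<open>i * m\<close>,
    \<open>j * m\<close> may be shifted to \<open>0\<close>, \<open>(j - i) * m\<close>, and the gap
    is at least \<open>m\<close>.\<close>
  have off: "(\<integral>x. D i x * D j x \<partial>M) \<le> \<eta>" if "i < j" for i j
  proof -
    have ge: "(j - i) * m \<ge> m" using that by (cases "j - i") auto
    define n where "n = (j - i) * m"
    have eq: "(f ^^ (j * m)) x = (f ^^ n) ((f ^^ (i * m)) x)" for x
    proof -
      have "j * m = n + i * m" unfolding n_def using that by (simp add: diff_mult_distrib)
      then show ?thesis by (simp add: funpow_add)
    qed
    have in1: "integrable M \<phi>" by (rule integrable_unit[OF meas b])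
    have in2: "integrable M (\<lambda>x. \<phi> ((f ^^ n) x))" by (rule integrable_iter[OF in1])
    have in3: "integrable M (\<lambda>x. \<phi> ((f ^^ n) x) * \<phi> x)"
      by (rule integrable_unit) (use b meas measurable_compose[OF iter_meas meas] in \<open>auto intro!: mult_le_one\<close>)
    have m3: "(\<lambda>y. (\<phi> ((f ^^ n) y) - c) * (\<phi> y - c)) \<in> borel_measurable M"
      using meas measurable_compose[OF iter_meas meas] by measurable
    have "(\<integral>x. D i x * D j x \<partial>M) = (\<integral>x. (\<lambda>y. (\<phi> ((f ^^ n) y) - c) * (\<phi> y - c)) ((f ^^ (i * m)) x) \<partial>M)"
      unfolding D_def eq by (simp add: mult.commute)
    also have "\<dots> = (\<integral>y. (\<phi> ((f ^^ n) y) - c) * (\<phi> y - c) \<partial>M)"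
      by (rule integral_iter[OF m3])
    also have "\<dots> = (\<integral>y. \<phi> ((f ^^ n) y) * \<phi> y - c * \<phi> ((f ^^ n) y) - c * \<phi> y + c * c \<partial>M)"
      by (intro Bochner_Integration.integral_cong) (auto simp: algebra_simps)
    also have "\<dots> = (\<integral>y. \<phi> ((f ^^ n) y) * \<phi> y \<partial>M) - c * (\<integral>y. \<phi> ((f ^^ n) y) \<partial>M) - c * (\<integral>y. \<phi> y \<partial>M) + c * c"
      using in1 in2 in3 by simp
    also have "(\<integral>y. \<phi> ((f ^^ n) y) \<partial>M) = c" unfolding c_def by (rule integral_iter[OF meas])
    finally have "(\<integral>x. D i x * D j x \<partial>M) = (\<integral>y. \<phi> ((f ^^ n) y) * \<phi> y \<partial>M) - c\<^sup>2"
      by (simp add: c_def[symmetric] power2_eq_square)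
    also have "\<dots> \<le> \<eta>" using cor[of n] ge unfolding c_def n_def by linarith
    finally show ?thesis .
  qed
  have DD: "(\<integral>x. D i x * D j x \<partial>M) \<le> (if i = j then 1 else 0) + \<eta>" for i j
    using off[of i j] off[of j i] DD_le1[of i i] eta by (cases i j rule: linorder_cases) (auto simp: mult.commute)
  have "(\<integral>x. ((\<Sum>i<N. D i x) / real N)\<^sup>2 \<partial>M) = (\<integral>x. (\<Sum>i<N. \<Sum>j<N. D i x * D j x) / (real N)\<^sup>2 \<partial>M)"
    by (intro Bochner_Integration.integral_cong refl) (simp add: power_divide power2_eq_square sum_product)
  also have "\<dots> = (\<Sum>i<N. \<Sum>j<N. (\<integral>x. D i x * D j x \<partial>M)) / (real N)\<^sup>2"
    using int by (simp add: Bochner_Integration.integral_sum Bochner_Integration.integrable_sum)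
  also have "\<dots> \<le> (\<Sum>i<N. \<Sum>j<N. (if i = j then 1 else 0) + \<eta>) / (real N)\<^sup>2"
    by (intro divide_right_mono sum_mono DD) simp
  also have "(\<Sum>i<N. \<Sum>j<N. (if i = j then 1 else 0) + \<eta>) = real N + (real N)\<^sup>2 * \<eta>"
    by (simp add: sum.distrib power2_eq_square algebra_simps)
  also have "(real N + (real N)\<^sup>2 * \<eta>) / (real N)\<^sup>2 = 1 / real N + \<eta>"
    using N by (simp add: field_simps power2_eq_square)
  finally show ?thesis unfolding D_def c_def .
qed

text \<open>The indicator of \<open>E\<close> is not Lipschitz, so its correlation with
  \<open>\<phi>\<close> is not controlled directly. But invariance of \<open>E\<close> allows
  \<open>\<phi>\<close> to be replaced by its time averages under the integral, and
  self-correlations of \<open>\<phi>\<close> alone make these averages close in the quadratic mean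
  to a constant.\<close>

lemma integral_invariant_set:
  fixes \<phi> :: "'a \<Rightarrow> real"
  assumes E: "E \<in> sets M" and inv: "AE x in M. \<forall>n. (f ^^ n) x \<in> E \<longleftrightarrow> x \<in> E"
    and meas: "\<phi> \<in> borel_measurable M" and b: "\<And>x. 0 \<le> \<phi> x" "\<And>x. \<phi> x \<le> 1"
    and cor: "(\<lambda>n. (\<integral>x. \<phi> ((f ^^ n) x) * \<phi> x \<partial>M)) \<longlonglongrightarrow> (\<integral>x. \<phi> x \<partial>M)\<^sup>2"
  shows "(\<integral>x. indicator E x * \<phi> x \<partial>M) = prob E * (\<integral>x. \<phi> x \<partial>M)"
proof -
  define c where "c = (\<integral>x. \<phi> x \<partial>M)"
  define s where "s = (\<integral>x. indicator E x * \<phi> x \<partial>M) - prob E * c"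
  have \<phi>int: "integrable M \<phi>" by (rule integrable_unit[OF meas b])
  have E\<phi>: "integrable M (\<lambda>x. indicator E x * \<phi> x)"
    using integrable_mult_indicator[OF E \<phi>int] by simp
  have shift: "(\<integral>x. indicator E x * \<phi> ((f ^^ n) x) \<partial>M) = (\<integral>x. indicator E x * \<phi> x \<partial>M)" for n
  proof -
    have mm: "(\<lambda>y. indicator E y * \<phi> y) \<in> borel_measurable M" using E\<phi> by simp
    have "(\<integral>x. indicator E x * \<phi> ((f ^^ n) x) \<partial>M) = (\<integral>x. (\<lambda>y. indicator E y * \<phi> y) ((f ^^ n) x) \<partial>M)"
    proof (rule integral_cong_AE)
      show "(\<lambda>x. indicator E x * \<phi> ((f ^^ n) x)) \<in> borel_measurable M"
        using E measurable_compose[OF iter_meas meas] by measurable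
      show "(\<lambda>x. (\<lambda>y. indicator E y * \<phi> y) ((f ^^ n) x)) \<in> borel_measurable M"
        by (rule measurable_compose[OF iter_meas mm])
      show "AE x in M. indicator E x * \<phi> ((f ^^ n) x) = (\<lambda>y. indicator E y * \<phi> y) ((f ^^ n) x)"
        using inv by eventually_elim (auto simp: indicator_def)
    qed
    also have "\<dots> = (\<integral>x. indicator E x * \<phi> x \<partial>M)" by (rule integral_iter[OF mm])
    finally show ?thesis .
  qed
  have s_le: "s\<^sup>2 \<le> 1 / real N + \<eta>" if "\<eta> > 0" "N \<ge> 1" for N \<eta>
  proof -
    have "eventually (\<lambda>n. dist (\<integral>x. \<phi> ((f ^^ n) x) * \<phi> x \<partial>M) (c\<^sup>2) < \<eta>) sequentially"
      using tendstoD[OF cor that(1)] unfolding c_def .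
    then obtain m0 where m0: "\<And>n. n \<ge> m0 \<Longrightarrow> dist (\<integral>x. \<phi> ((f ^^ n) x) * \<phi> x \<partial>M) (c\<^sup>2) < \<eta>"
      unfolding eventually_sequentially by blast
    define m where "m = Suc m0"
    have cor': "\<bar>(\<integral>x. \<phi> ((f ^^ n) x) * \<phi> x \<partial>M) - (\<integral>x. \<phi> x \<partial>M)\<^sup>2\<bar> \<le> \<eta>" if "n \<ge> m" for n
      using m0[of n] that unfolding m_def c_def dist_real_def by auto
    define u where "u x = (\<Sum>i<N. \<phi> ((f ^^ (i * m)) x) - c) / real N" for x
    have var: "(\<integral>x. (u x)\<^sup>2 \<partial>M) \<le> 1 / real N + \<eta>"
      using variance_average_le[of \<phi> m \<eta> N, OF meas b cor'] that unfolding u_def c_def m_def by auto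
    have Ii: "integrable M (\<lambda>x. \<phi> ((f ^^ n) x) - c)" for n
      using integrable_iter[OF \<phi>int, of n] by simp
    have uint: "integrable M u" unfolding u_def by (intro Bochner_Integration.integrable_divide Bochner_Integration.integrable_sum Ii)
    have ub: "\<bar>u x\<bar> \<le> 1 + \<bar>c\<bar>" for x
    proof -
      have "\<bar>\<Sum>i<N. \<phi> ((f ^^ (i * m)) x) - c\<bar> \<le> (\<Sum>i<N. 1 + \<bar>c\<bar>)"
        using b by (intro order_trans[OF sum_abs] sum_mono) (smt (verit))
      then show ?thesis using that(2) unfolding u_def by (simp add: field_simps)
    qed
    have u2: "(u x)\<^sup>2 \<le> (1 + \<bar>c\<bar>)\<^sup>2" for x using ub[of x] by (metis abs_ge_zero power2_abs power_mono)
    have u2int: "integrable M (\<lambda>x. (u x)\<^sup>2)"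
      by (rule integrable_const_bound[of _ "(1 + \<bar>c\<bar>)\<^sup>2"]) (use u2 uint in auto)
    have Eu: "integrable M (\<lambda>x. indicator E x * u x)"
      using integrable_mult_indicator[OF E uint] by simp
    have Eu2: "integrable M (\<lambda>x. (indicator E x * u x)\<^sup>2)"
    proof -
      have "(indicator E x * u x)\<^sup>2 = indicator E x * (u x)\<^sup>2" for x by (auto simp: indicator_def)
      then show ?thesis using integrable_mult_indicator[OF E u2int] by simp
    qed
    have "(\<integral>x. indicator E x * u x \<partial>M) = (\<Sum>i<N. (\<integral>x. indicator E x * \<phi> ((f ^^ (i * m)) x) \<partial>M) - prob E * c) / real N"
    proof -
      have i1: "integrable M (\<lambda>x. indicator E x * \<phi> ((f ^^ n) x))" for n
        using integrable_mult_indicator[OF E integrable_iter[OF \<phi>int, of n]] by simp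
      have i2: "integrable M (\<lambda>x. indicator E x * c)"
        using integrable_mult_indicator[OF E, of "\<lambda>_. c"] by simp
      have "(\<integral>x. indicator E x * u x \<partial>M) = (\<integral>x. (\<Sum>i<N. indicator E x * \<phi> ((f ^^ (i * m)) x) - indicator E x * c) / real N \<partial>M)"
        unfolding u_def by (intro Bochner_Integration.integral_cong refl) (simp add: sum_distrib_left algebra_simps)
      also have "\<dots> = (\<Sum>i<N. (\<integral>x. indicator E x * \<phi> ((f ^^ (i * m)) x) \<partial>M) - (\<integral>x. indicator E x * c \<partial>M)) / real N"
        using i1 i2 by (simp only: integral_divide_zero Bochner_Integration.integral_sum Bochner_Integration.integrable_diff Bochner_Integration.integral_diff)
      also have "(\<integral>x. indicator E x * c \<partial>M) = prob E * c" using E by simp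
      finally show ?thesis .
    qed
    also have "\<dots> = s" unfolding shift s_def using that(2) by simp
    finally have "s\<^sup>2 \<le> (\<integral>x. (indicator E x * u x)\<^sup>2 \<partial>M)"
      using sq_integral_le[OF Eu Eu2] by simp
    also have "\<dots> \<le> (\<integral>x. (u x)\<^sup>2 \<partial>M)"
      by (rule integral_mono[OF Eu2 u2int]) (auto simp: indicator_def)
    finally show ?thesis using var by linarith
  qed
  have "s\<^sup>2 \<le> 0"
  proof (rule field_le_epsilon)
    fix e :: real assume e: "e > 0"
    obtain N :: nat where N: "1 / real (Suc N) < e / 2" using reals_Archimedean[of "e / 2"] e by (auto simp: inverse_eq_divide)
    show "s\<^sup>2 \<le> 0 + e" using s_le[of "e / 2" "Suc N"] e N by simp
  qed
  then show ?thesis by (simp add: s_def c_def)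
qed

definition local_decay :: "'a set set \<Rightarrow> ('a set \<Rightarrow> nat \<Rightarrow> real) \<Rightarrow> bool" where
  "local_decay \<V> \<theta> \<longleftrightarrow> open_partition_mod M \<V> \<and> (\<forall>V\<in>\<V>. superpoly_null (\<theta> V) \<and> decay_on M f (\<theta> V) V)"

lemma superpoly_null_tendsto: "superpoly_null \<theta> \<Longrightarrow> \<theta> \<longlonglongrightarrow> 0"
proof -
  assume "superpoly_null \<theta>"
  then have "(\<lambda>n. real n powr 1 * \<theta> n) \<longlonglongrightarrow> 0" unfolding superpoly_null_def by (drule_tac spec[of _ 1]) simp
  moreover have "eventually (\<lambda>n. norm (\<theta> n) \<le> norm (real n powr 1 * \<theta> n)) sequentially"
    using eventually_ge_at_top[of 1] by eventually_elim (auto simp: abs_mult mult_le_cancel_right1)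
  ultimately show ?thesis by (rule tendsto_0_le[where K=1, simplified])
qed

lemma decay_on_tendsto:
  fixes \<phi> :: "'a \<Rightarrow> real"
  assumes "superpoly_null \<theta>" "decay_on M f \<theta> V" "\<And>x. 0 \<le> \<phi> x" "\<And>x. \<phi> x \<le> 1" "L-lipschitz_on UNIV \<phi>"
    "closed_support \<phi> \<subseteq> V"
  shows "(\<lambda>n. (\<integral>x. \<phi> ((f ^^ n) x) * \<phi> x \<partial>M)) \<longlonglongrightarrow> (\<integral>x. \<phi> x \<partial>M)\<^sup>2"
proof (rule LIM_zero_cancel, rule Lim_null_comparison)
  show "(\<lambda>n. (1 + L)\<^sup>2 * \<bar>\<theta> n\<bar>) \<longlonglongrightarrow> 0"
    using tendsto_mult_right_zero[OF tendsto_rabs_zero[OF superpoly_null_tendsto[OF assms(1)]]] .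
qed (use decay_onD[OF assms(2-6)] in \<open>auto intro!: always_eventually\<close>)

lemma measure_invariant_open:
  assumes E: "E \<in> sets M" and inv: "AE x in M. \<forall>n. (f ^^ n) x \<in> E \<longleftrightarrow> x \<in> E"
    and V: "superpoly_null \<theta>" "decay_on M f \<theta> V" and U: "open U" "U \<subseteq> V"
  shows "prob (E \<inter> U) = prob E * prob U"
proof (cases "U = UNIV")
  case True
  then show ?thesis using prob_space E by simp
next
  case False
  \<comment> \<open>Subtracting 1 keeps the closed support inside \<open>U\<close>: where
    \<open>\<phi> k\<close> is nonzero, the distance to the complement is at least
    \<open>1 / k\<close>. The case \<open>U = UNIV\<close> had to be split off because
    \<open>infdist x {} = 0\<close>.\<close>
  define \<phi> where "\<phi> k x = max 0 (min 1 (real k * infdist x (- U) - 1))" for k x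
  have b: "0 \<le> \<phi> k x" "\<phi> k x \<le> 1" for k x by (auto simp: \<phi>_def)
  have L: "(real k)-lipschitz_on UNIV (\<phi> k)" for k
  proof (rule lipschitz_onI)
    fix x y
    have "\<bar>real k * infdist x (- U) - real k * infdist y (- U)\<bar> \<le> real k * dist x y"
      using infdist_triangle_abs[of x "- U" y] by (simp add: right_diff_distrib[symmetric] abs_mult mult_left_mono)
    then show "dist (\<phi> k x) (\<phi> k y) \<le> real k * dist x y"
      unfolding \<phi>_def dist_real_def by (auto simp: max_def min_def abs_le_iff)
  qed simp
  have meas: "\<phi> k \<in> borel_measurable M" for k by (rule lipschitz_meas[OF L])
  have U0: "infdist x (- U) = 0" if "x \<notin> U" for x using that by simp
  have Upos: "infdist x (- U) > 0" if "x \<in> U" for x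
    using in_closed_iff_infdist_zero[of "- U" x] that U False infdist_nonneg[of x "- U"] by fastforce
  have supp: "closed_support (\<phi> k) \<subseteq> V" for k
  proof -
    have "closed {x. 1 \<le> real k * infdist x (- U)}"
      by (intro closed_Collect_le continuous_intros)
    moreover have "{x. \<phi> k x \<noteq> 0} \<subseteq> {x. 1 \<le> real k * infdist x (- U)}"
      by (auto simp: \<phi>_def max_def split: if_splits)
    ultimately have "closed_support (\<phi> k) \<subseteq> {x. 1 \<le> real k * infdist x (- U)}"
      unfolding closed_support_def by (rule closure_minimal[rotated])
    also have "\<dots> \<subseteq> U"
    proof
      fix x assume "x \<in> {x. 1 \<le> real k * infdist x (- U)}"
      then show "x \<in> U" by (cases "x \<in> U") (auto simp: U0)
    qed
    finally show ?thesis using U by blast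
  qed
  have lim: "(\<lambda>k. \<phi> k x) \<longlonglongrightarrow> indicator U x" for x
  proof (cases "x \<in> U")
    case True
    obtain k0 :: nat where k0: "2 / infdist x (- U) \<le> real k0" using real_arch_simple by blast
    have "\<phi> k x = 1" if "k \<ge> k0" for k
    proof -
      have "2 / infdist x (- U) \<le> real k" using k0 that by linarith
      then have "2 \<le> real k * infdist x (- U)" using Upos[OF True] by (simp add: field_simps)
      then show ?thesis by (simp add: \<phi>_def)
    qed
    then have "eventually (\<lambda>k. \<phi> k x = indicator U x) sequentially"
      using True by (auto simp: eventually_sequentially)
    then show ?thesis by (rule tendsto_eventually)
  qed (simp add: \<phi>_def U0)
  have Um: "U \<in> sets M" using U by (simp add: sets_M)
  have eq: "(\<integral>x. indicator E x * \<phi> k x \<partial>M) = prob E * (\<integral>x. \<phi> k x \<partial>M)" for k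
    by (rule integral_invariant_set[OF E inv meas b decay_on_tendsto[OF V b L supp]])
  have l1: "(\<lambda>k. \<integral>x. \<phi> k x \<partial>M) \<longlonglongrightarrow> (\<integral>x. indicator U x \<partial>M)"
    by (rule integral_dominated_convergence[where w="\<lambda>_. 1"]) (use Um meas lim b in auto)
  have l2: "(\<lambda>k. \<integral>x. indicator E x * \<phi> k x \<partial>M) \<longlonglongrightarrow> (\<integral>x. indicator E x * indicator U x \<partial>M)"
  proof (rule integral_dominated_convergence[where w="\<lambda>_. 1"])
    show "AE x in M. (\<lambda>k. indicator E x * \<phi> k x) \<longlonglongrightarrow> indicator E x * indicator U x"
      by (intro AE_I2 tendsto_mult tendsto_const lim)
  qed (use Um E meas b in \<open>auto simp: indicator_def\<close>)
  have "(\<integral>x. indicator E x * indicator U x \<partial>M) = prob E * (\<integral>x. (indicator U x :: real) \<partial>M)"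
    using LIMSEQ_unique[OF l2] tendsto_mult_left[OF l1, of "prob E"] unfolding eq by blast
  then show ?thesis using E Um by (simp add: indicator_inter_arith[symmetric])
qed

lemma open_partition_countable:
  assumes "open_partition_mod M \<V>" shows "countable \<V>"
proof (rule countable_disjoint_open_subsets)
  show "open S" if "S \<in> \<V>" for S using assms that by (auto simp: open_partition_mod_def)
  show "pairwise disjnt \<V>"
    using assms by (auto simp: open_partition_mod_def disjoint_def pairwise_def disjnt_def)
qed

text \<open>Decay makes an invariant set \<open>E\<close> independent of the open subsets of \<open>V\<close>, hence, by outer
  regularity, of \<open>E \<inter> V\<close>.\<close>

lemma invariant_set_0_1:
  assumes ld: "local_decay \<V> \<theta>" and E: "E \<in> sets M" and inv: "AE x in M. x \<in> E \<longrightarrow> f x \<in> E"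
    and pos: "prob E > 0"
  shows "prob E = 1"
proof -
  have op: "open_partition_mod M \<V>" using ld by (simp add: local_decay_def)
  have Vm: "V \<in> sets M" if "V \<in> \<V>" for V using op that by (auto simp: open_partition_mod_def sets_M)
  have eqE: "prob (E \<inter> V) = prob E * prob (E \<inter> V)" if V: "V \<in> \<V>" for V
  proof -
    have Vd: "superpoly_null (\<theta> V)" "decay_on M f (\<theta> V) V" "open V"
      using ld V by (auto simp: local_decay_def open_partition_mod_def)
    have EV: "E \<inter> V \<in> sets borel" using E Vm[OF V] by (auto simp: sets_M)
    have "prob E * prob (E \<inter> V) \<le> prob (E \<inter> V)"
      using prob_le_1[of E] by (simp add: mult_left_le_one_le)
    moreover have "prob (E \<inter> V) \<le> prob E * prob (E \<inter> V)"
    proof (rule field_le_epsilon)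
      fix e :: real assume e: "e > 0"
      have "emeasure M (E \<inter> V) = (INF U \<in> {U. E \<inter> V \<subseteq> U \<and> open U}. emeasure M U)"
        by (rule outer_regular[OF sets_M _ EV]) simp
      moreover have "emeasure M (E \<inter> V) < emeasure M (E \<inter> V) + ennreal e"
        using e by (simp add: emeasure_eq_measure ennreal_plus[symmetric] ennreal_less_iff del: ennreal_plus)
      ultimately obtain U where U: "E \<inter> V \<subseteq> U" "open U" "emeasure M U < emeasure M (E \<inter> V) + ennreal e"
        by (metis (mono_tags, lifting) INF_less_iff mem_Collect_eq)
      have Um: "U \<in> sets M" using U by (simp add: sets_M)
      have "E \<inter> (U \<inter> V) = E \<inter> V" using U by blast
      then have 1: "prob (E \<inter> V) = prob E * prob (U \<inter> V)"
        using measure_invariant_open[OF E AE_invariant[OF E inv] Vd(1,2), of "U \<inter> V"] U(2) Vd(3) by (simp add: open_Int)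
      have "prob (U \<inter> V) \<le> prob U" by (intro finite_measure_mono) (use Um in auto)
      also have "\<dots> \<le> prob (E \<inter> V) + e"
        using U(3) e by (simp add: emeasure_eq_measure ennreal_plus[symmetric] ennreal_less_iff del: ennreal_plus)
      finally have "prob E * prob (U \<inter> V) \<le> prob E * (prob (E \<inter> V) + e)"
        by (intro mult_left_mono) auto
      also have "\<dots> \<le> prob E * prob (E \<inter> V) + e"
        using prob_le_1[of E] e by (simp add: distrib_left mult_left_le_one_le)
      finally show "prob (E \<inter> V) \<le> prob E * prob (E \<inter> V) + e" using 1 by simp
    qed
    ultimately show ?thesis by linarith
  qed
  \<comment> \<open>For such a \<open>V\<close> the identity \<open>eqE\<close> can be divided by
    \<open>prob (E \<inter> V)\<close>. Countability of the partition excludes that a set of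
    positive measure meets every \<open>V\<close> in a null set.\<close>
  have "\<exists>V\<in>\<V>. prob (E \<inter> V) \<noteq> 0"
  proof (rule ccontr)
    assume "\<not> ?thesis"
    then have "E \<inter> V \<in> null_sets M" if "V \<in> \<V>" for V
      using that E Vm[OF that] by (auto simp: null_sets_def emeasure_eq_measure)
    then have "(\<Union>V\<in>\<V>. E \<inter> V) \<in> null_sets M"
      using open_partition_countable[OF op] by (intro null_sets_UN') auto
    then have "AE x in M. x \<notin> (\<Union>V\<in>\<V>. E \<inter> V)" by (rule AE_not_in)
    moreover have "AE x in M. x \<in> \<Union>\<V>" using op by (simp add: open_partition_mod_def)
    ultimately have "AE x in M. x \<notin> E" by eventually_elim auto
    then have "prob E = 0" using E by (simp add: AE_iff_null_sets measure_eq_0_null_sets)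
    then show False using pos by simp
  qed
  then show ?thesis using eqE by auto
qed

subsection \<open>The maximal inequality\<close>

text \<open>The maximum of 0 and of the Birkhoff sums of \<open>g\<close> of length at most
  \<open>N\<close>, written so that the recursion behind Garsia's proof is the definition.\<close>

primrec max_sum :: "('a \<Rightarrow> real) \<Rightarrow> nat \<Rightarrow> 'a \<Rightarrow> real" where
  "max_sum g 0 = (\<lambda>x. 0)"
| "max_sum g (Suc N) = (\<lambda>x. max 0 (g x + max_sum g N (f x)))"

lemma max_sum_nonneg: "0 \<le> max_sum g N x"
  by (cases N) auto

lemma max_sum_mono: "max_sum g N x \<le> max_sum g (Suc N) x"
proof (induction N arbitrary: x)
  case (Suc N)
  from Suc[of "f x"] show ?case by (subst (1 2) max_sum.simps(2)) (simp del: max_sum.simps)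
qed simp

lemma sum_le_max_sum: "n \<le> N \<Longrightarrow> (\<Sum>k<n. g ((f ^^ k) x)) \<le> max_sum g N x"
proof (induction N arbitrary: n x)
  case (Suc N)
  show ?case
  proof (cases n)
    case (Suc n')
    have "(\<Sum>k<n. g ((f ^^ k) x)) = g x + (\<Sum>k<n'. g ((f ^^ k) (f x)))"
      unfolding Suc sum.lessThan_Suc_shift by (simp add: funpow_swap1)
    also have "\<dots> \<le> g x + max_sum g N (f x)" using Suc.IH[of n' "f x"] Suc.prems Suc by simp
    finally show ?thesis by simp
  qed (use max_sum_nonneg[of g "Suc N" x] in simp)
qed simp

lemma max_sum_integrable:
  assumes "integrable M g" shows "integrable M (max_sum g N)"
proof (induction N)
  case (Suc N)
  then show ?case using assms integrable_iter[OF Suc, of 1] by simp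
qed simp

text \<open>Garsia's argument.\<close>

lemma maximal_inequality_finite:
  assumes g: "integrable M g"
  shows "0 \<le> (\<integral>x. indicator {x. 0 < max_sum g N x} x * g x \<partial>M)"
proof -
  let ?E = "{x. 0 < max_sum g N x}"
  note i = max_sum_integrable[OF g, of N]
  have "{x\<in>space M. 0 < max_sum g N x} \<in> sets M" using i by measurable
  then have E: "?E \<in> sets M" by simp
  have ig: "integrable M (\<lambda>x. indicator ?E x * g x)"
    using integrable_mult_indicator[OF E g] by simp
  have i2: "integrable M (\<lambda>x. max_sum g N (f x))" using integrable_iter[OF i, of 1] by simp
  \<comment> \<open>On the set where the maximum is positive, the recursion and monotonicity in
    \<open>N\<close> give the pointwise bound; elsewhere the left side is 0. The two integrals of
    \<open>max_sum g N\<close> then cancel by invariance.\<close>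
  have "(\<integral>x. max_sum g N x \<partial>M) \<le> (\<integral>x. indicator ?E x * g x + max_sum g N (f x) \<partial>M)"
  proof (rule integral_mono[OF i])
    show "integrable M (\<lambda>x. indicator ?E x * g x + max_sum g N (f x))" using ig i2 by simp
    fix x
    show "max_sum g N x \<le> indicator ?E x * g x + max_sum g N (f x)"
    proof (cases "x \<in> ?E")
      case True
      then obtain N' where N: "N = Suc N'" by (cases N) auto
      then have "max_sum g N x = g x + max_sum g N' (f x)" using True by (auto simp: max_def split: if_splits)
      also have "\<dots> \<le> g x + max_sum g N (f x)" using max_sum_mono[of g N' "f x"] unfolding N by simp
      finally show ?thesis using True by simp
    next
      case False
      then show ?thesis using max_sum_nonneg[of g N "f x"] by simp
    qed
  qed
  also have "\<dots> = (\<integral>x. indicator ?E x * g x \<partial>M) + (\<integral>x. max_sum g N x \<partial>M)"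
    using ig i2 integral_iter[of "max_sum g N" 1] i by simp
  finally show ?thesis by simp
qed

text \<open>The finite inequality for \<open>h - c\<close>, whose Birkhoff sum of length
  \<open>n\<close> is positive exactly when that of \<open>h\<close> exceeds \<open>c * n\<close>;
  the sets for increasing \<open>N\<close> exhaust the event.\<close>

lemma maximal_inequality:
  assumes h: "integrable M h" and nonneg: "\<And>x. 0 \<le> h x" and lam: "c > 0"
  shows "prob {x. \<exists>n. c * real n < (\<Sum>k<n. h ((f ^^ k) x))} \<le> (\<integral>x. h x \<partial>M) / c"
    and "{x. \<exists>n. c * real n < (\<Sum>k<n. h ((f ^^ k) x))} \<in> sets M"
proof -
  let ?A = "{x. \<exists>n. c * real n < (\<Sum>k<n. h ((f ^^ k) x))}"
  define g where "g x = h x - c" for x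
  have g: "integrable M g" unfolding g_def using h by simp
  define E where "E N = {x. 0 < max_sum g N x}" for N
  have E: "E N \<in> sets M" for N
  proof -
    have "{x\<in>space M. 0 < max_sum g N x} \<in> sets M" using max_sum_integrable[OF g, of N] by measurable
    then show ?thesis by (simp add: E_def)
  qed
  have hm: "(\<lambda>x. h ((f ^^ k) x)) \<in> borel_measurable M" for k
    using integrable_iter[OF h, of k] by simp
  have "{x\<in>space M. \<exists>n. c * real n < (\<Sum>k<n. h ((f ^^ k) x))} \<in> sets M" using hm by measurable
  then show "?A \<in> sets M" by simp
  have EN: "prob (E N) \<le> (\<integral>x. h x \<partial>M) / c" for N
  proof -
    have iE: "integrable M (\<lambda>x. indicator (E N) x * h x)" "integrable M (\<lambda>x. indicator (E N) x * c)"
      using integrable_mult_indicator[OF E h, of N] integrable_mult_indicator[OF E, of "\<lambda>_. c" N] by simp_all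
    have "0 \<le> (\<integral>x. indicator (E N) x * g x \<partial>M)"
      using maximal_inequality_finite[OF g, of N] unfolding E_def .
    also have "\<dots> = (\<integral>x. indicator (E N) x * h x - indicator (E N) x * c \<partial>M)"
      by (simp add: g_def right_diff_distrib)
    also have "\<dots> = (\<integral>x. indicator (E N) x * h x \<partial>M) - prob (E N) * c"
      using iE E by simp
    also have "(\<integral>x. indicator (E N) x * h x \<partial>M) \<le> (\<integral>x. h x \<partial>M)"
      by (rule integral_mono[OF iE(1) h]) (use nonneg in \<open>auto simp: indicator_def\<close>)
    finally show ?thesis using lam by (simp add: field_simps)
  qed
  have inc: "incseq E" unfolding E_def by (intro incseq_SucI) (use max_sum_mono less_le_trans in blast)
  have "?A \<subseteq> (\<Union>N. E N)"
  proof clarify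
    fix x n assume "c * real n < (\<Sum>k<n. h ((f ^^ k) x))"
    then have "0 < (\<Sum>k<n. g ((f ^^ k) x))" by (simp add: g_def sum_subtractf mult.commute)
    also have "\<dots> \<le> max_sum g n x" by (rule sum_le_max_sum) simp
    finally show "x \<in> (\<Union>N. E N)" by (auto simp: E_def)
  qed
  then have "prob ?A \<le> prob (\<Union>N. E N)"
    by (intro finite_measure_mono) (use E in auto)
  also have "\<dots> \<le> (\<integral>x. h x \<partial>M) / c"
    by (rule LIMSEQ_le_const2[OF finite_Lim_measure_incseq[OF _ inc]]) (use E EN in auto)
  finally show "prob ?A \<le> (\<integral>x. h x \<partial>M) / c" .
qed

text \<open>Takes the place of the pointwise ergodic theorem: an upper bound that is linear in
  \<open>n\<close>, with a constant depending on the point, is all that orbit expansion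
  requires.\<close>

lemma AE_sum_linear_growth:
  assumes h: "integrable M h" and nonneg: "\<And>x. 0 \<le> h x"
  shows "AE x in M. \<exists>c>0. \<forall>n. (\<Sum>k<n. h ((f ^^ k) x)) \<le> c * real n"
proof -
  define A where "A j = {x. \<exists>n. real (Suc j) * real n < (\<Sum>k<n. h ((f ^^ k) x))}" for j
  have A: "A j \<in> sets M" for j unfolding A_def by (rule maximal_inequality(2)[OF h nonneg]) simp
  have "prob (\<Inter>j. A j) \<le> (\<integral>x. h x \<partial>M) / real (Suc j)" for j
  proof -
    have "prob (\<Inter>j. A j) \<le> prob (A j)" by (intro finite_measure_mono A) auto
    also have "\<dots> \<le> (\<integral>x. h x \<partial>M) / real (Suc j)"
      unfolding A_def by (rule maximal_inequality(1)[OF h nonneg]) simp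
    finally show ?thesis .
  qed
  moreover have "(\<lambda>j. (\<integral>x. h x \<partial>M) / real (Suc j)) \<longlonglongrightarrow> 0"
    using LIMSEQ_Suc[OF lim_const_over_n] by simp
  ultimately have "prob (\<Inter>j. A j) \<le> 0"
    by (intro LIMSEQ_le_const) auto
  then have "(\<Inter>j. A j) \<in> null_sets M"
    using A by (auto simp: null_sets_def emeasure_eq_measure measure_le_0_iff)
  then have "AE x in M. x \<notin> (\<Inter>j. A j)" by (rule AE_not_in)
  then show ?thesis
  proof eventually_elim
    case (elim x)
    then obtain j where "x \<notin> A j" by blast
    then show ?case by (intro exI[of _ "real (Suc j)"]) (auto simp: A_def not_less)
  qed
qed

end

subsection \<open>Counting words with many repetitions\<close>

text \<open>Words are parsed from the left but decoded from the right: a block that repeats what stands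
  \<open>\<tau>\<close> places further right, possibly overlapping itself, is determined by its length, by \<open>\<tau>\<close> and by the
  rest of the word. The last \<open>W\<close> letters are a look-ahead, and \<open>b\<close> bounds the number of letters that are
  not part of a copied block.\<close>

inductive parsed :: "'s set \<Rightarrow> nat \<Rightarrow> nat \<Rightarrow> (nat \<Rightarrow> nat) \<Rightarrow> nat \<Rightarrow> nat \<Rightarrow> nat \<Rightarrow> 's list \<Rightarrow> bool"
  for S n0 n1 T W where
  stop: "N < n1 \<Longrightarrow> length w = N + W \<Longrightarrow> set w \<subseteq> S \<Longrightarrow> parsed S n0 n1 T W N b w"
| single: "s \<in> S \<Longrightarrow> parsed S n0 n1 T W N b w \<Longrightarrow> parsed S n0 n1 T W (Suc N) (Suc b) (s # w)"
| copy: "n0 \<le> length v \<Longrightarrow> length v \<le> n1 \<Longrightarrow> 1 \<le> \<tau> \<Longrightarrow> \<tau> \<le> T (length v) \<Longrightarrow> set v \<subseteq> S \<Longrightarrow>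
    (\<And>j. j < length v \<Longrightarrow> v ! j = (v @ w) ! (j + \<tau>)) \<Longrightarrow> parsed S n0 n1 T W N b w \<Longrightarrow>
    parsed S n0 n1 T W (length v + N) b (v @ w)"

lemma parsed_length_set:
  "parsed S n0 n1 T W N b w \<Longrightarrow> length w = N + W \<and> set w \<subseteq> S"
  by (induction rule: parsed.induct) auto

lemma parsed_mono: "parsed S n0 n1 T W N b w \<Longrightarrow> b \<le> b' \<Longrightarrow> parsed S n0 n1 T W N b' w"
proof (induction arbitrary: b' rule: parsed.induct)
  case (stop N w b)
  then show ?case by (intro parsed.stop)
next
  case (single s N b w)
  then obtain b'' where "b' = Suc b''" "b \<le> b''" by (cases b') auto
  have "parsed S n0 n1 T W (Suc N) (Suc b'') (s # w)"
    by (rule parsed.single) (use single \<open>b \<le> b''\<close> in auto)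
  then show ?case using \<open>b' = Suc b''\<close> by simp
next
  case (copy v \<tau> w N b)
  show ?case by (rule parsed.copy[OF copy(1-6) copy(8)[OF copy(9)]])
qed

lemma finite_parsed:
  assumes "finite S" shows "finite {w. parsed S n0 n1 T W N b w}"
    "card {w. parsed S n0 n1 T W N b w} \<le> card S ^ (N + W)"
proof -
  have sub: "{w. parsed S n0 n1 T W N b w} \<subseteq> {w. set w \<subseteq> S \<and> length w = N + W}"
    using parsed_length_set by blast
  show "finite {w. parsed S n0 n1 T W N b w}"
    using finite_subset[OF sub finite_lists_length_eq[OF assms]] .
  show "card {w. parsed S n0 n1 T W N b w} \<le> card S ^ (N + W)"
    using card_mono[OF finite_lists_length_eq[OF assms] sub] card_lists_length_eq[OF assms] by simp
qed

text \<open>Induction from the right end: the letter at \<open>j\<close> is read off at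
  \<open>j + \<tau> > j\<close>, which lies in \<open>w\<close> or further right in the prefix.
  Hence a copy may overlap its source.\<close>

lemma shift_determines_prefix:
  assumes "length v = length v'" "1 \<le> \<tau>"
    and "\<And>j. j < length v \<Longrightarrow> v ! j = (v @ w) ! (j + \<tau>)"
    and "\<And>j. j < length v \<Longrightarrow> v' ! j = (v' @ w) ! (j + \<tau>)"
  shows "v = v'"
proof (rule nth_equalityI[OF assms(1)])
  fix j assume "j < length v"
  then show "v ! j = v' ! j"
  proof (induction "length v - j" arbitrary: j rule: less_induct)
    case less
    have "(v @ w) ! (j + \<tau>) = (v' @ w) ! (j + \<tau>)"
    proof (cases "j + \<tau> < length v")
      case True
      then show ?thesis using less(1)[of "j + \<tau>"] assms(1,2) less(2) by (simp add: nth_append)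
    next
      case False
      then show ?thesis using assms(1) by (simp add: nth_append)
    qed
    then show ?case using assms(3)[OF less(2)] assms(4)[OF less(2)] by simp
  qed
qed

definition copies :: "nat \<Rightarrow> nat \<Rightarrow> 's list set \<Rightarrow> 's list set" where
  "copies n \<tau> X = {v @ w | v w. length v = n \<and> (\<forall>j<n. v ! j = (v @ w) ! (j + \<tau>)) \<and> w \<in> X}"

text \<open>Once its length and shift are known, a copied block is free of charge: dropping it is
  injective.\<close>

lemma copies_card:
  assumes "finite X" "1 \<le> \<tau>"
  shows "finite (copies n \<tau> X)" "card (copies n \<tau> X) \<le> card X"
proof -
  have inj: "inj_on (drop n) (copies n \<tau> X)"
  proof (rule inj_onI)
    fix x y assume xy: "x \<in> copies n \<tau> X" "y \<in> copies n \<tau> X" "drop n x = drop n y"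
    from xy(1) obtain v w where v: "x = v @ w" "length v = n" "\<forall>j<n. v ! j = (v @ w) ! (j + \<tau>)"
      unfolding copies_def by blast
    from xy(2) obtain v' w' where v': "y = v' @ w'" "length v' = n" "\<forall>j<n. v' ! j = (v' @ w') ! (j + \<tau>)"
      unfolding copies_def by blast
    have "w = w'" using xy(3) v(1,2) v'(1,2) by simp
    moreover have "v = v'"
      by (rule shift_determines_prefix[where \<tau>=\<tau> and w=w]) (use v v' assms(2) \<open>w = w'\<close> in auto)
    ultimately show "x = y" using v v' by simp
  qed
  have sub: "drop n ` copies n \<tau> X \<subseteq> X" unfolding copies_def by auto
  show "finite (copies n \<tau> X)" using finite_imageD[OF finite_subset[OF sub assms(1)] inj] .
  show "card (copies n \<tau> X) \<le> card X" by (rule card_inj_on_le[OF inj sub assms(1)])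
qed

text \<open>The generating function condition \<open>gen\<close> makes the bound self-reproducing along the recursion
  given by the three rules.\<close>

lemma card_parsed_le:
  fixes \<eta> y :: real
  assumes S: "finite S" "card S \<ge> 1" and n0: "n0 \<ge> 1" "n0 \<le> n1" and y: "y \<ge> 1" and \<eta>: "\<eta> \<ge> 0"
    and gen: "card S * exp (- \<eta>) / y + (\<Sum>n\<in>{n0..n1}. real (T n) * exp (- (\<eta> * real n))) \<le> 1"
  shows "real (card {w. parsed S n0 n1 T W N b w}) \<le> real (card S) ^ (n1 + W) * exp (\<eta> * real N) * y ^ b"
proof (induction N arbitrary: b rule: less_induct)
  case (less N)
  let ?P = "\<lambda>N b. {w. parsed S n0 n1 T W N b w}"
  define C where "C = real (card S) ^ (n1 + W)"
  have k1: "real (card S) \<ge> 1" using S(2) by simp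
  have C: "C \<ge> 0" by (simp add: C_def)
  note fin = finite_parsed(1)[OF S(1), of n0 n1 T W]
  show ?case
  proof (cases "N < n1")
    case True
    have "real (card (?P N b)) \<le> real (card S ^ (N + W))"
      using finite_parsed(2)[OF S(1)] of_nat_mono by blast
    also have "\<dots> \<le> C * 1 * 1" unfolding C_def using True k1 by (simp add: power_increasing)
    also have "\<dots> \<le> C * exp (\<eta> * real N) * y ^ b"
      by (intro mult_mono) (use \<eta> y C in auto)
    finally show ?thesis by (simp add: C_def)
  next
    case False
    \<comment> \<open>The words are sorted by the rule applied first. In the bound
      \<open>C * exp (\<eta> * N) * y ^ b\<close>, a single letter offers \<open>card S\<close>
      choices and lowers \<open>N\<close> and \<open>b\<close> by 1, which gives the factor
      \<open>card S * exp (- \<eta>) / y\<close>; a copy of length \<open>n\<close> offers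
      \<open>T n\<close> shifts and gives \<open>T n * exp (- (\<eta> * n))\<close>. These are the
      summands of \<open>gen\<close>.\<close>
    define X1 where "X1 = (if b = 0 then {} else (\<lambda>(s, w). s # w) ` (S \<times> ?P (N - 1) (b - 1)))"
    define X2 where "X2 n = (\<Union>\<tau>\<in>{1..T n}. copies n \<tau> (?P (N - n) b))" for n
    have sub: "?P N b \<subseteq> X1 \<union> (\<Union>n\<in>{n0..n1}. X2 n)"
    proof
      fix w assume "w \<in> ?P N b"
      then have "parsed S n0 n1 T W N b w" by simp
      then show "w \<in> X1 \<union> (\<Union>n\<in>{n0..n1}. X2 n)"
      proof cases
        case stop
        then show ?thesis using False by simp
      next
        case (single s N' b' w')
        then show ?thesis unfolding X1_def by force
      next
        case (copy v \<tau> w' N')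
        then have "w \<in> copies (length v) \<tau> (?P (N - length v) b)"
          unfolding copies_def
          by (intro CollectI exI[of _ v] exI[of _ w'] conjI allI impI) simp_all
        moreover have "\<tau> \<in> {1..T (length v)}" "length v \<in> {n0..n1}" using copy by auto
        ultimately show ?thesis unfolding X2_def by blast
      qed
    qed
    have fX2: "finite (X2 n)" for n unfolding X2_def using copies_card(1)[OF fin] by auto
    have fX1: "finite X1" unfolding X1_def using S fin by auto
    have X1: "real (card X1) \<le> (C * exp (\<eta> * real N) * y ^ b) * (card S * exp (- \<eta>) / y)"
    proof (cases "b = 0")
      case True
      then show ?thesis using C y by (simp add: X1_def)
    next
      case False': False
      have N1: "N \<ge> 1" using False n0 by simp
      have "card X1 \<le> card (S \<times> ?P (N - 1) (b - 1))"
        using False' card_image_le[OF finite_cartesian_product[OF S(1) fin]] unfolding X1_def by simp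
      then have "real (card X1) \<le> real (card S) * real (card (?P (N - 1) (b - 1)))"
        by (metis card_cartesian_product of_nat_mono of_nat_mult)
      also have "\<dots> \<le> real (card S) * (C * exp (\<eta> * real (N - 1)) * y ^ (b - 1))"
        using less[of "N - 1" "b - 1"] N1 unfolding C_def by (intro mult_left_mono) auto
      also have "exp (\<eta> * real (N - 1)) = exp (\<eta> * real N) * exp (- \<eta>)"
        using N1 by (simp add: exp_add[symmetric] of_nat_diff algebra_simps)
      also have "y ^ (b - 1) = y ^ b / y" using False' y by (simp add: power_diff)
      finally show ?thesis by (simp add: mult_ac)
    qed
    have X2: "real (card (X2 n)) \<le> (C * exp (\<eta> * real N) * y ^ b) * (real (T n) * exp (- (\<eta> * real n)))"
      if n: "n \<in> {n0..n1}" for n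
    proof -
      have nN: "n \<le> N" "N - n < N" using n False n0 by auto
      have "card (X2 n) \<le> (\<Sum>\<tau>\<in>{1..T n}. card (copies n \<tau> (?P (N - n) b)))"
        unfolding X2_def by (rule card_UN_le) simp
      also have "\<dots> \<le> (\<Sum>\<tau>\<in>{1..T n}. card (?P (N - n) b))"
        by (intro sum_mono copies_card(2)[OF fin]) simp
      also have "\<dots> = T n * card (?P (N - n) b)" by simp
      finally have "real (card (X2 n)) \<le> real (T n) * real (card (?P (N - n) b))"
        by (metis of_nat_mono of_nat_mult)
      also have "\<dots> \<le> real (T n) * (C * exp (\<eta> * real (N - n)) * y ^ b)"
        using less[OF nN(2), of b] unfolding C_def by (intro mult_left_mono) auto
      also have "exp (\<eta> * real (N - n)) = exp (\<eta> * real N) * exp (- (\<eta> * real n))"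
        using nN by (simp add: exp_add[symmetric] of_nat_diff algebra_simps)
      finally show ?thesis by (simp add: mult_ac)
    qed
    have "card (?P N b) \<le> card (X1 \<union> (\<Union>n\<in>{n0..n1}. X2 n))"
      by (rule card_mono[OF _ sub]) (use fX1 fX2 in auto)
    also have "\<dots> \<le> card X1 + card (\<Union>n\<in>{n0..n1}. X2 n)" by (rule card_Un_le)
    also have "\<dots> \<le> card X1 + (\<Sum>n\<in>{n0..n1}. card (X2 n))" by (intro add_left_mono card_UN_le) simp
    finally have "real (card (?P N b)) \<le> real (card X1) + (\<Sum>n\<in>{n0..n1}. real (card (X2 n)))"
      by (simp flip: of_nat_sum of_nat_add)
    also have "\<dots> \<le> (C * exp (\<eta> * real N) * y ^ b) * (card S * exp (- \<eta>) / y)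
        + (\<Sum>n\<in>{n0..n1}. (C * exp (\<eta> * real N) * y ^ b) * (real (T n) * exp (- (\<eta> * real n))))"
      by (intro add_mono X1 sum_mono X2)
    also have "\<dots> = (C * exp (\<eta> * real N) * y ^ b) * (card S * exp (- \<eta>) / y
         + (\<Sum>n\<in>{n0..n1}. real (T n) * exp (- (\<eta> * real n))))"
      by (simp only: distrib_left sum_distrib_left)
    also have "\<dots> \<le> (C * exp (\<eta> * real N) * y ^ b) * 1"
      by (intro mult_left_mono gen) (use C y in auto)
    finally show ?thesis by (simp add: C_def)
  qed
qed

definition repeats :: "nat \<Rightarrow> nat \<Rightarrow> (nat \<Rightarrow> nat) \<Rightarrow> (nat \<Rightarrow> 's) \<Rightarrow> bool" where
  "repeats n0 n1 T u \<longleftrightarrow> (\<exists>n\<in>{n0..n1}. \<exists>\<tau>\<in>{1..T n}. \<forall>j<n. u j = u (j + \<tau>))"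

text \<open>Greedy parsing: copy a block wherever one starts, else spend a single letter. Positions
  skipped inside a copied block are still counted if they are bad, so the count only overestimates
  the letters spent, and \<open>parsed_mono\<close> closes the gap. The look-ahead \<open>W\<close>
  dominates every admissible shift, so a source never runs past the end of the word.\<close>

lemma parsed_sequence:
  assumes S: "range u \<subseteq> S" and n0: "n0 \<ge> 1" "n0 \<le> n1" and W: "\<And>n. n \<le> n1 \<Longrightarrow> T n \<le> W"
  shows "parsed S n0 n1 T W N (card {i. i < N \<and> \<not> repeats n0 n1 T (\<lambda>j. u (i0 + i + j))})
           (map u [i0..<i0 + (N + W)])"
proof (induction N arbitrary: i0 rule: less_induct)
  case (less N)
  let ?bad = "\<lambda>i0 i. \<not> repeats n0 n1 T (\<lambda>j. u (i0 + i + j))"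
  have fin: "finite {i. i < N \<and> ?bad i0 i}" for N i0 by simp
  show ?case
  proof (cases "N < n1")
    case True
    then show ?thesis using S by (intro parsed.stop) auto
  next
    case False
    then obtain N' where N': "N = Suc N'" using n0 by (cases N) auto
    show ?thesis
    proof (cases "?bad i0 0")
      case True
      have "{i. i < N \<and> ?bad i0 i} = insert 0 (Suc ` {i. i < N' \<and> ?bad (Suc i0) i})"
      proof (intro equalityI subsetI)
        fix i assume "i \<in> {i. i < N \<and> ?bad i0 i}"
        then show "i \<in> insert 0 (Suc ` {i. i < N' \<and> ?bad (Suc i0) i})"
          by (cases i) (auto simp: N')
      qed (use True N' in auto)
      then have c: "card {i. i < N \<and> ?bad i0 i} = Suc (card {i. i < N' \<and> ?bad (Suc i0) i})"
        by (simp add: card_image)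
      have m: "map u [i0..<i0 + (N + W)] = u i0 # map u [Suc i0..<Suc i0 + (N' + W)]"
        using upt_conv_Cons[of i0 "i0 + (N + W)"] by (simp add: N' del: upt_Suc)
      show ?thesis unfolding c m unfolding N'
        by (rule parsed.single) (use S less[of N' "Suc i0"] N' in auto)
    next
      case False': False
      then obtain n \<tau> where n: "n \<in> {n0..n1}" "\<tau> \<in> {1..T n}" "\<And>j. j < n \<Longrightarrow> u (i0 + j) = u (i0 + (j + \<tau>))"
        unfolding repeats_def by auto
      have nN: "n \<le> N" "N - n < N" using n False n0 by auto
      define b where "b = card {i. i < N - n \<and> ?bad (i0 + n) i}"
      have IH: "parsed S n0 n1 T W (N - n) b (map u [i0 + n..<i0 + n + (N - n + W)])"
        using less[OF nN(2), of "i0 + n"] unfolding b_def .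
      have "(+) n ` {i. i < N - n \<and> ?bad (i0 + n) i} \<subseteq> {i. i < N \<and> ?bad i0 i}"
        using nN by (auto simp: add.assoc)
      then have "card ((+) n ` {i. i < N - n \<and> ?bad (i0 + n) i}) \<le> card {i. i < N \<and> ?bad i0 i}"
        by (intro card_mono) auto
      then have b: "b \<le> card {i. i < N \<and> ?bad i0 i}"
        unfolding b_def by (subst (asm) card_image) auto
      have split: "map u [i0..<i0 + (N + W)] = map u [i0..<i0 + n] @ map u [i0 + n..<i0 + n + (N - n + W)]"
      proof -
        have "i0 + (N + W) = i0 + n + (N - n + W)" using nN by simp
        then show ?thesis using upt_add_eq_append[of i0 "i0 + n" "N - n + W"] by simp
      qed
      have len: "length (map u [i0..<i0 + n]) = n" by simp
      have "parsed S n0 n1 T W (length (map u [i0..<i0 + n]) + (N - n)) b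
          (map u [i0..<i0 + n] @ map u [i0 + n..<i0 + n + (N - n + W)])"
      proof (rule parsed.copy[where \<tau>=\<tau>])
        fix j assume j: "j < length (map u [i0..<i0 + n])"
        then have "j + \<tau> < N + W" using n(1,2) nN W[of n] by auto
        then show "map u [i0..<i0 + n] ! j = (map u [i0..<i0 + n] @ map u [i0 + n..<i0 + n + (N - n + W)]) ! (j + \<tau>)"
          unfolding split[symmetric] using j n(3)[of j] by (simp del: upt_Suc)
      qed (use n S IH in auto)
      then have "parsed S n0 n1 T W N b (map u [i0..<i0 + (N + W)])"
        unfolding split len using nN by simp
      then show ?thesis using parsed_mono b by blast
    qed
  qed
qed

section \<open>Words with few errors, and the entropy of a partition most of whose mass has few
  names\<close>

definition hamming_ball :: "'s set \<Rightarrow> 's list \<Rightarrow> nat \<Rightarrow> 's list set" where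
  "hamming_ball S v b = {u. length u = length v \<and> set u \<subseteq> S \<and> card {i. i < length v \<and> u ! i \<noteq> v ! i} \<le> b}"

lemma finite_hamming_ball: "finite S \<Longrightarrow> finite (hamming_ball S v b)"
  by (rule finite_subset[OF _ finite_lists_length_eq[of S "length v"]]) (auto simp: hamming_ball_def)

text \<open>Exponential weights: giving each word the weight \<open>1 / y\<close> per error, all
  words together weigh at most \<open>(1 + card S / y) ^ length v\<close>, and each word of the ball
  weighs at least \<open>1 / y ^ b\<close>. The induction adds the weights letter by letter.\<close>

lemma card_hamming_ball_le:
  fixes y :: real
  assumes S: "finite S" and y: "y \<ge> 1"
  shows "real (card (hamming_ball S v b)) \<le> y ^ b * (1 + card S / y) ^ length v"
proof (induction v arbitrary: b)
  case Nil
  have "hamming_ball S [] b = {[]}" by (auto simp: hamming_ball_def)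
  then show ?case using y by simp
next
  case (Cons s v)
  let ?k = "1 + card S / y"
  define X where "X = (if b = 0 then {} else (\<lambda>(a, u). a # u) ` (S \<times> hamming_ball S v (b - 1)))"
  have sub: "hamming_ball S (s # v) b \<subseteq> (#) s ` hamming_ball S v b \<union> X"
  proof
    fix u assume u: "u \<in> hamming_ball S (s # v) b"
    then obtain a u' where au: "u = a # u'" "length u' = length v" "a \<in> S" "set u' \<subseteq> S"
      unfolding hamming_ball_def by (cases u) auto
    let ?D = "{i. i < length v \<and> u' ! i \<noteq> v ! i}"
    have eq: "{i. i < length (s # v) \<and> u ! i \<noteq> (s # v) ! i} = (if a = s then {} else {0}) \<union> Suc ` ?D" (is "?L = ?R")
    proof (intro equalityI subsetI)
      fix i assume "i \<in> ?L"
      then show "i \<in> ?R" by (cases i) (auto simp: au)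
    qed (auto simp: au split: if_splits)
    have "card ((if a = s then {} else {0}) \<union> Suc ` ?D) = (if a = s then 0 else 1) + card ?D"
      by (subst card_Un_disjoint) (auto simp: card_image)
    then have le: "(if a = s then 0 else 1) + card ?D \<le> b" using u eq unfolding hamming_ball_def by simp
    show "u \<in> (#) s ` hamming_ball S v b \<union> X"
    proof (cases "a = s")
      case True
      then show ?thesis using le au unfolding hamming_ball_def by simp
    next
      case False
      then have "b \<noteq> 0" "u' \<in> hamming_ball S v (b - 1)" using le au unfolding hamming_ball_def by auto
      then show ?thesis using au unfolding X_def by (auto intro!: image_eqI[of _ _ "(a, u')"])
    qed
  qed
  have X: "real (card X) \<le> (card S / y) * (y ^ b * ?k ^ length v)"
  proof (cases "b = 0")
    case False
    have "card X \<le> card (S \<times> hamming_ball S v (b - 1))"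
      using False card_image_le[OF finite_cartesian_product[OF S finite_hamming_ball[OF S]]] unfolding X_def by simp
    then have "real (card X) \<le> real (card S) * real (card (hamming_ball S v (b - 1)))"
      by (metis card_cartesian_product of_nat_mono of_nat_mult)
    also have "\<dots> \<le> real (card S) * (y ^ (b - 1) * ?k ^ length v)"
      by (intro mult_left_mono Cons.IH) simp
    also have "y ^ (b - 1) = y ^ b / y" using False y by (simp add: power_diff)
    finally show ?thesis by (simp add: mult_ac)
  qed (use y in \<open>simp add: X_def\<close>)
  have "card (hamming_ball S (s # v) b) \<le> card ((#) s ` hamming_ball S v b \<union> X)"
    by (rule card_mono[OF _ sub]) (use S finite_hamming_ball[OF S] in \<open>auto simp: X_def\<close>)
  also have "\<dots> \<le> card (hamming_ball S v b) + card X"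
    using card_Un_le[of "(#) s ` hamming_ball S v b" X] card_image_le[OF finite_hamming_ball[OF S], of "(#) s" v b] by linarith
  finally have "real (card (hamming_ball S (s # v) b)) \<le> real (card (hamming_ball S v b)) + real (card X)"
    by linarith
  also have "\<dots> \<le> y ^ b * ?k ^ length v + (card S / y) * (y ^ b * ?k ^ length v)"
    by (intro add_mono X Cons.IH)
  also have "\<dots> = y ^ b * ?k ^ length (s # v)" by (simp add: algebra_simps)
  finally show ?case .
qed

text \<open>The inequality between entropy and the logarithm of the number of atoms, for weights
  that need not sum to 1. It comes from \<open>ln t \<le> t - 1\<close> at
  \<open>t = 1 / (p i * K)\<close>; the summand 1 is the total of the terms
  \<open>1 / K\<close>.\<close>

lemma neg_sum_p_ln_p_le:
  fixes p :: "'i \<Rightarrow> real"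
  assumes A: "finite A" "real (card A) \<le> K" "K \<ge> 1" and p: "\<And>i. i \<in> A \<Longrightarrow> 0 \<le> p i"
  shows "- (\<Sum>i\<in>A. p i * ln (p i)) \<le> (\<Sum>i\<in>A. p i) * ln K + 1"
proof -
  have 1: "- (p i * ln (p i)) \<le> p i * ln K + 1 / K - p i" if i: "i \<in> A" for i
  proof (cases "p i = 0")
    case True
    then show ?thesis using A(3) by simp
  next
    case False
    then have pos: "p i > 0" using p[OF i] by simp
    have "ln (1 / (p i * K)) \<le> 1 / (p i * K) - 1" by (rule ln_le_minus_one) (use pos A(3) in simp)
    then have "p i * (- ln (p i) - ln K) \<le> p i * (1 / (p i * K) - 1)"
      using pos A(3) by (intro mult_left_mono) (auto simp: ln_div ln_mult)
    also have "\<dots> = 1 / K - p i" using pos A(3) by (simp add: field_simps)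
    finally show ?thesis by (simp add: algebra_simps)
  qed
  have "- (\<Sum>i\<in>A. p i * ln (p i)) = (\<Sum>i\<in>A. - (p i * ln (p i)))" by (simp add: sum_negf)
  also have "\<dots> \<le> (\<Sum>i\<in>A. p i * ln K + 1 / K - p i)" by (intro sum_mono 1)
  also have "\<dots> = (\<Sum>i\<in>A. p i) * ln K + real (card A) / K - (\<Sum>i\<in>A. p i)"
    by (simp add: sum.distrib sum_subtractf sum_distrib_right)
  also have "\<dots> \<le> (\<Sum>i\<in>A. p i) * ln K + 1"
  proof -
    have "real (card A) / K \<le> 1" using A by (simp add: divide_le_eq)
    moreover have "0 \<le> (\<Sum>i\<in>A. p i)" by (rule sum_nonneg[OF p])
    ultimately show ?thesis by linarith
  qed
  finally show ?thesis .
qed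

text \<open>A crude inequality of Fano type: values in \<open>G\<close> contribute at most
  \<open>ln K\<close>, the exceptional ones at most \<open>\<gamma> * ln L\<close>, and each of the
  two subfamilies costs an additional 1.\<close>

lemma (in prob_space) partition_entropy_bounds:
  assumes X: "simple_function M X" and G: "finite G" "real (card G) \<le> K" "K \<ge> 1"
    and L: "real (card (X ` space M)) \<le> L" "L \<ge> 1"
    and bad: "prob {x\<in>space M. X x \<notin> G} \<le> \<gamma>"
  shows "0 \<le> partition_entropy M X" "partition_entropy M X \<le> ln K + \<gamma> * ln L + 2"
proof -
  define p where "p i = prob (X -` {i} \<inter> space M)" for i
  let ?S = "X ` space M"
  have S: "finite ?S" using X by (rule simple_functionD)
  have pm: "X -` {i} \<inter> space M \<in> sets M" for i using X by (rule simple_functionD)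
  have eq: "partition_entropy M X = - (\<Sum>i\<in>?S. p i * ln (p i))"
    unfolding p_def by (rule partition_entropy_eq) (use X prob_space_axioms in auto)
  have p01: "0 \<le> p i" "p i \<le> 1" for i by (auto simp: p_def)
  have "p i * ln (p i) \<le> 0" for i
    using p01[of i] by (cases "p i = 0") (auto intro!: mult_nonneg_nonpos)
  then show "0 \<le> partition_entropy M X" unfolding eq by (simp add: sum_nonpos)
  have sum_p: "(\<Sum>i\<in>A. p i) = prob {x\<in>space M. X x \<in> A}" if "A \<subseteq> ?S" for A
  proof -
    have "finite A" using S that finite_subset by blast
    then have "(\<Sum>i\<in>A. p i) = prob (\<Union>i\<in>A. X -` {i} \<inter> space M)"
      unfolding p_def by (intro finite_measure_finite_Union[symmetric]) (use pm in \<open>auto simp: disjoint_family_on_def\<close>)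
    also have "(\<Union>i\<in>A. X -` {i} \<inter> space M) = {x\<in>space M. X x \<in> A}" by auto
    finally show ?thesis .
  qed
  have "- (\<Sum>i\<in>?S. p i * ln (p i)) = - (\<Sum>i\<in>?S \<inter> G. p i * ln (p i)) + - (\<Sum>i\<in>?S - G. p i * ln (p i))"
    using sum.Int_Diff[OF S, of "\<lambda>i. p i * ln (p i)" G] by simp
  also have "\<dots> \<le> ((\<Sum>i\<in>?S \<inter> G. p i) * ln K + 1) + ((\<Sum>i\<in>?S - G. p i) * ln L + 1)"
  proof (intro add_mono neg_sum_p_ln_p_le p01)
    have "card (?S \<inter> G) \<le> card G" by (intro card_mono G) auto
    then show "real (card (?S \<inter> G)) \<le> K" using G(2) by linarith
    have "card (?S - G) \<le> card ?S" by (intro card_mono S) auto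
    then show "real (card (?S - G)) \<le> L" using L(1) by linarith
  qed (use S G L in auto)
  also have "\<dots> \<le> (1 * ln K + 1) + (\<gamma> * ln L + 1)"
  proof (intro add_mono mult_right_mono order_refl)
    show "(\<Sum>i\<in>?S \<inter> G. p i) \<le> 1" by (subst sum_p) auto
    have "(\<Sum>i\<in>?S - G. p i) = prob {x\<in>space M. X x \<in> ?S - G}" by (rule sum_p) auto
    also have "{x\<in>space M. X x \<in> ?S - G} = {x\<in>space M. X x \<notin> G}" by auto
    finally show "(\<Sum>i\<in>?S - G. p i) \<le> \<gamma>" using bad by simp
  qed (use G L in auto)
  finally show "partition_entropy M X \<le> ln K + \<gamma> * ln L + 2" unfolding eq by simp
qed

subsection \<open>Entropy of repetitive labellings\<close>

lemma one_le_mult: "1 \<le> a \<Longrightarrow> 1 \<le> b \<Longrightarrow> 1 \<le> a * (b :: real)"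
  using mult_mono[of 1 a 1 b] by simp

context measure_preserving begin

text \<open>The expected number of visits is \<open>N * prob B\<close> by invariance. Applied to the
  bad positions and to the errors of the approximating labelling, it bounds their frequency without
  an ergodic theorem.\<close>

lemma visits_markov:
  assumes B: "B \<in> sets M" and \<beta>: "\<beta> > 0"
  shows "prob {x. \<beta> * real N < real (card {i. i < N \<and> (f ^^ i) x \<in> B})} \<le> prob B / \<beta>"
proof (cases "N = 0")
  case False
  define u where "u x = (\<Sum>i<N. indicator B ((f ^^ i) x) :: real)" for x
  have iB: "integrable M (indicator B :: 'a \<Rightarrow> real)"
    by (intro integrable_unit borel_measurable_indicator B) auto
  have i: "integrable M (\<lambda>x. indicator B ((f ^^ i) x) :: real)" for i
    using integrable_iter[OF iB] .
  have u: "integrable M u" unfolding u_def by (intro Bochner_Integration.integrable_sum i)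
  have u_eq: "u x = real (card {i. i < N \<and> (f ^^ i) x \<in> B})" for x
  proof -
    have "u x = (\<Sum>i\<in>{i. i < N \<and> (f ^^ i) x \<in> B}. 1)"
      unfolding u_def by (rule sum.mono_neutral_cong_right) (auto simp: indicator_def)
    then show ?thesis by simp
  qed
  have "(\<integral>x. u x \<partial>M) = (\<Sum>i<N. (\<integral>x. indicator B ((f ^^ i) x) \<partial>M))"
    unfolding u_def by (rule Bochner_Integration.integral_sum) (rule i)
  also have "\<dots> = (\<Sum>i<N. prob B)"
    using integral_iter[of "indicator B :: 'a \<Rightarrow> real"] B by simp
  finally have int: "(\<integral>x. u x \<partial>M) = real N * prob B" by simp
  have pos: "0 < \<beta> * real N" using False \<beta> by simp
  have "prob {x. \<beta> * real N < real (card {i. i < N \<and> (f ^^ i) x \<in> B})} \<le> prob {x\<in>space M. u x \<ge> \<beta> * real N}"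
    proof (intro finite_measure_mono)
    show "{x\<in>space M. u x \<ge> \<beta> * real N} \<in> sets M" using u by measurable
  qed (auto simp: u_eq)
  also have "\<dots> \<le> (\<integral>x. u x \<partial>M) / (\<beta> * real N)"
    by (rule integral_Markov_inequality_measure[OF u, of "space M"]) (use pos in \<open>auto simp: u_eq\<close>)
  also have "\<dots> = prob B / \<beta>" using False \<beta> by (simp add: int)
  finally show ?thesis .
qed (use \<beta> in simp)

lemma label_meas:
  assumes "Q \<in> measurable M (count_space UNIV)"
  shows "(\<lambda>x. Q ((f ^^ i) x)) \<in> measurable M (count_space UNIV)"
  using measurable_compose[OF iter_meas assms] .

lemma label_Collect:
  fixes Q :: "'a \<Rightarrow> nat"
  assumes "Q \<in> measurable M (count_space UNIV)" "Q' \<in> measurable M (count_space UNIV)"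
  shows "{x. Q x = Q' x} \<in> sets M"
proof -
  have "{x. Q x = Q' x} = (\<Union>i. (Q -` {i} \<inter> space M) \<inter> (Q' -` {i} \<inter> space M))" by auto
  also have "\<dots> \<in> sets M"
    by (intro sets.countable_UN image_subsetI sets.Int measurable_sets[OF assms(1)] measurable_sets[OF assms(2)]) auto
  finally show ?thesis .
qed

text \<open>The smallness of repetition times that, in the formula of Ornstein and Weiss,
  corresponds to entropy zero. It is asked only along infinitely many lengths \<open>n\<close>,
  depending on the point.\<close>

definition repetitive :: "('a \<Rightarrow> nat) \<Rightarrow> bool" where
  "repetitive Q \<longleftrightarrow> (AE x in M. \<forall>\<delta>>0. \<forall>n0. \<exists>n\<ge>n0. \<exists>\<tau>\<ge>1. real \<tau> \<le> exp (\<delta> * real n) \<and>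
     (\<forall>j<n. Q ((f ^^ j) x) = Q ((f ^^ (j + \<tau>)) x)))"

lemma simple_function_itinerary:
  assumes P: "P \<in> measurable M (count_space UNIV)" and k: "range P \<subseteq> {..<k}"
  shows "simple_function M (itinerary f P N)"
    and "itinerary f P N ` space M \<subseteq> {w. set w \<subseteq> {..<k} \<and> length w = N}"
proof -
  show sub: "itinerary f P N ` space M \<subseteq> {w. set w \<subseteq> {..<k} \<and> length w = N}"
    using k by (auto simp: itinerary_def image_subset_iff)
  then have fin: "finite (itinerary f P N ` space M)"
    using finite_subset finite_lists_length_eq[of "{..<k}" N] by blast
  have "itinerary f P N -` {w} \<in> sets M" for w
  proof (cases "length w = N")
    case True
    have "itinerary f P N -` {w} = (\<Inter>i\<in>{..<N}. {x. P ((f ^^ i) x) = w ! i}) \<inter> space M"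
    proof -
      have "itinerary f P N x = w \<longleftrightarrow> (\<forall>i<N. P ((f ^^ i) x) = w ! i)" for x
        using True unfolding itinerary_def list_eq_iff_nth_eq by simp
      then show ?thesis by auto
    qed
    moreover have "{x. P ((f ^^ i) x) = w ! i} \<in> sets M" for i
      using label_Collect[OF label_meas[OF P, of i], of "\<lambda>_. w ! i"] by simp
    then have "(\<Inter>i\<in>{..<N}. {x. P ((f ^^ i) x) = w ! i}) \<in> sets M" if "N \<noteq> 0"
      using that by (intro sets.finite_INT) auto
    ultimately show ?thesis by (cases "N = 0") auto
  next
    case False
    then have "itinerary f P N -` {w} = {}" by (auto simp: itinerary_def)
    then show ?thesis by simp
  qed
  then show "simple_function M (itinerary f P N)"
    unfolding simple_function_def using fin by simp
qed

text \<open>\<open>repetitive\<close> gives repetitions of unbounded length. Cutting the lengths off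
  at \<open>n1\<close> costs little probability, as the exceptional sets decrease to a null set, and
  it makes the look-ahead of the parsing finite.\<close>

lemma measure_not_repeats_small:
  fixes T :: "nat \<Rightarrow> nat"
  assumes Q: "Q \<in> measurable M (count_space UNIV)" and rep: "repetitive Q" and \<delta>: "\<delta> > 0" and \<epsilon>: "\<epsilon> > 0"
    and T: "\<And>n. T n = nat \<lfloor>exp (\<delta> * real n)\<rfloor>"
  obtains n1 where "n1 \<ge> n0" "{x. \<not> repeats n0 n1 T (\<lambda>j. Q ((f ^^ j) x))} \<in> sets M"
    "prob {x. \<not> repeats n0 n1 T (\<lambda>j. Q ((f ^^ j) x))} < \<epsilon>"
proof -
  define B where "B n1 = {x. \<not> repeats n0 n1 T (\<lambda>j. Q ((f ^^ j) x))}" for n1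
  have B: "B n1 \<in> sets M" for n1
  proof -
    have "(\<Union>n\<in>{n0..n1}. \<Union>\<tau>\<in>{1..T n}. (\<Inter>j\<in>{..<n}. {x. Q ((f ^^ j) x) = Q ((f ^^ (j + \<tau>)) x)}) \<inter> space M) \<in> sets M"
    proof (intro sets.finite_UN finite_atLeastAtMost)
      fix n \<tau>
      show "(\<Inter>j\<in>{..<n}. {x. Q ((f ^^ j) x) = Q ((f ^^ (j + \<tau>)) x)}) \<inter> space M \<in> sets M"
        using label_Collect[OF label_meas[OF Q] label_meas[OF Q]] sets.finite_INT[of "{..<n}"]
        by (cases "n = 0") auto
    qed
    moreover have "B n1 = space M - (\<Union>n\<in>{n0..n1}. \<Union>\<tau>\<in>{1..T n}. (\<Inter>j\<in>{..<n}. {x. Q ((f ^^ j) x) = Q ((f ^^ (j + \<tau>)) x)}) \<inter> space M)"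
      unfolding B_def repeats_def by auto
    ultimately show ?thesis by simp
  qed
  have dec: "decseq B"
    unfolding B_def repeats_def by (intro decseq_SucI) (auto; meson atLeastAtMost_iff le_SucI)
  have "AE x in M. x \<notin> (\<Inter>n1. B n1)"
    using rep[unfolded repetitive_def]
  proof eventually_elim
    case (elim x)
    then obtain n \<tau> where n: "n \<ge> n0" "\<tau> \<ge> 1" "real \<tau> \<le> exp (\<delta> * real n)"
      "\<forall>j<n. Q ((f ^^ j) x) = Q ((f ^^ (j + \<tau>)) x)"
      using \<delta> by blast
    have "\<tau> \<le> T n" using n(3) unfolding T by (simp add: le_nat_floor)
    then have "\<tau> \<in> {1..T n}" "n \<in> {n0..n}" using n by auto
    then have "x \<notin> B n" using n(4) unfolding B_def repeats_def by blast
    then show ?case by blast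
  qed
  then have "prob (\<Inter>n1. B n1) = 0"
    using B AE_iff_null_sets[of "\<Inter>n1. B n1" M] by (auto intro!: measure_eq_0_null_sets)
  then have "(\<lambda>n1. prob (B n1)) \<longlonglongrightarrow> 0"
    using finite_Lim_measure_decseq[OF _ dec] B by auto
  then have "eventually (\<lambda>n1. prob (B n1) < \<epsilon>) sequentially"
    using order_tendstoD(2) \<epsilon> by blast
  then obtain n1' where "\<And>n1. n1 \<ge> n1' \<Longrightarrow> prob (B n1) < \<epsilon>"
    unfolding eventually_sequentially by blast
  then have "prob (B (max n0 n1')) < \<epsilon>" "max n0 n1' \<ge> n0" by auto
  then obtain n1 where "n1 \<ge> n0" "prob (B n1) < \<epsilon>" by blast
  then show thesis using that B unfolding B_def by blast
qed

text \<open>Outside a set of probability \<open>2 * \<delta>\<close>, an itinerary of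
  \<open>P\<close> differs in at most \<open>\<beta> * N\<close> places from one of
  \<open>Q\<close>, and the latter parses with at most \<open>\<beta> * N\<close> single letters.
  Counting parsed words, and words close to them, bounds the number of typical itineraries; the
  exceptional ones enter through the trivial bound \<open>k ^ N\<close>.\<close>

lemma itinerary_entropy_bound:
  assumes P: "P \<in> measurable M (count_space UNIV)" "range P \<subseteq> {..<k}" and k: "k \<ge> 1"
    and approx: "\<And>\<epsilon>. \<epsilon> > 0 \<Longrightarrow> \<exists>Q. Q \<in> measurable M (count_space UNIV) \<and> range Q \<subseteq> {..<k} \<and>
      prob {x. P x \<noteq> Q x} \<le> \<epsilon> \<and> repetitive Q"
    and \<delta>: "\<delta> > 0"
  obtains C where "\<And>N. 0 \<le> partition_entropy M (itinerary f P N)"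
    "\<And>N. partition_entropy M (itinerary f P N) \<le> C + (5 + 2 * ln (real k)) * \<delta> * real N"
proof -
  define S where "S = {..<k}"
  have S: "finite S" "card S = k" by (auto simp: S_def)
  have k1: "real k \<ge> 1" using k by simp
  \<comment> \<open>\<open>y1\<close> makes the single-letter term of the generating function
    condition at most one half, \<open>y2\<close> makes the count of errors at most
    \<open>exp (\<delta> * N)\<close> apart from \<open>y2 ^ b\<close>, and \<open>\<beta>\<close>
    is so small that \<open>y1 ^ b * y2 ^ b\<close> is at most \<open>exp (\<delta> * N)\<close>.
    Events of probability \<open>\<beta> * \<delta>\<close> then have frequency above
    \<open>\<beta>\<close> with probability at most \<open>\<delta>\<close>.\<close>
  define y1 where "y1 = 2 * real k"
  define y2 where "y2 = max 1 (real k / \<delta>)"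
  have y1: "y1 \<ge> 1" and y2: "y2 \<ge> 1" using k1 by (auto simp: y1_def y2_def)
  have ky2: "real k / y2 \<le> \<delta>"
    using \<delta> y2 by (auto simp: y2_def max_def field_simps split: if_splits)
  define \<beta> where "\<beta> = \<delta> / (ln y1 + ln y2 + 1)"
  have lny: "ln y1 \<ge> 0" "ln y2 \<ge> 0" using y1 y2 by auto
  have \<beta>: "\<beta> > 0" using \<delta> lny by (simp add: \<beta>_def)
  have \<beta>y: "\<beta> * (ln y1 + ln y2) \<le> \<delta>"
    using \<delta> lny by (simp add: \<beta>_def field_simps)
  have \<beta>\<delta>: "\<beta> * \<delta> > 0" using \<beta> \<delta> by simp
  obtain Q where Q: "Q \<in> measurable M (count_space UNIV)" "range Q \<subseteq> S"
    "prob {x. P x \<noteq> Q x} \<le> \<beta> * \<delta>" "repetitive Q"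
    using approx[OF \<beta>\<delta>] unfolding S_def by blast
  define T where "T n = nat \<lfloor>exp (\<delta> * real n)\<rfloor>" for n
  have T_le: "real (T n) \<le> exp (\<delta> * real n)" for n unfolding T_def by (rule of_nat_floor) simp
  have T_mono: "T n \<le> T n'" if "n \<le> n'" for n n'
    unfolding T_def using that \<delta> by (intro nat_mono floor_mono) simp
  \<comment> \<open>With \<open>\<eta> = 2 * \<delta>\<close>, the copies of length \<open>n\<close>
    contribute at most \<open>exp (- (\<delta> * n))\<close>; starting far out in this series leaves
    them the other half of the condition. The successor ensures \<open>n0 \<ge> 1\<close>.\<close>
  obtain n0' where n0': "\<And>m n. m \<ge> n0' \<Longrightarrow> norm (\<Sum>i\<in>{m..<n}. exp (- (\<delta> * real i))) < 1 / 2"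
    using summable_exp_neg[OF \<delta>] unfolding summable_Cauchy by (meson half_gt_zero zero_less_one)
  define n0 where "n0 = Suc n0'"
  obtain n1 where n1: "n1 \<ge> n0" "{x. \<not> repeats n0 n1 T (\<lambda>j. Q ((f ^^ j) x))} \<in> sets M"
    "prob {x. \<not> repeats n0 n1 T (\<lambda>j. Q ((f ^^ j) x))} < \<beta> * \<delta>"
    using measure_not_repeats_small[OF Q(1,4) \<delta> \<beta>\<delta> T_def] by metis
  define B where "B = {x. \<not> repeats n0 n1 T (\<lambda>j. Q ((f ^^ j) x))}"
  define D where "D = {x. P x \<noteq> Q x}"
  have D: "D \<in> sets M"
  proof -
    have "D = space M - {x. P x = Q x}" by (auto simp: D_def)
    then show ?thesis using label_Collect[OF P(1) Q(1)] by simp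
  qed
  have B: "B \<in> sets M" using n1 by (simp add: B_def)
  define W where "W = T n1"
  have gen: "real (card S) * exp (- (2 * \<delta>)) / y1 + (\<Sum>n\<in>{n0..n1}. real (T n) * exp (- (2 * \<delta> * real n))) \<le> 1"
  proof -
    have "real (card S) * exp (- (2 * \<delta>)) / y1 = exp (- (2 * \<delta>)) / 2" using k1 by (simp add: y1_def S)
    also have "\<dots> \<le> 1 / 2" using \<delta> by simp
    finally have a: "real (card S) * exp (- (2 * \<delta>)) / y1 \<le> 1 / 2" .
    have "(\<Sum>n\<in>{n0..n1}. real (T n) * exp (- (2 * \<delta> * real n))) \<le> (\<Sum>n\<in>{n0..n1}. exp (- (\<delta> * real n)))"
    proof (rule sum_mono)
      fix n
      have "real (T n) * exp (- (2 * \<delta> * real n)) \<le> exp (\<delta> * real n) * exp (- (2 * \<delta> * real n))"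
        by (intro mult_right_mono T_le) simp
      also have "\<dots> = exp (- (\<delta> * real n))" by (simp add: exp_add[symmetric])
      finally show "real (T n) * exp (- (2 * \<delta> * real n)) \<le> exp (- (\<delta> * real n))" .
    qed
    also have "\<dots> = (\<Sum>n\<in>{n0..<Suc n1}. exp (- (\<delta> * real n)))" by (simp add: atLeastLessThanSuc_atLeastAtMost)
    also have "\<dots> \<le> 1 / 2" using n0'[of n0 "Suc n1"] by (simp add: n0_def)
    finally show ?thesis using a by linarith
  qed
  define C where "C = ln (real k ^ (n1 + W)) + 2"
  have main: "0 \<le> partition_entropy M (itinerary f P N) \<and>
      partition_entropy M (itinerary f P N) \<le> C + (5 + 2 * ln (real k)) * \<delta> * real N" for N
  proof -
    define b where "b = nat \<lfloor>\<beta> * real N\<rfloor>"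
    have b: "real b \<le> \<beta> * real N" unfolding b_def by (rule of_nat_floor) (use \<beta> in simp)
    have b_ge: "m \<le> b" if "real m \<le> \<beta> * real N" for m unfolding b_def using that by (simp add: le_nat_floor)
    let ?PS = "{w. parsed S n0 n1 T W N b w}"
    define G where "G = (\<Union>w\<in>?PS. hamming_ball S (take N w) b)"
    have finPS: "finite ?PS" by (rule finite_parsed(1)[OF S(1)])
    have finG: "finite G" unfolding G_def using finPS finite_hamming_ball[OF S(1)] by blast
    define K1 where "K1 = real k ^ (n1 + W) * exp (2 * \<delta> * real N) * y1 ^ b"
    define K2 where "K2 = y2 ^ b * exp (\<delta> * real N)"
    have K1: "K1 \<ge> 1" unfolding K1_def using k1 y1 \<delta> by (intro one_le_mult one_le_power) auto
    have K2: "K2 \<ge> 1" unfolding K2_def using y2 \<delta> by (intro one_le_mult one_le_power) auto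
    have cPS: "real (card ?PS) \<le> K1"
      using card_parsed_le[OF S(1) _ _ n1(1) y1 _ gen, of W N b] k \<delta> unfolding K1_def S(2) by (simp add: n0_def)
    have cH: "real (card (hamming_ball S (take N w) b)) \<le> K2" if "w \<in> ?PS" for w
    proof -
      have len: "length (take N w) = N" using parsed_length_set that by fastforce
      have "real (card (hamming_ball S (take N w) b)) \<le> y2 ^ b * (1 + real k / y2) ^ N"
        using card_hamming_ball_le[OF S(1) y2, of "take N w" b] unfolding len S(2) .
      also have "(1 + real k / y2) ^ N \<le> exp \<delta> ^ N"
      proof (rule power_mono)
        have "1 + real k / y2 \<le> 1 + \<delta>" using ky2 by simp
        also have "\<dots> \<le> exp \<delta>" by simp
        finally show "1 + real k / y2 \<le> exp \<delta>" .
      qed (use y2 in simp)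
      also have "exp \<delta> ^ N = exp (\<delta> * real N)" by (simp add: exp_of_nat_mult[symmetric] mult.commute)
      finally show ?thesis unfolding K2_def using y2 by simp
    qed
    have cG: "real (card G) \<le> K1 * K2"
    proof -
      have "real (card G) \<le> (\<Sum>w\<in>?PS. real (card (hamming_ball S (take N w) b)))"
        unfolding G_def using card_UN_le[OF finPS, of "\<lambda>w. hamming_ball S (take N w) b"]
        by (simp flip: of_nat_sum)
      also have "\<dots> \<le> (\<Sum>w\<in>?PS. K2)" by (intro sum_mono cH)
      also have "\<dots> = real (card ?PS) * K2" by simp
      also have "\<dots> \<le> K1 * K2" by (intro mult_right_mono cPS) (use K2 in simp)
      finally show ?thesis .
    qed
    let ?V = "\<lambda>A. {x. \<beta> * real N < real (card {i. i < N \<and> (f ^^ i) x \<in> A})}"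
    have sub: "{x\<in>space M. itinerary f P N x \<notin> G} \<subseteq> ?V B \<union> ?V D"
    proof (rule subsetI, rule ccontr)
      fix x assume x: "x \<in> {x\<in>space M. itinerary f P N x \<notin> G}" "x \<notin> ?V B \<union> ?V D"
      define u where "u j = Q ((f ^^ j) x)" for j
      have fi: "(f ^^ j) ((f ^^ i) x) = (f ^^ (i + j)) x" for i j
        by (simp add: funpow_add add.commute[of i j])
      have "card {i. i < N \<and> (f ^^ i) x \<in> B} \<le> b" using x(2) b_ge by simp
      moreover have "{i. i < N \<and> (f ^^ i) x \<in> B} = {i. i < N \<and> \<not> repeats n0 n1 T (\<lambda>j. u (0 + i + j))}"
        unfolding B_def u_def by (simp add: fi)
      ultimately have "card {i. i < N \<and> \<not> repeats n0 n1 T (\<lambda>j. u (0 + i + j))} \<le> b" by simp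
      moreover have "range u \<subseteq> S" using Q(2) by (auto simp: u_def)
      ultimately have par: "parsed S n0 n1 T W N b (map u [0..<0 + (N + W)])"
        using parsed_mono[OF parsed_sequence[of u S n0 n1 T W N 0]] n1(1) T_mono unfolding W_def n0_def by simp
      have "card {i. i < N \<and> (f ^^ i) x \<in> D} \<le> b" using x(2) b_ge by simp
      moreover have "{i. i < N \<and> (f ^^ i) x \<in> D} = {i. i < N \<and> itinerary f P N x ! i \<noteq> map u [0..<N] ! i}"
        by (auto simp: itinerary_def D_def u_def)
      ultimately have "card {i. i < N \<and> itinerary f P N x ! i \<noteq> map u [0..<N] ! i} \<le> b" by simp
      then have "itinerary f P N x \<in> hamming_ball S (map u [0..<N]) b"
        unfolding hamming_ball_def using P(2) by (auto simp: itinerary_def S_def)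
      moreover have "take N (map u [0..<0 + (N + W)]) = map u [0..<N]" by (simp add: take_map)
      ultimately have "itinerary f P N x \<in> G" unfolding G_def using par by (metis UN_I mem_Collect_eq)
      then show False using x(1) by simp
    qed
    have Vm: "?V A \<in> sets M" if "A \<in> sets M" for A
    proof -
      have "{x\<in>space M. \<beta> * real N < (\<Sum>i<N. indicator A ((f ^^ i) x))} \<in> sets M"
        using measurable_compose[OF iter_meas borel_measurable_indicator[OF that]] by measurable
      moreover have "(\<Sum>i<N. indicator A ((f ^^ i) x)) = real (card {i. i < N \<and> (f ^^ i) x \<in> A})" for x
      proof -
        have "(\<Sum>i<N. indicator A ((f ^^ i) x) :: real) = (\<Sum>i\<in>{i. i < N \<and> (f ^^ i) x \<in> A}. 1)"
          by (rule sum.mono_neutral_cong_right) (auto simp: indicator_def)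
        then show ?thesis by simp
      qed
      ultimately show ?thesis by simp
    qed
    have "prob {x\<in>space M. itinerary f P N x \<notin> G} \<le> prob (?V B \<union> ?V D)"
      by (intro finite_measure_mono sub sets.Un Vm B D)
    also have "\<dots> \<le> prob (?V B) + prob (?V D)"
      by (intro measure_Un_le Vm B D)
    also have "\<dots> \<le> prob B / \<beta> + prob D / \<beta>"
      by (intro add_mono visits_markov B D \<beta>)
    also have "\<dots> \<le> \<delta> + \<delta>"
      using n1(3) Q(3) \<beta> unfolding B_def[symmetric] D_def[symmetric] by (intro add_mono) (auto simp: field_simps)
    finally have bad: "prob {x\<in>space M. itinerary f P N x \<notin> G} \<le> 2 * \<delta>" by simp
    have simp_it: "simple_function M (itinerary f P N)" by (rule simple_function_itinerary(1)[OF P])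
    have cL: "real (card (itinerary f P N ` space M)) \<le> real k ^ N"
    proof -
      have "card (itinerary f P N ` space M) \<le> card {w. set w \<subseteq> {..<k} \<and> length w = N}"
        by (rule card_mono[OF finite_lists_length_eq simple_function_itinerary(2)[OF P]]) simp
      also have "\<dots> = k ^ N" by (subst card_lists_length_eq) auto
      finally show ?thesis by (metis of_nat_mono of_nat_power)
    qed
    have K12: "K1 * K2 \<ge> 1" using K1 K2 by (rule one_le_mult)
    have kN: "real k ^ N \<ge> 1" using k1 by (simp add: one_le_power)
    note H = partition_entropy_bounds[OF simp_it finG cG K12 cL kN bad]
    have "ln (K1 * K2) = ln K1 + ln K2" using K1 K2 by (simp add: ln_mult)
    also have "ln K1 = ln (real k ^ (n1 + W)) + 2 * \<delta> * real N + real b * ln y1"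
      unfolding K1_def using k1 y1 by (simp add: ln_mult ln_realpow)
    also have "ln K2 = real b * ln y2 + \<delta> * real N"
      unfolding K2_def using y2 by (simp add: ln_mult ln_realpow)
    finally have "ln (K1 * K2) = ln (real k ^ (n1 + W)) + 3 * \<delta> * real N + real b * (ln y1 + ln y2)"
      by (simp add: algebra_simps)
    also have "real b * (ln y1 + ln y2) \<le> (\<beta> * real N) * (ln y1 + ln y2)"
      by (intro mult_right_mono b) (use lny in simp)
    also have "\<dots> \<le> \<delta> * real N"
      using mult_right_mono[OF \<beta>y, of "real N"] by (simp add: mult_ac)
    finally have K12le: "ln (K1 * K2) \<le> ln (real k ^ (n1 + W)) + 4 * \<delta> * real N" by simp
    have lnk: "ln (real k ^ N) = real N * ln (real k)" using k1 by (simp add: ln_realpow)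
    have "partition_entropy M (itinerary f P N) \<le> C + 4 * \<delta> * real N + 2 * \<delta> * (real N * ln (real k))"
      using H(2)[unfolded lnk] K12le unfolding C_def by linarith
    also have "\<dots> \<le> C + (5 + 2 * ln (real k)) * \<delta> * real N"
      using \<delta> by (simp add: algebra_simps)
    finally show ?thesis using H(1) by blast
  qed
  show thesis by (rule that[of C]) (use main in blast)+
qed

text \<open>All approximations use the same \<open>k\<close> letters, so the factor of
  \<open>\<delta> * N\<close> in the entropy bound is a constant and \<open>\<delta>\<close> may
  tend to 0 after \<open>N\<close> has tended to infinity.\<close>

lemma entropy_zero_of_repetitive:
  assumes P: "P \<in> measurable M (count_space UNIV)" "range P \<subseteq> {..<k}" and k: "k \<ge> 1"
    and approx: "\<And>\<epsilon>. \<epsilon> > 0 \<Longrightarrow> \<exists>Q. Q \<in> measurable M (count_space UNIV) \<and> range Q \<subseteq> {..<k} \<and>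
      prob {x. P x \<noteq> Q x} \<le> \<epsilon> \<and> repetitive Q"
  shows "entropy_wrt_partition M f P = 0"
proof -
  define H where "H n = partition_entropy M (itinerary f P n)" for n
  define c where "c = 5 + 2 * ln (real k)"
  have c: "c > 0" using k by (simp add: c_def add_pos_nonneg)
  have "(\<lambda>n. H n / real n) \<longlonglongrightarrow> 0"
  proof (rule LIMSEQ_I)
    fix r :: real assume r: "r > 0"
    define \<delta> where "\<delta> = r / (2 * c)"
    have \<delta>: "\<delta> > 0" using r c by (simp add: \<delta>_def)
    obtain C where C: "\<And>N. 0 \<le> H N" "\<And>N. H N \<le> C + c * \<delta> * real N"
      using itinerary_entropy_bound[OF P k approx \<delta>] unfolding H_def c_def by metis
    obtain N0 :: nat where N0: "2 * \<bar>C\<bar> / r < real N0" using reals_Archimedean2 by blast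
    show "\<exists>no. \<forall>n\<ge>no. norm (H n / real n - 0) < r"
    proof (intro exI[of _ "Suc N0"] allI impI)
      fix n assume n: "n \<ge> Suc N0"
      then have n0: "real n > 0" by simp
      have "2 * \<bar>C\<bar> / r < real n" using N0 n by simp
      then have "\<bar>C\<bar> < r / 2 * real n" using r by (simp add: field_simps)
      moreover have "c * \<delta> = r / 2" using c by (simp add: \<delta>_def)
      then have "H n \<le> C + r / 2 * real n" using C(2)[of n] by (simp only:)
      ultimately have "H n < r * real n" by linarith
      then show "norm (H n / real n - 0) < r" using C(1)[of n] n0 by (simp add: field_simps)
    qed
  qed
  then show ?thesis unfolding entropy_wrt_partition_def H_def by (rule limI)
qed

end

subsection \<open>Tracking of labels along orbits\<close>

text \<open>Links the unordered sum in the average Lipschitz exponent to an integral, to which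
  Tonelli's theorem applies.\<close>

lemma nn_integral_count_space_le_infsum:
  fixes g :: "'i \<Rightarrow> ennreal"
  assumes "countable A"
  shows "(\<integral>\<^sup>+x. g x \<partial>count_space A) \<le> infsum g A"
proof (cases "finite A")
  case True
  then show ?thesis by (simp add: nn_integral_count_space_finite)
next
  case False
  have bij: "bij_betw (from_nat_into A) UNIV A" by (rule bij_betw_from_nat_into[OF assms False])
  have "(\<integral>\<^sup>+x. g x \<partial>count_space A) = (\<integral>\<^sup>+i. g (from_nat_into A i) \<partial>count_space UNIV)"
    by (rule nn_integral_bij_count_space[OF bij, symmetric])
  also have "\<dots> = (\<Sum>i. g (from_nat_into A i))" by (rule nn_integral_count_space_nat)
  also have "\<dots> = (SUP n. \<Sum>i<n. g (from_nat_into A i))" by (rule suminf_eq_SUP)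
  also have "\<dots> \<le> infsum g A"
  proof (rule SUP_least)
    fix n
    have "inj_on (from_nat_into A) {..<n}" using bij by (auto simp: bij_betw_def inj_on_def)
    then have "(\<Sum>i<n. g (from_nat_into A i)) = sum g (from_nat_into A ` {..<n})" by (simp add: sum.reindex)
    also have "\<dots> \<le> (SUP F\<in>{F. finite F \<and> F \<subseteq> A}. sum g F)"
      by (rule SUP_upper) (use bij in \<open>auto simp: bij_betw_def\<close>)
    also have "\<dots> = infsum g A" by (rule nonneg_infsum_complete[symmetric]) simp
    finally show "(\<Sum>i<n. g (from_nat_into A i)) \<le> infsum g A" .
  qed
  finally show ?thesis .
qed

lemma frontier_singularity: "A \<in> \<A> \<Longrightarrow> s \<in> frontier A \<Longrightarrow> s \<in> singularity_set \<A>"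
  unfolding singularity_set_def by blast

context measure_preserving begin

text \<open>\<open>h x\<close> is the positive part of the logarithm of the Lipschitz constant on
  the piece of \<open>x\<close>, and 0 outside all pieces; its integral is at most the average
  Lipschitz exponent. Being nonnegative, it fits the maximal inequality.\<close>

lemma log_lipschitz_integrable:
  assumes pl: "piecewise_lipschitz_wrt M f \<A> L" and avg: "avg_lipschitz_exponent M \<A> L < \<infinity>"
  obtains h :: "'a \<Rightarrow> real" where "integrable M h" "\<And>x. 0 \<le> h x"
    "\<And>A x. A \<in> \<A> \<Longrightarrow> x \<in> A \<Longrightarrow> L A \<le> exp (h x)"
proof -
  have op: "open_partition_mod M \<A>" using pl by (simp add: piecewise_lipschitz_wrt_def)
  have cnt: "countable \<A>" by (rule open_partition_countable[OF op])
  have Am: "A \<in> sets M" if "A \<in> \<A>" for A using op that by (auto simp: open_partition_mod_def sets_M)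
  have dj: "A = B" if "A \<in> \<A>" "B \<in> \<A>" "x \<in> A" "x \<in> B" for A B x
    using op that by (auto simp: open_partition_mod_def disjoint_def)
  define c where "c A = max (ln (L A)) 0" for A
  define h where "h x = (if x \<in> \<Union>\<A> then c (THE A. A \<in> \<A> \<and> x \<in> A) else 0)" for x
  have h_eq: "h x = c A" if "A \<in> \<A>" "x \<in> A" for A x
  proof -
    have "(THE A. A \<in> \<A> \<and> x \<in> A) = A" by (rule the_equality) (use that dj in blast)+
    then show ?thesis using that by (auto simp: h_def)
  qed
  have h0: "0 \<le> h x" for x by (simp add: h_def c_def)
  have hm: "h \<in> borel_measurable M"
  proof (rule measurableI)
    fix S :: "real set"
    have Un: "\<Union>\<B> \<in> sets M" if "\<B> \<subseteq> \<A>" for \<B>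
      by (rule sets.countable_Union) (use that Am countable_subset[OF that cnt] in auto)
    have "h -` S \<inter> space M = \<Union>{A\<in>\<A>. c A \<in> S} \<union> (if 0 \<in> S then space M - \<Union>\<A> else {})"
    proof (intro equalityI subsetI)
      fix x assume x: "x \<in> h -` S \<inter> space M"
      show "x \<in> \<Union>{A\<in>\<A>. c A \<in> S} \<union> (if 0 \<in> S then space M - \<Union>\<A> else {})"
      proof (cases "x \<in> \<Union>\<A>")
        case True
        then obtain A where "A \<in> \<A>" "x \<in> A" by blast
        then show ?thesis using x h_eq by auto
      next
        case False
        then show ?thesis using x by (auto simp: h_def)
      qed
    next
      fix x assume "x \<in> \<Union>{A\<in>\<A>. c A \<in> S} \<union> (if 0 \<in> S then space M - \<Union>\<A> else {})"
      then consider A where "A \<in> \<A>" "c A \<in> S" "x \<in> A" | "0 \<in> S" "x \<notin> \<Union>\<A>"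
        by (auto split: if_splits)
      then show "x \<in> h -` S \<inter> space M"
      proof cases
        case 1
        then show ?thesis using h_eq[of A x] by simp
      next
        case 2
        then show ?thesis unfolding h_def by simp
      qed
    qed
    also have "\<dots> \<in> sets M" using Un[of "{A\<in>\<A>. c A \<in> S}"] Un[of \<A>] by auto
    finally show "h -` S \<inter> space M \<in> sets M" .
  qed simp
  have "(\<integral>\<^sup>+x. ennreal (h x) \<partial>M) \<le> (\<integral>\<^sup>+x. (\<integral>\<^sup>+A. ennreal (c A) * indicator A x \<partial>count_space \<A>) \<partial>M)"
  proof (rule nn_integral_mono)
    fix x
    show "ennreal (h x) \<le> (\<integral>\<^sup>+A. ennreal (c A) * indicator A x \<partial>count_space \<A>)"
    proof (cases "x \<in> \<Union>\<A>")
      case True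
      then obtain A where A: "A \<in> \<A>" "x \<in> A" by blast
      then have "ennreal (h x) = ennreal (c A) * indicator A x" by (simp add: h_eq)
      also have "\<dots> \<le> (\<integral>\<^sup>+A. ennreal (c A) * indicator A x \<partial>count_space \<A>)"
        using nn_integral_ge_point[OF A(1), of "\<lambda>A. ennreal (c A) * indicator A x"] .
      finally show ?thesis .
    next
      case False
      then show ?thesis by (simp add: h_def)
    qed
  qed
  also have "\<dots> = (\<integral>\<^sup>+A. (\<integral>\<^sup>+x. ennreal (c A) * indicator A x \<partial>M) \<partial>count_space \<A>)"
    by (rule nn_integral_count_space_nn_integral[OF cnt]) (use Am in auto)
  also have "\<dots> = (\<integral>\<^sup>+A. ennreal (c A) * emeasure M A \<partial>count_space \<A>)"
    by (rule nn_integral_cong) (use Am in \<open>auto simp: nn_integral_cmult_indicator\<close>)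
  also have "\<dots> \<le> (\<Sum>\<^sub>\<infinity>A\<in>\<A>. ennreal (c A) * emeasure M A)"
    by (rule nn_integral_count_space_le_infsum[OF cnt])
  also have "\<dots> < \<infinity>" using avg by (simp add: avg_lipschitz_exponent_def c_def)
  finally have "integrable M h" by (intro integrableI_nonneg hm) (use h0 in auto)
  moreover have "L A \<le> exp (h x)" if "A \<in> \<A>" "x \<in> A" for A x
  proof -
    have "(L A)-lipschitz_on A f" using pl that by (auto simp: piecewise_lipschitz_wrt_def)
    then have "0 \<le> L A" by (rule lipschitz_on_nonneg)
    show ?thesis
    proof (cases "L A = 0")
      case False
      then have "L A = exp (ln (L A))" using \<open>0 \<le> L A\<close> by simp
      also have "\<dots> \<le> exp (h x)" by (simp add: h_eq[OF that] c_def)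
      finally show ?thesis .
    qed simp
  qed
  ultimately show thesis using that h0 by blast
qed

text \<open>Borel-Cantelli yields the claim with constant 1 for all large \<open>k\<close>. The
  finitely many other times are repaired by shrinking the constant: the intersection of all
  \<open>B (exp (- m))\<close> is null, so each iterate misses one of these sets. Used for the
  neighbourhoods of the singularities and of the jumps of a labelling.\<close>

lemma AE_iter_avoids:
  assumes mono: "\<And>\<epsilon> \<epsilon>'. \<epsilon> \<le> \<epsilon>' \<Longrightarrow> B \<epsilon> \<subseteq> B \<epsilon>'" and B: "\<And>\<epsilon>. B \<epsilon> \<in> sets M"
    and sm: "summable (\<lambda>k::nat. prob (B (exp (- real k))))"
  shows "AE x in M. \<exists>c>0. \<forall>k. (f ^^ k) x \<notin> B (c * exp (- real k))"
proof -
  have "AE x in M. eventually (\<lambda>k. x \<notin> (f ^^ k) -` B (exp (- real k))) sequentially"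
    by (rule borel_cantelli_eventually) (use B sm measure_iter[OF B] in auto)
  moreover have "AE x in M. \<forall>k. (f ^^ k) x \<notin> (\<Inter>m. B (exp (- real m)))"
  proof (rule AE_iter)
    have "prob (\<Inter>m. B (exp (- real m))) \<le> prob (B (exp (- real m)))" for m :: nat
      by (intro finite_measure_mono B) auto
    then have "prob (\<Inter>m. B (exp (- real m))) \<le> 0"
      by (intro LIMSEQ_le_const[OF summable_LIMSEQ_zero[OF sm]]) auto
    then have "(\<Inter>m. B (exp (- real m))) \<in> null_sets M"
      using B by (auto simp: null_sets_def emeasure_eq_measure measure_le_0_iff)
    then show "AE x in M. x \<notin> (\<Inter>m. B (exp (- real m)))" by (rule AE_not_in)
  qed
  ultimately show ?thesis
  proof eventually_elim
    case (elim x)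
    then obtain k0 where k0: "\<And>k. k \<ge> k0 \<Longrightarrow> (f ^^ k) x \<notin> B (exp (- real k))"
      unfolding eventually_sequentially by auto
    from elim(2) have "\<forall>k. \<exists>m::nat. (f ^^ k) x \<notin> B (exp (- real m))" by blast
    then obtain m :: "nat \<Rightarrow> nat" where m: "\<And>k. (f ^^ k) x \<notin> B (exp (- real (m k)))" by metis
    define q where "q = (\<Sum>k<k0. m k)"
    have "(f ^^ k) x \<notin> B (exp (- real q) * exp (- real k))" for k
    proof (cases "k < k0")
      case True
      then have "m k \<le> q" unfolding q_def by (intro member_le_sum) auto
      then have "exp (- real q) * exp (- real k) \<le> exp (- real (m k))"
        by (simp add: exp_add[symmetric])
      then show ?thesis using mono m by blast
    next
      case False
      have "exp (- real q) * exp (- real k) \<le> exp (- real k)" by simp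
      then show ?thesis using mono k0[of k] False by (meson not_less subsetD)
    qed
    then show ?case by (intro exI[of _ "exp (- real q)"]) auto
  qed
qed

text \<open>If the product of the Lipschitz constants up to time \<open>j\<close> is at most
  \<open>exp (l * j)\<close> and the starting distance is below
  \<open>c * exp (- ((l + 1) * n))\<close>, then at time \<open>j \<le> n\<close> the orbits are
  closer than \<open>c * exp (- j)\<close>, the margin by which \<open>x\<close> avoids the
  singularities. So both stay in the same piece. The 1 in \<open>l + 1\<close> is this
  margin.\<close>

lemma AE_orbit_expansion:
  assumes pl: "piecewise_lipschitz_wrt M f \<A> L" and avg: "avg_lipschitz_exponent M \<A> L < \<infinity>"
  shows "AE x in M. \<exists>c>0. \<exists>\<kappa>>0. \<forall>n y. dist y x < c * exp (- (\<kappa> * real n)) \<longrightarrow>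
      (\<forall>j\<le>n. dist ((f ^^ j) y) ((f ^^ j) x) \<le> exp (\<kappa> * real j) * dist y x)"
proof -
  obtain h :: "'a \<Rightarrow> real" where h: "integrable M h" "\<And>x. 0 \<le> h x"
    "\<And>A x. A \<in> \<A> \<Longrightarrow> x \<in> A \<Longrightarrow> L A \<le> exp (h x)"
    using log_lipschitz_integrable[OF pl avg] by metis
  have op: "open_partition_mod M \<A>" using pl by (simp add: piecewise_lipschitz_wrt_def)
  have lip: "(L A)-lipschitz_on A f" if "A \<in> \<A>" for A using pl that by (simp add: piecewise_lipschitz_wrt_def)
  obtain K a where Ka: "K > 0" "a > 0"
    "\<And>\<epsilon>. \<epsilon> > 0 \<Longrightarrow> prob {x. \<exists>y\<in>singularity_set \<A>. dist x y < \<epsilon>} \<le> K * \<epsilon> powr a"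
    using pl by (auto simp: piecewise_lipschitz_wrt_def)
  define B where "B \<epsilon> = {x. \<exists>y\<in>singularity_set \<A>. dist x y < \<epsilon>}" for \<epsilon>
  have "B \<epsilon> = (\<Union>y\<in>singularity_set \<A>. ball y \<epsilon>)" for \<epsilon> by (auto simp: B_def dist_commute)
  then have B: "B \<epsilon> \<in> sets M" for \<epsilon> by (simp add: sets_M open_UN)
  have "summable (\<lambda>k::nat. prob (B (exp (- real k))))"
  proof (rule summable_comparison_test'[OF summable_mult[OF summable_exp_neg[OF Ka(2)]]])
    fix k :: nat
    have "prob (B (exp (- real k))) \<le> K * exp (- real k) powr a" unfolding B_def by (rule Ka) simp
    then show "norm (prob (B (exp (- real k)))) \<le> K * exp (- (a * real k))"
      by (simp add: exp_powr_real mult.commute)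
  qed
  then have "AE x in M. \<exists>c>0. \<forall>k. (f ^^ k) x \<notin> B (c * exp (- real k))"
    by (intro AE_iter_avoids B) (auto simp: B_def intro: less_le_trans)
  moreover have "AE x in M. \<exists>c>0. \<forall>n. (\<Sum>k<n. h ((f ^^ k) x)) \<le> c * real n"
    by (rule AE_sum_linear_growth[OF h(1,2)])
  moreover have "AE x in M. \<forall>k. (f ^^ k) x \<in> \<Union>\<A>"
    by (rule AE_iter) (use op in \<open>simp add: open_partition_mod_def\<close>)
  ultimately show ?thesis
  proof eventually_elim
    case (elim x)
    then obtain c l where c: "c > 0" "\<And>k. (f ^^ k) x \<notin> B (c * exp (- real k))"
      and l: "l > 0" "\<And>n. (\<Sum>k<n. h ((f ^^ k) x)) \<le> l * real n" by blast
    have "dist ((f ^^ j) y) ((f ^^ j) x) \<le> exp (\<Sum>k<j. h ((f ^^ k) x)) * dist y x"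
      if d: "dist y x < c * exp (- ((l + 1) * real n))" and jn: "j \<le> n" for n y j
      using jn
    proof (induction j)
      case (Suc j)
      have "exp (\<Sum>k<j. h ((f ^^ k) x)) * dist y x \<le> exp (l * real j) * dist y x"
        using l(2)[of j] by (intro mult_right_mono) auto
      also have "\<dots> < exp (l * real j) * (c * exp (- ((l + 1) * real n)))"
        using d by (intro mult_strict_left_mono) auto
      also have "\<dots> \<le> exp (l * real j) * (c * exp (- ((l + 1) * real j)))"
        using Suc.prems l(1) c(1) by (intro mult_left_mono) auto
      also have "\<dots> = c * exp (- real j)" by (simp add: exp_add[symmetric] algebra_simps)
      finally have close: "dist ((f ^^ j) y) ((f ^^ j) x) < c * exp (- real j)"
        using Suc by simp
      from elim(3) obtain A where A: "A \<in> \<A>" "(f ^^ j) x \<in> A" by blast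
      have yA: "(f ^^ j) y \<in> A"
      proof (rule ccontr)
        assume "(f ^^ j) y \<notin> A"
        let ?b = "ball ((f ^^ j) x) (c * exp (- real j))"
        \<comment> \<open>Balls are connected, so one that meets both \<open>A\<close> and its
          complement meets the frontier of \<open>A\<close>. It thus suffices that the orbit of
          \<open>x\<close> alone stays away from the singularities.\<close>
        have "?b \<inter> frontier A \<noteq> {}"
        proof (rule connected_Int_frontier)
          show "connected ?b" by (simp add: convex_connected)
          have "(f ^^ j) x \<in> ?b \<inter> A" using A c(1) by simp
          then show "?b \<inter> A \<noteq> {}" by blast
          have "(f ^^ j) y \<in> ?b - A" using \<open>(f ^^ j) y \<notin> A\<close> close by (simp add: dist_commute)
          then show "?b - A \<noteq> {}" by blast
        qed
        then show False using c(2)[of j] frontier_singularity[OF A(1)] unfolding B_def by auto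
      qed
      have "dist ((f ^^ Suc j) y) ((f ^^ Suc j) x) \<le> L A * dist ((f ^^ j) y) ((f ^^ j) x)"
        using lipschitz_onD[OF lip[OF A(1)] yA A(2)] by simp
      also have "\<dots> \<le> exp (h ((f ^^ j) x)) * (exp (\<Sum>k<j. h ((f ^^ k) x)) * dist y x)"
        using Suc h(3)[OF A] by (intro mult_mono) auto
      finally show ?case by (simp add: exp_add mult_ac)
    qed simp
    moreover have "exp (\<Sum>k<j. h ((f ^^ k) x)) * dist y x \<le> exp ((l + 1) * real j) * dist y x" for j y
      using l(2)[of j] by (intro mult_right_mono) (auto simp: algebra_simps)
    ultimately have "\<forall>n y. dist y x < c * exp (- ((l + 1) * real n)) \<longrightarrow>
      (\<forall>j\<le>n. dist ((f ^^ j) y) ((f ^^ j) x) \<le> exp ((l + 1) * real j) * dist y x)"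
      by (meson order_trans)
    moreover have "l + 1 > 0" using l(1) by simp
    ultimately show ?case using c(1) by blast
  qed
qed

section \<open>Labellings obtained by rounding a Lipschitz function\<close>

lemma lipschitz_label_approximation:
  fixes P :: "'a \<Rightarrow> nat"
  assumes P: "P \<in> measurable M (count_space UNIV)" "range P \<subseteq> {..<k}" and k: "k \<ge> 1" and \<epsilon>: "\<epsilon> > 0"
  obtains g C where "C-lipschitz_on UNIV g" "\<And>x. 0 \<le> g x" "\<And>x. g x \<le> real k - 1"
    "{x. g x \<noteq> real (P x)} \<in> sets M" "prob {x. g x \<noteq> real (P x)} \<le> \<epsilon>"
proof -
  have Pm: "P -` {i} \<in> sets M" for i
    using measurable_sets[OF P(1), of "{i}"] by simp
  \<comment> \<open>Inner regularity: almost all of each label set is exhausted by a compact set.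
    Finitely many disjoint compact sets keep a positive distance \<open>D\<close>, so a function
    prescribed to be constant on each of them can be Lipschitz.\<close>
  have "\<exists>K. K \<subseteq> P -` {i} \<and> compact K \<and> prob (P -` {i}) \<le> prob K + \<epsilon> / k" for i
  proof -
    have "emeasure M (P -` {i}) = (SUP K \<in> {K. K \<subseteq> P -` {i} \<and> compact K}. emeasure M K)"
      by (rule inner_regular[OF sets_M]) (use Pm in \<open>auto simp: sets_M\<close>)
    show ?thesis
    proof (rule ccontr)
      assume "\<not> ?thesis"
      then have neg: "prob K + \<epsilon> / k < prob (P -` {i})" if "K \<subseteq> P -` {i}" "compact K" for K
        using that by (meson not_le)
      have "emeasure M (P -` {i}) \<le> ennreal (prob (P -` {i}) - \<epsilon> / k)"
        unfolding \<open>emeasure M (P -` {i}) = _\<close>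
      proof (rule SUP_least)
        fix K assume "K \<in> {K. K \<subseteq> P -` {i} \<and> compact K}"
        then have "prob K \<le> prob (P -` {i}) - \<epsilon> / k" using neg[of K] by simp
        then show "emeasure M K \<le> ennreal (prob (P -` {i}) - \<epsilon> / k)"
          by (simp add: emeasure_eq_measure ennreal_leI)
      qed
      moreover have "0 \<le> prob (P -` {i}) - \<epsilon> / k"
        using neg[of "{}"] by simp
      ultimately have "prob (P -` {i}) \<le> prob (P -` {i}) - \<epsilon> / k"
        by (simp add: emeasure_eq_measure)
      then show False using \<epsilon> k by (simp add: field_simps)
    qed
  qed
  then obtain K where K: "\<And>i. K i \<subseteq> P -` {i}" "\<And>i. compact (K i)"
    "\<And>i. prob (P -` {i}) \<le> prob (K i) + \<epsilon> / k" by metis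
  have "\<exists>d>0. \<forall>x\<in>K i. \<forall>y\<in>K j. d \<le> dist x y" if "i \<noteq> j" for i j
  proof (rule separate_compact_closed[OF K(2) compact_imp_closed[OF K(2)]])
    show "K i \<inter> K j = {}" using K(1)[of i] K(1)[of j] that by fastforce
  qed
  then have "\<exists>d. d > 0 \<and> (i \<noteq> j \<longrightarrow> (\<forall>x\<in>K i. \<forall>y\<in>K j. d \<le> dist x y))" for i j
    by (cases "i = j") (auto intro: exI[of _ "1::real"])
  then obtain d where d: "\<And>i j. d i j > 0" "\<And>i j x y. i \<noteq> j \<Longrightarrow> x \<in> K i \<Longrightarrow> y \<in> K j \<Longrightarrow> d i j \<le> dist x y"
    by metis
  define D where "D = Min (insert 1 ((\<lambda>(i, j). d i j) ` ({..<k} \<times> {..<k})))"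
  have D: "D > 0" unfolding D_def using d(1) by (subst Min_gr_iff) auto
  have Dle: "D \<le> dist x y" if "i < k" "j < k" "i \<noteq> j" "x \<in> K i" "y \<in> K j" for i j x y
  proof -
    have "D \<le> d i j" unfolding D_def by (rule Min_le) (use that in auto)
    then show ?thesis using d(2)[OF that(3-5)] by linarith
  qed
  \<comment> \<open>Empty compact sets are left out: as \<open>infdist x {} = 0\<close>, their tent
    function would be 1 everywhere.\<close>
  define J where "J = {i. i < k \<and> K i \<noteq> {}}"
  have finJ: "finite J" by (simp add: J_def)
  define w where "w i x = max 0 (1 - infdist x (K i) / D)" for i x
  \<comment> \<open>The tents have width \<open>D\<close>, so on \<open>K j\<close> only the tent of
    \<open>j\<close> survives and \<open>g = j\<close>. The cap at \<open>k - 1\<close> keeps the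
    rounded values inside the original alphabet.\<close>
  define g where "g x = min (real k - 1) (\<Sum>i\<in>J. real i * w i x)" for x
  have w_lip: "\<bar>w i x - w i y\<bar> \<le> dist x y / D" for i x y
  proof -
    have "\<bar>infdist x (K i) / D - infdist y (K i) / D\<bar> \<le> dist x y / D"
      using infdist_triangle_abs[of x "K i" y] D by (simp add: diff_divide_distrib[symmetric] divide_right_mono)
    then show ?thesis unfolding w_def by (auto simp: max_def abs_le_iff)
  qed
  have lip: "(\<Sum>i\<in>J. real i / D)-lipschitz_on UNIV g"
  proof (rule lipschitz_onI)
    fix x y
    have "\<bar>(\<Sum>i\<in>J. real i * w i x) - (\<Sum>i\<in>J. real i * w i y)\<bar> \<le> (\<Sum>i\<in>J. \<bar>real i * w i x - real i * w i y\<bar>)"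
      unfolding sum_subtractf[symmetric] by (rule sum_abs)
    also have "\<dots> \<le> (\<Sum>i\<in>J. real i / D * dist x y)"
    proof (rule sum_mono)
      fix i
      have "\<bar>real i * w i x - real i * w i y\<bar> = real i * \<bar>w i x - w i y\<bar>"
        by (simp add: right_diff_distrib[symmetric] abs_mult)
      also have "\<dots> \<le> real i * (dist x y / D)" by (intro mult_left_mono w_lip) simp
      finally show "\<bar>real i * w i x - real i * w i y\<bar> \<le> real i / D * dist x y" by simp
    qed
    finally show "dist (g x) (g y) \<le> (\<Sum>i\<in>J. real i / D) * dist x y"
      unfolding g_def dist_real_def sum_distrib_right by (auto simp: min_def abs_le_iff)
  qed (use D in \<open>auto intro: sum_nonneg\<close>)
  have g_eq: "g x = real j" if "j < k" "x \<in> K j" for x j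
  proof -
    have "w i x = (if i = j then 1 else 0)" if i: "i \<in> J" for i
    proof (cases "i = j")
      case True
      then show ?thesis using \<open>x \<in> K j\<close> by (simp add: w_def)
    next
      case False
      have ne: "K i \<noteq> {}" using i by (simp add: J_def)
      have "D \<le> infdist x (K i)"
        unfolding infdist_notempty[OF ne]
        by (rule cINF_greatest[OF ne]) (use Dle[of j i x] False i \<open>j < k\<close> \<open>x \<in> K j\<close> in \<open>auto simp: J_def\<close>)
      then show ?thesis using False D by (simp add: w_def)
    qed
    then have "(\<Sum>i\<in>J. real i * w i x) = (\<Sum>i\<in>J. if i = j then real i else 0)"
      by (intro sum.cong) auto
    also have "\<dots> = real j" using finJ that by (auto simp: sum.delta J_def)
    finally show ?thesis using that by (simp add: g_def)
  qed
  have Km: "K i \<in> sets M" for i using K(2)[of i] by (simp add: sets_M compact_imp_closed)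
  have bad: "{x. g x \<noteq> real (P x)} \<subseteq> (\<Union>i\<in>{..<k}. P -` {i} - K i)"
  proof
    fix x assume x: "x \<in> {x. g x \<noteq> real (P x)}"
    have "P x < k" using P(2) by (auto simp: image_subset_iff)
    then show "x \<in> (\<Union>i\<in>{..<k}. P -` {i} - K i)" using x g_eq[of "P x" x] by auto
  qed
  show thesis
  proof (rule that[OF lip])
    show "0 \<le> g x" for x using k by (auto simp: g_def w_def intro!: sum_nonneg)
    show "g x \<le> real k - 1" for x by (simp add: g_def)
    have "g \<in> borel_measurable M" by (rule lipschitz_meas[OF lip])
    moreover have "(\<lambda>x. real (P x)) \<in> borel_measurable M" by (rule measurable_compose[OF P(1)]) simp
    ultimately have "{x\<in>space M. g x \<noteq> real (P x)} \<in> sets M" by measurable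
    then show "{x. g x \<noteq> real (P x)} \<in> sets M" by simp
    have "prob {x. g x \<noteq> real (P x)} \<le> prob (\<Union>i\<in>{..<k}. P -` {i} - K i)"
      by (intro finite_measure_mono bad sets.finite_UN) (use Pm Km in auto)
    also have "\<dots> \<le> (\<Sum>i\<in>{..<k}. prob (P -` {i} - K i))"
      by (intro finite_measure_subadditive_finite) (use Pm Km in auto)
    also have "\<dots> \<le> (\<Sum>i\<in>{..<k}. \<epsilon> / k)"
    proof (rule sum_mono)
      fix i
      have "prob (P -` {i} - K i) = prob (P -` {i}) - prob (K i)"
        by (rule finite_measure_Diff) (use Pm Km K in auto)
      then show "prob (P -` {i} - K i) \<le> \<epsilon> / k" using K(3)[of i] by simp
    qed
    also have "\<dots> = \<epsilon>" using k by simp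
    finally show "prob {x. g x \<noteq> real (P x)} \<le> \<epsilon>" .
  qed
qed

text \<open>Neighbourhoods of the jumps of the labelling \<open>\<lfloor>g + t\<rfloor>\<close>. For
  \<open>0 \<le> g \<le> k - 1\<close> and \<open>0 < t < 1\<close> only the integers from 0 to
  \<open>k\<close> can matter.\<close>

definition near_integer :: "('a \<Rightarrow> real) \<Rightarrow> nat \<Rightarrow> real \<Rightarrow> real \<Rightarrow> 'a set" where
  "near_integer g k t \<epsilon> = {x. \<exists>z\<in>{..k}. \<bar>g x + t - real z\<bar> \<le> \<epsilon>}"

lemma near_integer_sets:
  assumes "g \<in> borel_measurable M"
  shows "near_integer g k t \<epsilon> \<in> sets M"
proof -
  have "{x\<in>space M. \<exists>z\<in>{..k}. \<bar>g x + t - real z\<bar> \<le> \<epsilon>} \<in> sets M" using assms by measurable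
  then show ?thesis by (simp add: near_integer_def)
qed

text \<open>By Fubini, almost every \<open>t\<close> works.\<close>

lemma good_translation:
  assumes g: "g \<in> borel_measurable M"
  obtains t :: real where "0 < t" "t < 1" "summable (\<lambda>n::nat. prob (near_integer g k t (exp (- real n))))"
proof -
  interpret P: pair_sigma_finite M lborel by unfold_locales
  define S where "S n z t = {x\<in>space M. \<bar>g x + t - real z\<bar> \<le> exp (- real n)}" for n z :: nat and t :: real
  have S: "S n z t \<in> sets M" for n z t unfolding S_def using g by measurable
  define I where "I n z x t = (indicator {u. \<bar>u\<bar> \<le> exp (- real n)} (g x + t - real z) :: ennreal)" for n z :: nat and x t
  have Im: "(\<lambda>(x, t). I n z x t) \<in> borel_measurable (M \<Otimes>\<^sub>M lborel)" for n z
  proof -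
    have "{u :: real. \<bar>u\<bar> \<le> exp (- real n)} \<in> sets borel" by simp
    moreover have "(\<lambda>(x, t). g x + t - real z) \<in> borel_measurable (M \<Otimes>\<^sub>M lborel)" using g by measurable
    ultimately show ?thesis unfolding I_def case_prod_beta
      by (intro measurable_compose[where N=borel, OF _ borel_measurable_indicator]) auto
  qed
  have Ix: "(\<integral>\<^sup>+x. I n z x t \<partial>M) = emeasure M (S n z t)" for n z t
  proof -
    have "(\<integral>\<^sup>+x. I n z x t \<partial>M) = (\<integral>\<^sup>+x. indicator (S n z t) x \<partial>M)"
      by (intro nn_integral_cong) (auto simp: I_def S_def indicator_def)
    then show ?thesis using S by simp
  qed
  have It: "(\<integral>\<^sup>+t. I n z x t \<partial>lborel) = ennreal (2 * exp (- real n))" for n z x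
  proof -
    have "(\<integral>\<^sup>+t. I n z x t \<partial>lborel) = (\<integral>\<^sup>+t. indicator {real z - g x - exp (- real n)..real z - g x + exp (- real n)} t \<partial>lborel)"
      by (intro nn_integral_cong) (auto simp: I_def indicator_def abs_le_iff)
    then show ?thesis by simp
  qed
  \<comment> \<open>\<open>G t\<close> dominates the series of probabilities. Its integral over
    \<open>t\<close> is finite, since for every single \<open>x\<close> and \<open>z\<close> the
    translations \<open>t\<close> to be avoided form an interval of length
    \<open>2 * exp (- n)\<close>.\<close>
  define G where "G t = (\<Sum>n. \<Sum>z\<le>k. emeasure M (S n z t))" for t
  have Sm: "(\<lambda>t. emeasure M (S n z t)) \<in> borel_measurable lborel" for n z
  proof -
    have "{u :: real. \<bar>u\<bar> \<le> exp (- real n)} \<in> sets borel" by simp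
    moreover have "(\<lambda>(t, x). g x + t - real z) \<in> borel_measurable (lborel \<Otimes>\<^sub>M M)" using g by measurable
    ultimately have "(\<lambda>(t, x). I n z x t) \<in> borel_measurable (lborel \<Otimes>\<^sub>M M)" unfolding I_def case_prod_beta
      by (intro measurable_compose[where N=borel, OF _ borel_measurable_indicator]) auto
    then show ?thesis unfolding Ix[symmetric] by (rule borel_measurable_nn_integral)
  qed
  have int1: "(\<integral>\<^sup>+t. emeasure M (S n z t) \<partial>lborel) = ennreal (2 * exp (- real n))" for n z
  proof -
    have "(\<integral>\<^sup>+t. emeasure M (S n z t) \<partial>lborel) = (\<integral>\<^sup>+t. \<integral>\<^sup>+x. I n z x t \<partial>M \<partial>lborel)" by (simp add: Ix)
    also have "\<dots> = (\<integral>\<^sup>+x. \<integral>\<^sup>+t. I n z x t \<partial>lborel \<partial>M)" by (rule P.Fubini'[OF Im])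
    also have "\<dots> = ennreal (2 * exp (- real n))" by (simp add: It emeasure_space_1[simplified])
    finally show ?thesis .
  qed
  have Gm: "G \<in> borel_measurable lborel" unfolding G_def using Sm by measurable
  have "(\<integral>\<^sup>+t. G t \<partial>lborel) = (\<Sum>n. (\<Sum>z\<le>k. ennreal (2 * exp (- real n))))"
    unfolding G_def using Sm by (subst nn_integral_suminf) (auto simp: nn_integral_sum int1)
  also have "\<dots> = (\<Sum>n. ennreal (real (Suc k) * (2 * exp (- real n))))"
    by (simp add: ennreal_of_nat_eq_real_of_nat ennreal_mult' del: of_nat_Suc)
  also have "\<dots> < top"
  proof -
    have "summable (\<lambda>n::nat. real (Suc k) * (2 * exp (- real n)))"
      using summable_exp_neg[of 1] by (intro summable_mult) simp
    then have "(\<Sum>n. ennreal (real (Suc k) * (2 * exp (- real n)))) = ennreal (\<Sum>n. real (Suc k) * (2 * exp (- real n)))"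
      by (intro suminf_ennreal2) auto
    then show ?thesis by simp
  qed
  finally have "AE t in lborel. G t \<noteq> \<infinity>"
    by (intro nn_integral_PInf_AE[OF Gm]) auto
  then have "\<exists>t. 0 < t \<and> t < 1 \<and> G t \<noteq> \<infinity>"
  proof (rule contrapos_pp)
    assume "\<not> ?thesis"
    then have all: "\<And>t. 0 < t \<Longrightarrow> t < 1 \<Longrightarrow> G t = \<infinity>" by blast
    show "\<not> (AE t in lborel. G t \<noteq> \<infinity>)"
    proof
      assume "AE t in lborel. G t \<noteq> \<infinity>"
      then have "AE t in lborel. t \<notin> {0<..<1 :: real}" by (rule AE_mp) (use all in \<open>auto intro!: AE_I2\<close>)
      then have "{0<..<1::real} \<in> null_sets lborel" by (subst AE_iff_null_sets) auto
      then have "emeasure lborel {0<..<1::real} = 0" by (rule null_setsD1)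
      then show False by simp
    qed
  qed
  then obtain t where t: "0 < t" "t < 1" "G t \<noteq> \<infinity>" by blast
  have le: "emeasure M (near_integer g k t (exp (- real n))) \<le> (\<Sum>z\<le>k. emeasure M (S n z t))" for n
  proof -
    have "near_integer g k t (exp (- real n)) = (\<Union>z\<in>{..k}. S n z t)"
      by (auto simp: near_integer_def S_def)
    then show ?thesis
      by (simp only:) (rule emeasure_subadditive_finite, use S in auto)
  qed
  have "(\<Sum>n. ennreal (prob (near_integer g k t (exp (- real n))))) \<le> G t"
    unfolding G_def emeasure_eq_measure[symmetric] by (intro suminf_le le) auto
  then have "(\<Sum>n. ennreal (prob (near_integer g k t (exp (- real n))))) \<noteq> top"
    using t(3) by (auto simp: top_unique)
  then have "summable (\<lambda>n. prob (near_integer g k t (exp (- real n))))"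
    by (intro summable_suminf_not_top) auto
  then show thesis using that t by blast
qed

end

subsection \<open>Fast returns\<close>

text \<open>If the floors differed, an integer would separate \<open>a + t\<close> from
  \<open>b + t\<close> and so lie within \<open>d\<close> of \<open>a + t\<close>; the ranges force
  it to be one of \<open>0, ..., k\<close>.\<close>

lemma floor_eq_of_far_from_integers:
  fixes a b d t :: real
  assumes ab: "\<bar>a - b\<bar> \<le> d" and far: "\<And>z. z \<le> k \<Longrightarrow> \<bar>a + t - real z\<bar> > d"
    and r: "0 \<le> a" "0 \<le> b" "a \<le> real k - 1" "b \<le> real k - 1" and t: "0 < t" "t < 1"
  shows "nat \<lfloor>a + t\<rfloor> = nat \<lfloor>b + t\<rfloor>"
proof -
  have key: False
    if "u + t < of_int z" "of_int z \<le> v + t" "u = a \<and> v = b \<or> u = b \<and> v = a" for u v :: real and z :: int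
  proof -
    have "0 \<le> z" "z \<le> int k" using that r t by linarith+
    then have "\<bar>a + t - of_int z\<bar> > d" using far[of "nat z"] by simp
    then show False using that ab by linarith
  qed
  have "\<lfloor>a + t\<rfloor> = \<lfloor>b + t\<rfloor>"
  proof (cases "\<lfloor>a + t\<rfloor>" "\<lfloor>b + t\<rfloor>" rule: linorder_cases)
    case less
    then have "a + t < of_int \<lfloor>b + t\<rfloor>" by (simp only: floor_less_iff)
    then show ?thesis using key[OF _ of_int_floor_le] by blast
  next
    case greater
    then have "b + t < of_int \<lfloor>a + t\<rfloor>" by (simp only: floor_less_iff)
    then show ?thesis using key[OF _ of_int_floor_le] by blast
  qed
  then show ?thesis by simp
qed

context measure_preserving begin

text \<open>Outside this set the lower recurrence rate is positive, so that only returns after time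
  \<open>exp (a m)\<close> matter, where the decay of correlations is effective.\<close>

definition fast_return_set :: "'a set" where
  "fast_return_set = (\<Inter>j. \<Inter>m0. \<Union>m\<in>{m0..}. \<Union>n\<in>{n. 1 \<le> n \<and> real n \<le> exp (real m / real (Suc j))}. close_return m n)"

lemma fast_return_set_iff:
  "x \<in> fast_return_set \<longleftrightarrow> (\<forall>j m0. \<exists>m\<ge>m0. \<exists>n\<ge>1. real n \<le> exp (real m / real (Suc j)) \<and> x \<in> close_return m n)"
  by (simp only: fast_return_set_def INT_iff UN_iff ball_UNIV Bex_def mem_Collect_eq atLeast_iff conj_assoc)

lemma fast_return_set_sets: "fast_return_set \<in> sets M"
proof -
  have "(\<Union>m\<in>{m0..}. \<Union>n\<in>{n. 1 \<le> n \<and> real n \<le> exp (real m / real (Suc j))}. close_return m n) \<in> sets M" for j m0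
    by (intro sets.countable_UN image_subsetI close_return_sets)
  then show ?thesis
    unfolding fast_return_set_def by (intro sets.countable_INT image_subsetI) simp_all
qed

text \<open>Same margin as for the singularities: a starting distance of order
  \<open>exp (- ((l + 1) * n))\<close> keeps the orbits within a multiple of
  \<open>exp (- j)\<close> at time \<open>j\<close>, while the orbit of \<open>x\<close> keeps
  \<open>g + t\<close> at least that far from the jumps.\<close>

lemma AE_label_tracking:
  assumes pl: "piecewise_lipschitz_wrt M f \<A> L" and avg: "avg_lipschitz_exponent M \<A> L < \<infinity>"
    and g: "C-lipschitz_on UNIV g" "\<And>x. 0 \<le> g x" "\<And>x. g x \<le> real k - 1"
    and t: "0 < t" "t < 1" "summable (\<lambda>n::nat. prob (near_integer g k t (exp (- real n))))"
  shows "AE x in M. \<exists>c>0. \<exists>\<kappa>>0. \<forall>n y. dist y x < c * exp (- (\<kappa> * real n)) \<longrightarrow>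
      (\<forall>j<n. nat \<lfloor>g ((f ^^ j) y) + t\<rfloor> = nat \<lfloor>g ((f ^^ j) x) + t\<rfloor>)"
proof -
  have C0: "0 \<le> C" by (rule lipschitz_on_nonneg[OF g(1)])
  have gm: "g \<in> borel_measurable M" by (rule lipschitz_meas[OF g(1)])
  have mono: "near_integer g k t \<epsilon> \<subseteq> near_integer g k t \<epsilon>'" if "\<epsilon> \<le> \<epsilon>'" for \<epsilon> \<epsilon>'
    using that unfolding near_integer_def by force
  have "AE x in M. \<exists>c>0. \<forall>j. (f ^^ j) x \<notin> near_integer g k t (c * exp (- real j))"
    by (rule AE_iter_avoids[where B="near_integer g k t"]) (use mono near_integer_sets[OF gm] t(3) in auto)
  then show ?thesis
    using AE_orbit_expansion[OF pl avg]
  proof eventually_elim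
    case (elim x)
    then obtain c1 l c2 where c1: "c1 > 0" and l: "l > 0"
      and ex: "\<And>n y j. dist y x < c1 * exp (- (l * real n)) \<Longrightarrow> j \<le> n \<Longrightarrow>
         dist ((f ^^ j) y) ((f ^^ j) x) \<le> exp (l * real j) * dist y x"
      and c2: "c2 > 0" and av: "\<And>j. (f ^^ j) x \<notin> near_integer g k t (c2 * exp (- real j))" by blast
    \<comment> \<open>The denominator \<open>C + 1\<close> replaces the Lipschitz constant
      \<open>C\<close>, which may be 0.\<close>
    define c where "c = min c1 (c2 / (C + 1))"
    have c: "c > 0" "c \<le> c1" "C * c \<le> c2"
    proof -
      show "c > 0" using c1 c2 C0 by (simp add: c_def)
      show "c \<le> c1" by (simp add: c_def)
      have "C * c \<le> C * (c2 / (C + 1))" using C0 by (intro mult_left_mono) (auto simp: c_def)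
      also have "\<dots> \<le> c2" using C0 c2 by (simp add: field_simps)
      finally show "C * c \<le> c2" .
    qed
    have "nat \<lfloor>g ((f ^^ j) y) + t\<rfloor> = nat \<lfloor>g ((f ^^ j) x) + t\<rfloor>"
      if d: "dist y x < c * exp (- ((l + 1) * real n))" and j: "j < n" for n y j
    proof -
      have "c * exp (- ((l + 1) * real n)) \<le> c1 * exp (- (l * real n))"
        by (intro mult_mono) (use c c1 in \<open>auto simp: algebra_simps\<close>)
      then have "dist ((f ^^ j) y) ((f ^^ j) x) \<le> exp (l * real j) * dist y x"
        using ex[of y n j] d j by simp
      also have "\<dots> \<le> exp (l * real j) * (c * exp (- ((l + 1) * real j)))"
      proof (intro mult_left_mono)
        have "c * exp (- ((l + 1) * real n)) \<le> c * exp (- ((l + 1) * real j))"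
          using c(1) l j by (intro mult_left_mono) auto
        then show "dist y x \<le> c * exp (- ((l + 1) * real j))" using d by linarith
      qed simp
      also have "\<dots> = c * exp (- real j)" by (simp add: exp_add[symmetric] algebra_simps)
      finally have "C * dist ((f ^^ j) y) ((f ^^ j) x) \<le> C * (c * exp (- real j))"
        by (intro mult_left_mono C0)
      also have "\<dots> \<le> c2 * exp (- real j)" using c(3) by (simp add: mult.assoc[symmetric])
      finally have "\<bar>g ((f ^^ j) x) - g ((f ^^ j) y)\<bar> \<le> c2 * exp (- real j)"
        using lipschitz_onD[OF g(1), of "(f ^^ j) x" "(f ^^ j) y"] by (simp add: dist_real_def dist_commute)
      then have "nat \<lfloor>g ((f ^^ j) x) + t\<rfloor> = nat \<lfloor>g ((f ^^ j) y) + t\<rfloor>"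
        by (rule floor_eq_of_far_from_integers[where k=k])
           (use av[of j] g t in \<open>auto simp: near_integer_def not_le\<close>)
      then show ?thesis by simp
    qed
    moreover have "l + 1 > 0" using l by simp
    ultimately show ?case using c(1) by blast
  qed
qed

text \<open>A return within \<open>exp (- m)\<close> is tracked by the labels for \<open>n\<close>
  close to \<open>(m + ln c) / \<kappa>\<close> steps. So \<open>n\<close> is proportional to
  \<open>m\<close>, and a return time that is subexponential in \<open>m\<close> is subexponential
  in \<open>n\<close>.\<close>

lemma repetitive_of_fast_returns:
  assumes track: "AE x in M. \<exists>c>0. \<exists>\<kappa>>0. \<forall>n y. dist y x < c * exp (- (\<kappa> * real n)) \<longrightarrow>
      (\<forall>j<n. Q ((f ^^ j) y) = Q ((f ^^ j) x))"
    and fast: "AE x in M. x \<in> fast_return_set"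
  shows "repetitive Q"
  unfolding repetitive_def using track fast
proof eventually_elim
  case (elim x)
  then obtain c \<kappa> where c: "c > 0" "\<kappa> > 0"
    and tr: "\<And>n y j. dist y x < c * exp (- (\<kappa> * real n)) \<Longrightarrow> j < n \<Longrightarrow> Q ((f ^^ j) y) = Q ((f ^^ j) x)" by blast
  show ?case
  proof (intro allI impI)
    fix \<delta> :: real and n0 :: nat assume \<delta>: "\<delta> > 0"
    obtain j :: nat where "2 * \<kappa> / \<delta> \<le> real j" using real_arch_simple by blast
    then have j: "2 * \<kappa> / \<delta> \<le> real (Suc j)" by simp
    \<comment> \<open>The first term gives \<open>m / (2 * \<kappa>) \<le> u - 1\<close>, which
      absorbs \<open>ln c\<close> and the rounding of \<open>u\<close> into the factor 2 in the
      choice of \<open>j\<close>; the second gives \<open>n \<ge> n0\<close>.\<close>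
    define m0 where "m0 = nat \<lceil>max (2 * \<kappa> - 2 * ln c) (\<kappa> * (real n0 + 1) - ln c)\<rceil>"
    obtain m \<tau> where m: "m \<ge> m0" "1 \<le> \<tau>" "real \<tau> \<le> exp (real m / real (Suc j))" "x \<in> close_return m \<tau>"
      using elim(2) unfolding fast_return_set_iff by blast
    have "max (2 * \<kappa> - 2 * ln c) (\<kappa> * (real n0 + 1) - ln c) \<le> real m0"
      unfolding m0_def by (rule real_nat_ceiling_ge)
    then have mm: "2 * \<kappa> - 2 * ln c \<le> real m" "\<kappa> * (real n0 + 1) - ln c \<le> real m" using m(1) by linarith+
    define u where "u = (real m + ln c) / \<kappa>"
    have u: "real n0 + 1 \<le> u" unfolding u_def using mm(2) c(2) by (simp add: field_simps)
    define n where "n = nat \<lfloor>u\<rfloor>"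
    have n: "real n \<le> u" "u < real n + 1" using nat_floor_bounds[of u] u by (auto simp: n_def)
    have "n \<ge> n0" using u n by linarith
    moreover have "real \<tau> \<le> exp (\<delta> * real n)"
    proof -
      have "2 * \<kappa> \<le> real (Suc j) * \<delta>" using j \<delta> by (simp add: field_simps)
      then have "real m * (2 * \<kappa>) \<le> real m * (real (Suc j) * \<delta>)" by (intro mult_left_mono) auto
      then have "real m / real (Suc j) \<le> \<delta> * (real m / (2 * \<kappa>))" using c(2) by (simp add: field_simps)
      also have "\<dots> \<le> \<delta> * (u - 1)"
      proof (intro mult_left_mono)
        have "real m \<le> 2 * (real m + ln c - \<kappa>)" using mm(1) by (simp add: algebra_simps)
        then have "real m / (2 * \<kappa>) \<le> (2 * (real m + ln c - \<kappa>)) / (2 * \<kappa>)" using c(2) by (intro divide_right_mono) auto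
        also have "\<dots> = u - 1" unfolding u_def using c(2) by (simp add: field_simps)
        finally show "real m / (2 * \<kappa>) \<le> u - 1" .
      qed (use \<delta> in simp)
      also have "\<dots> \<le> \<delta> * real n" using \<delta> n by (intro mult_left_mono) auto
      finally show ?thesis using m(3) by (meson exp_le_cancel_iff order_trans)
    qed
    moreover have "\<forall>i<n. Q ((f ^^ i) x) = Q ((f ^^ (i + \<tau>)) x)"
    proof (intro allI impI)
      fix i assume i: "i < n"
      have "dist ((f ^^ \<tau>) x) x < exp (- real m)" using m(4) by (simp add: close_return_def)
      also have "\<dots> \<le> c * exp (- (\<kappa> * real n))"
      proof -
        have "\<kappa> * real n \<le> \<kappa> * u" using n c(2) by (intro mult_left_mono) auto
        also have "\<dots> = real m + ln c" unfolding u_def using c(2) by simp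
        finally have "exp (- real m) \<le> exp (ln c - \<kappa> * real n)" by simp
        also have "\<dots> = c * exp (- (\<kappa> * real n))" using c(1) by (simp add: exp_diff exp_minus field_simps)
        finally show ?thesis .
      qed
      finally have "Q ((f ^^ i) ((f ^^ \<tau>) x)) = Q ((f ^^ i) x)" using tr i by blast
      then show "Q ((f ^^ i) x) = Q ((f ^^ (i + \<tau>)) x)" by (simp add: funpow_add)
    qed
    ultimately show "\<exists>n\<ge>n0. \<exists>\<tau>\<ge>1. real \<tau> \<le> exp (\<delta> * real n) \<and> (\<forall>j<n. Q ((f ^^ j) x) = Q ((f ^^ (j + \<tau>)) x))"
      using m(2) by blast
  qed
qed

lemma entropy_zero_of_fast_returns:
  assumes pl: "piecewise_lipschitz_wrt M f \<A> L" and avg: "avg_lipschitz_exponent M \<A> L < \<infinity>"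
    and fast: "AE x in M. x \<in> fast_return_set"
  shows "metric_entropy M f \<le> 0"
  unfolding metric_entropy_def
proof (rule SUP_least)
  fix P :: "'a \<Rightarrow> nat" assume "P \<in> {P. simple_function M P}"
  then have sf: "simple_function M P" by simp
  have P: "P \<in> measurable M (count_space UNIV)" using measurable_simple_function[OF sf] .
  have "finite (range P)" using simple_functionD(1)[OF sf] by simp
  then obtain k where "\<forall>i\<in>range P. i < k" using finite_nat_set_iff_bounded by blast
  then have k: "range P \<subseteq> {..<k}" "k \<ge> 1" by auto
  have "\<exists>Q. Q \<in> measurable M (count_space UNIV) \<and> range Q \<subseteq> {..<k} \<and>
      prob {x. P x \<noteq> Q x} \<le> \<epsilon> \<and> repetitive Q" if eps: "\<epsilon> > 0" for \<epsilon>
  proof -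
    obtain g C where g: "C-lipschitz_on UNIV g" "\<And>x. 0 \<le> g x" "\<And>x. g x \<le> real k - 1"
      "{x. g x \<noteq> real (P x)} \<in> sets M" "prob {x. g x \<noteq> real (P x)} \<le> \<epsilon>"
      by (rule lipschitz_label_approximation[OF P k eps]) blast
    have gm: "g \<in> borel_measurable M" by (rule lipschitz_meas[OF g(1)])
    obtain t where t: "0 < t" "t < 1" "summable (\<lambda>n::nat. prob (near_integer g k t (exp (- real n))))"
      by (rule good_translation[OF gm])
    define Q where "Q x = nat \<lfloor>g x + t\<rfloor>" for x
    have "Q \<in> measurable M (count_space UNIV)" unfolding Q_def using gm by measurable
    moreover have "range Q \<subseteq> {..<k}"
    proof clarsimp
      fix x
      have "g x + t < real k" "0 \<le> g x + t" using g(2,3)[of x] t by linarith+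
      then show "Q x < k" unfolding Q_def using k(2) by (simp add: nat_less_iff floor_less_iff)
    qed
    moreover have "prob {x. P x \<noteq> Q x} \<le> \<epsilon>"
    proof -
      have "{x. P x \<noteq> Q x} \<subseteq> {x. g x \<noteq> real (P x)}"
      proof clarify
        fix x assume "P x \<noteq> Q x" "g x = real (P x)"
        moreover have "\<lfloor>real (P x) + t\<rfloor> = int (P x)" using t by linarith
        ultimately show False by (simp add: Q_def)
      qed
      then have "prob {x. P x \<noteq> Q x} \<le> prob {x. g x \<noteq> real (P x)}"
        by (rule finite_measure_mono[OF _ g(4)])
      then show ?thesis using g(5) by linarith
    qed
    moreover have "repetitive Q"
      by (rule repetitive_of_fast_returns[OF _ fast])
         (use AE_label_tracking[OF pl avg g(1-3) t] in \<open>simp add: Q_def\<close>)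
    ultimately show ?thesis by blast
  qed
  then have "entropy_wrt_partition M f P = 0"
    by (rule entropy_zero_of_repetitive[OF P k])
  then show "ereal (entropy_wrt_partition M f P) \<le> 0" by simp
qed

text \<open>Applying \<open>f\<close> to a return inside one piece multiplies its distance by at
  most \<open>exp q1\<close>, so scale \<open>m\<close> becomes scale \<open>m - q1\<close>. The
  exponent loses at most a factor 2 once \<open>m \<ge> 2 * q1\<close>, hence the index
  \<open>2 * j + 1\<close>; \<open>q2\<close> ensures that the returning point lies in the same
  piece.\<close>

lemma AE_fast_return_set_forward:
  assumes pl: "piecewise_lipschitz_wrt M f \<A> L"
  shows "AE x in M. x \<in> fast_return_set \<longrightarrow> f x \<in> fast_return_set"
proof -
  have "AE x in M. x \<in> \<Union>\<A>" using pl by (simp add: piecewise_lipschitz_wrt_def open_partition_mod_def)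
  then show ?thesis
  proof eventually_elim
    case (elim x)
    then obtain A where A: "A \<in> \<A>" "x \<in> A" by blast
    have lip: "(L A)-lipschitz_on A f" using pl A by (simp add: piecewise_lipschitz_wrt_def)
    have "open A" using pl A by (simp add: piecewise_lipschitz_wrt_def open_partition_mod_def)
    then obtain e where e: "e > 0" "ball x e \<subseteq> A" using A(2) open_contains_ball by blast
    obtain q1 :: nat where "L A < real q1" using reals_Archimedean2 by blast
    then have q1: "L A < exp (real q1)" using exp_ge_add_one_self[of "real q1"] by linarith
    obtain q2 :: nat where "- ln e \<le> real q2" using real_arch_simple by blast
    then have q2: "exp (- real q2) \<le> e" using e(1) by (metis exp_le_cancel_iff exp_ln minus_le_iff)
    show ?case
    proof
      assume x: "x \<in> fast_return_set"
      show "f x \<in> fast_return_set"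
        unfolding fast_return_set_iff
      proof (intro allI)
        fix j m0
        obtain m n where m: "m \<ge> m0 + 2 * q1 + q2" "n \<ge> 1" "real n \<le> exp (real m / real (Suc (2 * j + 1)))" "x \<in> close_return m n"
          using x unfolding fast_return_set_iff by blast
        have d: "dist ((f ^^ n) x) x < exp (- real m)" using m(4) by (simp add: close_return_def)
        also have "\<dots> \<le> exp (- real q2)" using m(1) by simp
        finally have "(f ^^ n) x \<in> A" using q2 e(2) by (auto simp: dist_commute)
        then have "dist (f ((f ^^ n) x)) (f x) \<le> L A * dist ((f ^^ n) x) x"
          using lipschitz_onD[OF lip _ A(2)] by simp
        also have "\<dots> \<le> L A * exp (- real m)"
          using d lipschitz_on_nonneg[OF lip] by (intro mult_left_mono) auto
        also have "\<dots> < exp (real q1) * exp (- real m)" using q1 by (intro mult_strict_right_mono) auto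
        also have "\<dots> = exp (- real (m - q1))" using m(1) by (simp add: exp_add[symmetric] of_nat_diff)
        finally have "f x \<in> close_return (m - q1) n" by (simp add: close_return_def funpow_swap1)
        moreover have "m - q1 \<ge> m0" using m(1) by simp
        moreover have "real n \<le> exp (real (m - q1) / real (Suc j))"
        proof -
          have "real m / 2 \<le> real (m - q1)" using m(1) by (simp add: of_nat_diff)
          then have "real m / 2 / real (Suc j) \<le> real (m - q1) / real (Suc j)" by (rule divide_right_mono) simp
          moreover have "real (Suc (2 * j + 1)) = 2 * real (Suc j)" by simp
          ultimately have "real m / real (Suc (2 * j + 1)) \<le> real (m - q1) / real (Suc j)"
            by (metis divide_divide_eq_left)
          then show ?thesis using m(3) by (meson exp_le_cancel_iff order_trans)
        qed
        ultimately show "\<exists>m\<ge>m0. \<exists>n\<ge>1. real n \<le> exp (real m / real (Suc j)) \<and> f x \<in> close_return m n"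
          using m(2) by blast
      qed
    qed
  qed
qed

lemma AE_not_fast_return:
  assumes pl: "piecewise_lipschitz_wrt M f \<A> L" and avg: "avg_lipschitz_exponent M \<A> L < \<infinity>"
    and ld: "local_decay \<V> \<theta>" and ent: "metric_entropy M f > 0"
  shows "AE x in M. x \<notin> fast_return_set"
proof -
  note Z = fast_return_set_sets
  have "prob fast_return_set = 0"
  proof (rule ccontr)
    assume "prob fast_return_set \<noteq> 0"
    then have "prob fast_return_set > 0" by (simp add: measure_nonneg order_le_neq_trans)
    then have "prob fast_return_set = 1"
      by (rule invariant_set_0_1[OF ld Z AE_fast_return_set_forward[OF pl]])
    then have "AE x in M. x \<in> fast_return_set" using AE_prob_1 by blast
    then show False using entropy_zero_of_fast_returns[OF pl avg] ent by simp
  qed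
  then have "fast_return_set \<in> null_sets M" using Z by (auto simp: null_sets_def emeasure_eq_measure)
  then show ?thesis by (rule AE_not_in)
qed

end

subsection \<open>Recurrence rates and dimensions\<close>

lemma eventually_at_right_0_scale:
  assumes "eventually P (at_right (0::real))" "\<kappa> > 0"
  shows "eventually (\<lambda>r. P (\<kappa> * r)) (at_right 0)"
proof -
  obtain b where b: "b > 0" "\<And>y. y > 0 \<Longrightarrow> y < b \<Longrightarrow> P y"
    using assms(1) unfolding eventually_at_right_field by auto
  show ?thesis
  proof (rule eventually_at_rightI[of 0 "b / \<kappa>"])
    fix r assume "r \<in> {0<..<b / \<kappa>}"
    then show "P (\<kappa> * r)" using b(2)[of "\<kappa> * r"] assms(2) by (simp add: field_simps)
  qed (use b assms in simp)
qed

lemma eventually_powr_less: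
  fixes c \<epsilon> :: real
  assumes "c > 0" "\<epsilon> > 0"
  shows "eventually (\<lambda>r. r powr \<epsilon> < c) (at_right 0)"
proof (rule eventually_at_rightI[of 0 "c powr (1 / \<epsilon>)"])
  fix r assume r: "r \<in> {0<..<c powr (1 / \<epsilon>)}"
  then have "r powr \<epsilon> < (c powr (1 / \<epsilon>)) powr \<epsilon>" using assms by (intro powr_less_mono2) auto
  also have "\<dots> = c" using assms by (simp add: powr_powr)
  finally show "r powr \<epsilon> < c" .
qed (use assms in simp)

lemma ereal_nonneg_of_neg_less:
  assumes "\<And>y. y < 0 \<Longrightarrow> ereal y < X" shows "0 \<le> X"
proof (rule ccontr)
  assume "\<not> 0 \<le> X"
  then have "X < 0" by simp
  then obtain y where "X < ereal y" "ereal y < 0" using ereal_dense2 by blast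
  then show False using assms[of y] by simp
qed

text \<open>Rescaling the radius by \<open>\<kappa>\<close> does not affect limits at 0, and since
  \<open>G\<close> is eventually nonnegative only thresholds \<open>y \<ge> 0\<close> have to be
  transferred. An arbitrarily small gap between \<open>y\<close> and \<open>y'\<close> leaves room
  to absorb constants.\<close>

lemma Liminf_Limsup_le_of_thresholds:
  fixes F G :: "real \<Rightarrow> ereal"
  assumes \<kappa>: "\<kappa> > 0"
    and thr: "\<And>y y'. 0 \<le> y \<Longrightarrow> y < y' \<Longrightarrow>
      eventually (\<lambda>r. ereal y' < F r \<longrightarrow> ereal y < G (\<kappa> * r)) (at_right 0)"
    and G0: "eventually (\<lambda>r. 0 \<le> G r) (at_right 0)"
  shows "Liminf (at_right 0) F \<le> Liminf (at_right 0) G" "Limsup (at_right 0) F \<le> Limsup (at_right 0) G"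
proof -
  have scale: "eventually (\<lambda>r. P (\<kappa> * r)) (at_right 0) \<Longrightarrow> eventually P (at_right (0::real))" for P
    using eventually_at_right_0_scale[of "\<lambda>r. P (\<kappa> * r)" "1 / \<kappa>"] \<kappa> by simp
  have Li0: "0 \<le> Liminf (at_right 0) G" by (rule Liminf_bounded[OF G0])
  then have Ls0: "0 \<le> Limsup (at_right 0) G"
    using Liminf_le_Limsup[of "at_right (0::real)" G] by (simp add: order_trans)
  show "Liminf (at_right 0) F \<le> Liminf (at_right 0) G"
  proof (rule ccontr)
    assume "\<not> ?thesis"
    then have "Liminf (at_right 0) G < Liminf (at_right 0) F" by simp
    then obtain y where y: "Liminf (at_right 0) G < ereal y" "ereal y < Liminf (at_right 0) F"
      using ereal_dense2 by blast
    then obtain y' where y': "ereal y < ereal y'" "ereal y' < Liminf (at_right 0) F"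
      using ereal_dense2 by blast
    have "ereal 0 < ereal y" using Li0 y(1) by (metis le_less_trans zero_ereal_def)
    then have yy: "0 \<le> y" "y < y'" using y' by auto
    have "eventually (\<lambda>r. ereal y' < F r) (at_right 0)" using y'(2) by (rule less_LiminfD)
    then have "eventually (\<lambda>r. ereal y < G (\<kappa> * r)) (at_right 0)"
      using thr[OF yy] by eventually_elim simp
    then have "eventually (\<lambda>r. ereal y < G r) (at_right 0)" by (rule scale)
    then have "eventually (\<lambda>r. ereal y \<le> G r) (at_right 0)" by eventually_elim simp
    then have "ereal y \<le> Liminf (at_right 0) G" by (rule Liminf_bounded)
    then show False using y(1) by simp
  qed
  show "Limsup (at_right 0) F \<le> Limsup (at_right 0) G"
  proof (rule ccontr)
    assume "\<not> ?thesis"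
    then have "Limsup (at_right 0) G < Limsup (at_right 0) F" by simp
    then obtain y where y: "Limsup (at_right 0) G < ereal y" "ereal y < Limsup (at_right 0) F"
      using ereal_dense2 by blast
    then obtain y' where y': "ereal y < ereal y'" "ereal y' < Limsup (at_right 0) F"
      using ereal_dense2 by blast
    have "ereal 0 < ereal y" using Ls0 y(1) by (metis le_less_trans zero_ereal_def)
    then have yy: "0 \<le> y" "y < y'" using y' by auto
    have "eventually (\<lambda>r. G r < ereal y) (at_right 0)" using y(1) by (rule Limsup_lessD)
    then have "eventually (\<lambda>r. G (\<kappa> * r) < ereal y) (at_right 0)"
      by (rule eventually_at_right_0_scale[OF _ \<kappa>])
    then have "eventually (\<lambda>r. F r \<le> ereal y') (at_right 0)"
      using thr[OF yy] by eventually_elim (meson less_asym not_le)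
    then have "Limsup (at_right 0) F \<le> ereal y'" by (rule Limsup_bounded)
    then show False using y'(2) by simp
  qed
qed

lemma return_time_cases:
  obtains "return_time f r x = \<infinity>" "\<And>n. n \<ge> 1 \<Longrightarrow> \<not> dist ((f ^^ n) x) x < r"
  | n where "n \<ge> 1" "dist ((f ^^ n) x) x < r" "return_time f r x = of_nat n"
      "\<And>k. k \<ge> 1 \<Longrightarrow> dist ((f ^^ k) x) x < r \<Longrightarrow> n \<le> k"
proof -
  let ?R = "{n::nat. 1 \<le> n \<and> dist ((f ^^ n) x) x < r}"
  show thesis
  proof (cases "?R = {}")
    case True
    then have "return_time f r x = \<infinity>" unfolding return_time_def by simp
    then show thesis using that(1) True by blast
  next
    case False
    define n where "n = (LEAST n. n \<in> ?R)"
    have n: "n \<in> ?R" unfolding n_def by (rule LeastI_ex[of "\<lambda>n. n \<in> ?R"]) (use False in blast)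
    have le: "n \<le> k" if "k \<in> ?R" for k unfolding n_def using that by (rule Least_le)
    have "return_time f r x = of_nat n"
      unfolding return_time_def
      by (rule antisym[OF INF_lower[OF n] INF_greatest]) (use le in auto)
    then show thesis using that(2)[of n] n le by blast
  qed
qed

text \<open>Clears the logarithms. A point without returns fits in: its quotient is infinite and the
  right side holds vacuously.\<close>

lemma less_recurrence_quotient_iff:
  assumes r: "0 < r" "r < 1"
  shows "ereal y < eln (return_time f r x) / ereal (ln (1 / r)) \<longleftrightarrow>
    (\<forall>n\<ge>1. dist ((f ^^ n) x) x < r \<longrightarrow> r powr - y < real n)"
proof -
  have l: "ln (1 / r) > 0" using r by simp
  show ?thesis
  proof (cases rule: return_time_cases[of f r x])
    case 1
    then have "eln (return_time f r x) / ereal (ln (1 / r)) = \<infinity>"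
      using l by (simp add: eln_def)
    then show ?thesis using 1(2) by auto
  next
    case (2 n)
    have "eln (return_time f r x) = ereal (ln (real n))"
      using 2(1,3) by (simp add: eln_def ennreal_of_nat_eq_real_of_nat)
    then have "ereal y < eln (return_time f r x) / ereal (ln (1 / r)) \<longleftrightarrow> y < ln (real n) / ln (1 / r)"
      using l by simp
    also have "\<dots> \<longleftrightarrow> y * ln (1 / r) < ln (real n)" using l by (simp add: pos_less_divide_eq)
    also have "\<dots> \<longleftrightarrow> exp (y * ln (1 / r)) < real n"
      using 2(1) by (metis exp_less_cancel_iff exp_ln of_nat_0_less_iff less_le_trans zero_less_one)
    also have "exp (y * ln (1 / r)) = r powr - y" using r by (simp add: powr_def ln_div)
    finally show ?thesis using 2 by (meson less_le_trans of_nat_le_iff)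
  qed
qed

context measure_preserving begin

text \<open>The counterpart for masses. For a ball of mass 0 the quotient is minus infinity over a
  negative number, thus infinite, in agreement with \<open>0 < r powr y\<close>.\<close>

lemma less_dimension_quotient_iff:
  assumes r: "0 < r" "r < 1"
  shows "ereal y < eln (emeasure M (ball x r)) / ereal (ln r) \<longleftrightarrow> prob (ball x r) < r powr y"
proof (cases "prob (ball x r) = 0")
  case True
  then have "emeasure M (ball x r) = 0" by (simp add: emeasure_eq_measure)
  then show ?thesis using r True by (simp add: eln_def)
next
  case False
  then have pos: "prob (ball x r) > 0" by (simp add: measure_nonneg order_le_neq_trans)
  have l: "ln r < 0" using r by simp
  have "eln (emeasure M (ball x r)) = ereal (ln (prob (ball x r)))"
    using pos by (simp add: eln_def emeasure_eq_measure)
  then have "ereal y < eln (emeasure M (ball x r)) / ereal (ln r) \<longleftrightarrow> y < ln (prob (ball x r)) / ln r"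
    using l by simp
  also have "\<dots> \<longleftrightarrow> ln (prob (ball x r)) < y * ln r" using l by (simp add: neg_less_divide_eq)
  also have "\<dots> \<longleftrightarrow> prob (ball x r) < exp (y * ln r)"
    using pos by (metis exp_less_cancel_iff exp_ln)
  also have "exp (y * ln r) = r powr y" using r by (simp add: powr_def)
  finally show ?thesis .
qed

text \<open>A point outside \<open>fast_return_set\<close> has its own exponent
  \<open>1 / Suc j\<close> below which no return is close; the window estimate with this exponent
  takes over from there. All parameters of the window range over countable sets, so one null set
  serves them all. \<open>C\<close> is \<open>K + 1\<close> for the \<open>K\<close> of the window:
  the block lies in the ball of radius \<open>(K + 1) * exp (- m)\<close>.\<close>

lemma AE_return_lower:
  fixes C :: real
  defines "C \<equiv> 4 * DIM('a) + 2"
  assumes ld: "local_decay \<V> \<theta>" and slow: "AE y in M. y \<notin> fast_return_set"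
  shows "AE y in M. \<forall>\<epsilon>>0. eventually (\<lambda>m. \<forall>n\<ge>1.
     real n * prob (ball y (C * exp (- real m))) \<le> exp (- (\<epsilon> * real m)) \<longrightarrow> y \<notin> close_return m n) sequentially"
proof -
  have op: "open_partition_mod M \<V>" using ld by (simp add: local_decay_def)
  have cnt: "countable \<V>" by (rule open_partition_countable[OF op])
  define K where "K = 4 * DIM('a) + 1"
  define Win where "Win y m \<epsilon> n \<longleftrightarrow>
     (real n * prob (grid_nbhd m K (grid m y)) \<le> exp (- (\<epsilon> * real m))
     \<longrightarrow> y \<notin> close_return m n)" for y :: 'a and m n :: nat and \<epsilon> :: real
  have "AE y in M. \<forall>V\<in>\<V>. \<forall>j i l r::nat. norm y \<le> real (Suc r) \<and> ball y (1 / real (Suc l)) \<subseteq> V \<longrightarrow>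
     eventually (\<lambda>m. \<forall>n. exp (1 / real (Suc j) * real m) \<le> real n \<longrightarrow> Win y m (1 / real (Suc i)) n) sequentially"
    unfolding AE_ball_countable[OF cnt] AE_all_countable
  proof (intro ballI allI)
    fix V and j i l r :: nat assume "V \<in> \<V>"
    then have "superpoly_null (\<theta> V)" "decay_on M f (\<theta> V) V" using ld by (auto simp: local_decay_def)
    then show "AE y in M. norm y \<le> real (Suc r) \<and> ball y (1 / real (Suc l)) \<subseteq> V \<longrightarrow>
     eventually (\<lambda>m. \<forall>n. exp (1 / real (Suc j) * real m) \<le> real n \<longrightarrow> Win y m (1 / real (Suc i)) n) sequentially"
      unfolding Win_def K_def by (intro AE_no_return_window) auto
  qed
  moreover have "AE y in M. y \<in> \<Union>\<V>" using op by (simp add: open_partition_mod_def)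
  ultimately show ?thesis using slow
  proof eventually_elim
    case (elim y)
    obtain V where V: "V \<in> \<V>" "y \<in> V" using elim by blast
    have "open V" using op V by (simp add: open_partition_mod_def)
    then obtain e where e: "e > 0" "ball y e \<subseteq> V" using V(2) open_contains_ball by blast
    obtain l :: nat where l: "1 / real (Suc l) < e" using reals_Archimedean[OF e(1)] by (auto simp: inverse_eq_divide)
    have inV: "ball y (1 / real (Suc l)) \<subseteq> V" using e(2) l by (meson ball_subset_ball_iff less_imp_le order_trans subset_ball)
    obtain r :: nat where "norm y \<le> real r" using real_arch_simple by blast
    then have r: "norm y \<le> real (Suc r)" by simp
    obtain j m0 where slow: "\<And>m n. m \<ge> m0 \<Longrightarrow> n \<ge> 1 \<Longrightarrow> real n \<le> exp (real m / real (Suc j)) \<Longrightarrow> y \<notin> close_return m n"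
      using elim(3) unfolding fast_return_set_iff by blast
    show ?case
    proof (intro allI impI)
      fix \<epsilon> :: real assume "\<epsilon> > 0"
      then obtain i :: nat where i: "1 / real (Suc i) < \<epsilon>" using reals_Archimedean[of \<epsilon>] by (auto simp: inverse_eq_divide)
      have "eventually (\<lambda>m. \<forall>n. exp (1 / real (Suc j) * real m) \<le> real n \<longrightarrow> Win y m (1 / real (Suc i)) n) sequentially"
        using elim(1) V(1) r inV by blast
      then show "eventually (\<lambda>m. \<forall>n\<ge>1.
        real n * prob (ball y (C * exp (- real m))) \<le> exp (- (\<epsilon> * real m)) \<longrightarrow> y \<notin> close_return m n) sequentially"
        using eventually_ge_at_top[of m0]
      proof eventually_elim
        case (elim m)
        show ?case
        proof (intro allI impI)
          fix n :: nat assume n: "n \<ge> 1"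
            "real n * prob (ball y (C * exp (- real m))) \<le> exp (- (\<epsilon> * real m))"
          show "y \<notin> close_return m n"
          proof (cases "exp (1 / real (Suc j) * real m) \<le> real n")
            case True
            have "DIM('a) * ((real K + 1) * cell_scale TYPE('a) m) = (real K + 1) * (DIM('a) * cell_scale TYPE('a) m)"
              by (simp only: mult.left_commute)
            also have "\<dots> = C * exp (- real m)" unfolding DIM_cell_scale by (simp add: C_def K_def)
            finally have "grid_nbhd m K (grid m y) \<subseteq> ball y (C * exp (- real m))"
              using nbhd_subset_ball[OF cell_scale_pos[where 'a='a and m=m], of K y] by simp
            then have "prob (grid_nbhd m K (grid m y)) \<le> prob (ball y (C * exp (- real m)))"
              by (rule finite_measure_mono[OF _ ball_sets])
            then have "real n * prob (grid_nbhd m K (grid m y))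
                \<le> real n * prob (ball y (C * exp (- real m)))" by (intro mult_left_mono) auto
            also have "\<dots> \<le> exp (- (\<epsilon> * real m))" by (rule n(2))
            also have "\<dots> \<le> exp (- (1 / real (Suc i) * real m))"
              using i by (intro iffD2[OF exp_le_cancel_iff] le_imp_neg_le mult_right_mono) auto
            finally show ?thesis using elim(1) True unfolding Win_def by blast
          next
            case False
            then have "real n \<le> exp (real m / real (Suc j))" by simp
            then show ?thesis using slow elim(2) n(1) by blast
          qed
        qed
      qed
    qed
  qed
qed

section \<open>From the scales \<open>exp (- m)\<close> to all radii\<close>

lemma rates_le_dims:
  assumes up: "\<And>\<epsilon>. \<epsilon> > 0 \<Longrightarrow> eventually (\<lambda>m. \<exists>n\<ge>1. real n * prob (ball x (cell_scale TYPE('a) m)) \<le> exp (\<epsilon> * real m)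
           \<and> dist ((f ^^ n) x) x < exp (- real m)) sequentially"
  shows "lower_recurrence_rate f x \<le> lower_pointwise_dim M x" "upper_recurrence_rate f x \<le> upper_pointwise_dim M x"
proof -
  \<comment> \<open>For the integer \<open>m\<close> with
    \<open>exp (- m) \<le> r \<le> exp (1 - m)\<close>, the radius \<open>\<kappa> * r\<close> is at
    most \<open>exp (- m) / DIM('a)\<close>, that of the ball in the hypothesis
    \<open>up\<close>.\<close>
  define \<kappa> where "\<kappa> = 1 / (exp 1 * DIM('a))"
  have \<kappa>: "0 < \<kappa>" "\<kappa> \<le> 1"
  proof -
    show "0 < \<kappa>" by (simp add: \<kappa>_def)
    have "1 * 1 \<le> exp 1 * real DIM('a)" by (intro mult_mono) (auto simp: Suc_leI)
    then show "\<kappa> \<le> 1" by (simp add: \<kappa>_def divide_le_eq)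
  qed
  let ?F = "\<lambda>r::real. eln (return_time f r x) / ereal (ln (1 / r))"
  let ?G = "\<lambda>r::real. eln (emeasure M (ball x r)) / ereal (ln r)"
  have thr: "eventually (\<lambda>r. ereal y' < ?F r \<longrightarrow> ereal y < ?G (\<kappa> * r)) (at_right 0)"
    if y: "0 \<le> y" "y < y'" for y y' :: real
  proof -
    \<comment> \<open>Of the gap \<open>2 * \<epsilon>\<close>, one part pays for the factor
      \<open>exp (\<epsilon> * m)\<close>, the other beats the constants
      \<open>exp \<epsilon>\<close> and \<open>\<kappa> powr y\<close> for small
      \<open>r\<close>.\<close>
    define \<epsilon> where "\<epsilon> = (y' - y) / 2"
    have \<epsilon>: "\<epsilon> > 0" "y' = y + 2 * \<epsilon>" using y by (auto simp: \<epsilon>_def field_simps)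
    obtain m0 where m0: "\<And>m. m \<ge> m0 \<Longrightarrow> \<exists>n\<ge>1. real n * prob (ball x (cell_scale TYPE('a) m)) \<le> exp (\<epsilon> * real m)
           \<and> dist ((f ^^ n) x) x < exp (- real m)"
      using up[OF \<epsilon>(1)] unfolding eventually_sequentially by blast
    have "eventually (\<lambda>r. r powr \<epsilon> < \<kappa> powr y / exp \<epsilon>) (at_right 0)"
      by (rule eventually_powr_less) (use \<kappa> \<epsilon> in auto)
    moreover have "eventually (\<lambda>r. r \<in> {0<..<exp (- real m0)}) (at_right (0::real))"
      by (rule eventually_at_rightI[of 0 "exp (- real m0)"]) auto
    ultimately show ?thesis
    proof eventually_elim
      case (elim r)
      have r: "0 < r" "r < exp (- real m0)" using elim by auto
      then have r1: "r < 1" by (rule_tac less_le_trans) auto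
      define m where "m = nat \<lceil>ln (1 / r)\<rceil>"
      have lnr: "ln (1 / r) > 0" using r r1 by simp
      have m: "ln (1 / r) \<le> real m" "real m \<le> ln (1 / r) + 1"
        unfolding m_def using lnr by linarith+
      have "real m0 < ln (1 / r)" using r ln_less_cancel_iff[of r "exp (- real m0)"] by (simp add: ln_div)
      then have "m \<ge> m0" using m(1) by linarith
      then obtain n where n: "n \<ge> 1" "real n * prob (ball x (cell_scale TYPE('a) m)) \<le> exp (\<epsilon> * real m)"
        "dist ((f ^^ n) x) x < exp (- real m)" using m0 by blast
      have em: "exp (- real m) \<le> r"
      proof -
        have "exp (- real m) \<le> exp (- ln (1 / r))" using m(1) by simp
        also have "\<dots> = r" using r by (simp add: ln_div)
        finally show ?thesis .
      qed
      have em': "r \<le> exp 1 * exp (- real m)"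
      proof -
        have "r = exp (- ln (1 / r))" using r by (simp add: ln_div)
        also have "\<dots> \<le> exp (1 - real m)" using m(2) by simp
        finally show ?thesis by (simp add: exp_diff exp_minus field_simps)
      qed
      show ?case
      proof
        assume "ereal y' < ?F r"
        then have "r powr - y' < real n"
          using n(1,3) em unfolding less_recurrence_quotient_iff[OF r(1) r1] by force
        then have "r powr - y' * prob (ball x (cell_scale TYPE('a) m)) \<le> real n * prob (ball x (cell_scale TYPE('a) m))"
          by (intro mult_right_mono) auto
        also have "\<dots> \<le> exp (\<epsilon> * real m)" by (rule n(2))
        also have "\<dots> \<le> exp (\<epsilon> * (ln (1 / r) + 1))" using m(2) \<epsilon> by simp
        also have "\<dots> = exp \<epsilon> * r powr - \<epsilon>" using r by (simp add: powr_def ln_div exp_add[symmetric] algebra_simps)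
        finally have "prob (ball x (cell_scale TYPE('a) m)) \<le> r powr y' * (exp \<epsilon> * r powr - \<epsilon>)"
          using r by (simp add: powr_minus field_simps)
        also have "\<dots> = r powr y * (exp \<epsilon> * r powr \<epsilon>)"
          unfolding \<epsilon>(2) using r by (simp add: powr_add[symmetric] add.commute)
        also have "\<dots> < r powr y * \<kappa> powr y"
          using elim(1) r by (intro mult_strict_left_mono) (auto simp: field_simps)
        also have "\<dots> = (\<kappa> * r) powr y" using r \<kappa> by (simp add: powr_mult)
        finally have 1: "prob (ball x (cell_scale TYPE('a) m)) < (\<kappa> * r) powr y" .
        have "\<kappa> * r \<le> cell_scale TYPE('a) m"
          using em' by (simp add: \<kappa>_def cell_scale_def field_simps)
        then have "prob (ball x (\<kappa> * r)) \<le> prob (ball x (cell_scale TYPE('a) m))"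
          by (intro finite_measure_mono subset_ball) auto
        then have "prob (ball x (\<kappa> * r)) < (\<kappa> * r) powr y" using 1 by linarith
        moreover have "0 < \<kappa> * r" "\<kappa> * r < 1"
          using mult_pos_pos[OF \<kappa>(1) r(1)] mult_right_mono[OF \<kappa>(2) less_imp_le[OF r(1)]] r1 by linarith+
        ultimately show "ereal y < ?G (\<kappa> * r)" by (simp only: less_dimension_quotient_iff)
      qed
    qed
  qed
  have G0: "eventually (\<lambda>r. 0 \<le> ?G r) (at_right 0)"
  proof (rule eventually_at_rightI[of 0 1])
    fix r :: real assume r: "r \<in> {0<..<1}"
    show "0 \<le> ?G r"
    proof (rule ereal_nonneg_of_neg_less)
      fix y :: real assume "y < 0"
      then have "1 < r powr y" using r by (simp add: powr_def mult_neg_neg)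
      then have "prob (ball x r) < r powr y" using prob_le_1[of "ball x r"] by linarith
      then show "ereal y < ?G r" using r by (subst less_dimension_quotient_iff) auto
    qed
  qed simp
  note rates = Liminf_Limsup_le_of_thresholds[where F="?F" and G="?G", OF \<kappa>(1) thr G0]
  show "lower_recurrence_rate f x \<le> lower_pointwise_dim M x"
    unfolding lower_recurrence_rate_def lower_pointwise_dim_def by (rule rates(1))
  show "upper_recurrence_rate f x \<le> upper_pointwise_dim M x"
    unfolding upper_recurrence_rate_def upper_pointwise_dim_def by (rule rates(2))
qed

lemma dims_le_rates:
  fixes C :: real
  assumes C: "C \<ge> 1" and low: "\<And>\<epsilon>. \<epsilon> > 0 \<Longrightarrow> eventually (\<lambda>m. \<forall>n\<ge>1.
     real n * prob (ball x (C * exp (- real m))) \<le> exp (- (\<epsilon> * real m)) \<longrightarrow> x \<notin> close_return m n) sequentially"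
  shows "lower_pointwise_dim M x \<le> lower_recurrence_rate f x" "upper_pointwise_dim M x \<le> upper_recurrence_rate f x"
proof -
  \<comment> \<open>Here \<open>m\<close> is \<open>ln (C / r)\<close> rounded up: then
    \<open>C * exp (- m) \<le> r\<close>, so the ball of the hypothesis lies in
    \<open>ball x r\<close>, and \<open>\<kappa> * r \<le> exp (- m)\<close>, so a return within
    \<open>\<kappa> * r\<close> is a close return at scale \<open>m\<close>.\<close>
  define \<kappa> where "\<kappa> = 1 / (exp 1 * C)"
  have \<kappa>: "0 < \<kappa>" "\<kappa> \<le> 1"
  proof -
    show "0 < \<kappa>" using C by (simp add: \<kappa>_def)
    have "1 * 1 \<le> exp 1 * C" by (intro mult_mono) (use C in auto)
    then show "\<kappa> \<le> 1" using C by (simp add: \<kappa>_def divide_le_eq)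
  qed
  let ?F = "\<lambda>r::real. eln (return_time f r x) / ereal (ln (1 / r))"
  let ?G = "\<lambda>r::real. eln (emeasure M (ball x r)) / ereal (ln r)"
  have thr: "eventually (\<lambda>r. ereal y' < ?G r \<longrightarrow> ereal y < ?F (\<kappa> * r)) (at_right 0)"
    if y: "0 \<le> y" "y < y'" for y y' :: real
  proof -
    define \<epsilon> where "\<epsilon> = (y' - y) / 2"
    have \<epsilon>: "\<epsilon> > 0" "y' = y + 2 * \<epsilon>" using y by (auto simp: \<epsilon>_def field_simps)
    obtain m0 where m0: "\<And>m n. m \<ge> m0 \<Longrightarrow> n \<ge> 1 \<Longrightarrow>
        real n * prob (ball x (C * exp (- real m))) \<le> exp (- (\<epsilon> * real m)) \<Longrightarrow> x \<notin> close_return m n"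
      using low[OF \<epsilon>(1)] unfolding eventually_sequentially by blast
    \<comment> \<open>For such \<open>r\<close> one has
      \<open>r powr y' \<le> (\<kappa> * r) powr (y + \<epsilon>)\<close>; the
      \<open>\<epsilon>\<close> left over cancels against \<open>exp (- (\<epsilon> * m)) \<ge>
      (\<kappa> * r) powr \<epsilon>\<close>.\<close>
    have "eventually (\<lambda>r. r powr \<epsilon> < \<kappa> powr (y + \<epsilon>)) (at_right 0)"
      by (rule eventually_powr_less) (use \<kappa> \<epsilon> in auto)
    moreover have "eventually (\<lambda>r. r \<in> {0<..<exp (- real m0)}) (at_right (0::real))"
      by (rule eventually_at_rightI[of 0 "exp (- real m0)"]) auto
    ultimately show ?thesis
    proof eventually_elim
      case (elim r)
      have r: "0 < r" "r < exp (- real m0)" using elim by auto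
      then have r1: "r < 1" by (rule_tac less_le_trans) auto
      define m where "m = nat \<lceil>ln (C / r)\<rceil>"
      have lnr: "ln (1 / r) > 0" using r r1 by simp
      have lnC: "ln (C / r) = ln C + ln (1 / r)" "ln C \<ge> 0" using r C by (auto simp: ln_div)
      have m: "ln (C / r) \<le> real m" "real m \<le> ln (C / r) + 1"
        unfolding m_def using lnr lnC by linarith+
      have "real m0 < ln (1 / r)" using r ln_less_cancel_iff[of r "exp (- real m0)"] by (simp add: ln_div)
      then have mm0: "m \<ge> m0" using m(1) lnC by linarith
      have rC: "exp (- ln (C / r)) = r / C" using r C by (simp add: exp_minus field_simps)
      have em: "C * exp (- real m) \<le> r"
      proof -
        have "exp (- real m) \<le> exp (- ln (C / r))" using m(1) by simp
        then show ?thesis using C unfolding rC by (simp add: field_simps)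
      qed
      have em': "\<kappa> * r \<le> exp (- real m)"
      proof -
        have "\<kappa> * r = exp (- 1) * exp (- ln (C / r))" unfolding rC by (simp add: \<kappa>_def exp_minus field_simps)
        also have "\<dots> = exp (- (ln (C / r) + 1))" by (simp add: exp_add[symmetric])
        also have "\<dots> \<le> exp (- real m)" using m(2) by simp
        finally show ?thesis .
      qed
      have \<kappa>r: "0 < \<kappa> * r" "\<kappa> * r < 1"
        using mult_pos_pos[OF \<kappa>(1) r(1)] mult_right_mono[OF \<kappa>(2) less_imp_le[OF r(1)]] r1 by linarith+
      show ?case
      proof
        assume "ereal y' < ?G r"
        then have G: "prob (ball x r) < r powr y'" by (simp only: less_dimension_quotient_iff r r1)
        have "prob (ball x (C * exp (- real m))) \<le> prob (ball x r)"
          by (intro finite_measure_mono subset_ball em) auto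
        then have mb: "prob (ball x (C * exp (- real m))) < r powr y'" using G by linarith
        show "ereal y < ?F (\<kappa> * r)"
          unfolding less_recurrence_quotient_iff[OF \<kappa>r]
        proof (intro allI impI)
          fix n :: nat assume n: "n \<ge> 1" "dist ((f ^^ n) x) x < \<kappa> * r"
          then have "x \<in> close_return m n" using em' by (simp add: close_return_def)
          then have "\<not> real n * prob (ball x (C * exp (- real m))) \<le> exp (- (\<epsilon> * real m))"
            using m0[OF mm0 n(1)] by blast
          then have "exp (- (\<epsilon> * real m)) < real n * prob (ball x (C * exp (- real m)))" by simp
          also have "\<dots> \<le> real n * r powr y'" using mb by (intro mult_left_mono) auto
          finally have 1: "exp (- (\<epsilon> * real m)) < real n * r powr y'" .
          have "(\<kappa> * r) powr \<epsilon> \<le> exp (- real m) powr \<epsilon>" using em' \<epsilon> \<kappa>r by (intro powr_mono2) auto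
          also have "\<dots> = exp (- (\<epsilon> * real m))" by (simp add: exp_powr_real mult.commute)
          finally have 2: "(\<kappa> * r) powr \<epsilon> < real n * r powr y'" using 1 by linarith
          have "r powr y' = r powr \<epsilon> * r powr (y + \<epsilon>)" unfolding \<epsilon>(2) by (simp add: powr_add[symmetric] add.commute)
          also have "\<dots> \<le> \<kappa> powr (y + \<epsilon>) * r powr (y + \<epsilon>)"
            using elim(1) by (intro mult_right_mono) auto
          also have "\<dots> = (\<kappa> * r) powr (y + \<epsilon>)" using r \<kappa> by (simp add: powr_mult)
          also have "\<dots> = (\<kappa> * r) powr y * (\<kappa> * r) powr \<epsilon>" by (simp add: powr_add)
          finally have "real n * r powr y' \<le> real n * ((\<kappa> * r) powr y * (\<kappa> * r) powr \<epsilon>)"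
            by (intro mult_left_mono) auto
          then have "1 * (\<kappa> * r) powr \<epsilon> < (real n * (\<kappa> * r) powr y) * (\<kappa> * r) powr \<epsilon>"
            using 2 by (simp add: mult.assoc)
          moreover have "(\<kappa> * r) powr \<epsilon> > 0" using r(1) \<kappa>(1) by simp
          ultimately have "1 < real n * (\<kappa> * r) powr y" using mult_less_cancel_right_pos by blast
          then show "(\<kappa> * r) powr - y < real n" using r(1) \<kappa>(1) by (simp add: powr_minus field_simps)
        qed
      qed
    qed
  qed
  have F0: "eventually (\<lambda>r. 0 \<le> ?F r) (at_right 0)"
  proof (rule eventually_at_rightI[of 0 1])
    fix r :: real assume r: "r \<in> {0<..<1}"
    show "0 \<le> ?F r"
    proof (rule ereal_nonneg_of_neg_less)
      fix y :: real assume "y < 0"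
      then have "r powr - y < 1" using r powr_less_mono2[of "- y" r 1] by simp
      then have "r powr - y < real n" if "n \<ge> 1" for n using that by (simp add: less_le_trans[of _ 1])
      then show "ereal y < ?F r" using r by (subst less_recurrence_quotient_iff) auto
    qed
  qed simp
  note rates = Liminf_Limsup_le_of_thresholds[where F="?G" and G="?F", OF \<kappa>(1) thr F0]
  show "lower_pointwise_dim M x \<le> lower_recurrence_rate f x"
    unfolding lower_recurrence_rate_def lower_pointwise_dim_def by (rule rates(1))
  show "upper_pointwise_dim M x \<le> upper_recurrence_rate f x"
    unfolding upper_recurrence_rate_def upper_pointwise_dim_def by (rule rates(2))
qed

lemma AE_rates_eq_dims:
  assumes pl: "piecewise_lipschitz_wrt M f \<A> L" and avg: "avg_lipschitz_exponent M \<A> L < \<infinity>"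
    and ld: "local_decay \<V> \<theta>" and ent: "metric_entropy M f > 0"
  shows "AE x in M. lower_recurrence_rate f x = lower_pointwise_dim M x \<and>
                    upper_recurrence_rate f x = upper_pointwise_dim M x"
  using AE_return_upper AE_return_lower[OF ld AE_not_fast_return[OF pl avg ld ent]]
proof eventually_elim
  case (elim x)
  have C: "(1::real) \<le> 4 * DIM('a) + 2" by simp
  show ?case
    using rates_le_dims[of x] dims_le_rates[OF C, of x] elim by (intro conjI antisym) blast+
qed

text \<open>The whole space has empty frontier, so with a single piece the neighbourhoods of the
  singularity set are empty.\<close>

lemma lipschitz_imp_piecewise_lipschitz:
  assumes "L-lipschitz_on UNIV f"
  shows "piecewise_lipschitz_wrt M f {UNIV} (\<lambda>_. L)" "avg_lipschitz_exponent M {UNIV} (\<lambda>_. L) < \<infinity>"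
proof -
  have "\<exists>c>0. \<exists>a>0. \<forall>\<epsilon>>0. prob {x. \<exists>y\<in>singularity_set {UNIV :: 'a set}. dist x y < \<epsilon>} \<le> c * \<epsilon> powr a"
    by (intro exI[of _ "1 :: real"] conjI) (simp_all add: singularity_set_def)
  then show "piecewise_lipschitz_wrt M f {UNIV} (\<lambda>_. L)"
    using assms by (simp add: piecewise_lipschitz_wrt_def open_partition_mod_def disjoint_def)
  show "avg_lipschitz_exponent M {UNIV} (\<lambda>_. L) < \<infinity>"
    by (simp add: avg_lipschitz_exponent_def emeasure_eq_measure)
qed

end

theorem theorem3:
  fixes M :: "('a::euclidean_space) measure" and f :: "'a \<Rightarrow> 'a"
  assumes "prob_space M" and "sets M = sets borel"
    and "f \<in> measurable M M" and "distr M M f = M"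
    and "metric_entropy M f > 0"
    and "(\<exists>L. L-lipschitz_on UNIV f) \<or>
         (\<exists>\<A> L. piecewise_lipschitz_wrt M f \<A> L \<and> avg_lipschitz_exponent M \<A> L < \<infinity>)"
    and "superpoly_decay M f \<or> local_superpoly_decay M f"
  shows "AE x in M. lower_recurrence_rate f x = lower_pointwise_dim M x \<and>
                    upper_recurrence_rate f x = upper_pointwise_dim M x"
proof -
  interpret prob_space M by fact
  interpret measure_preserving M f by unfold_locales fact+
  obtain \<A> L where pl: "piecewise_lipschitz_wrt M f \<A> L" "avg_lipschitz_exponent M \<A> L < \<infinity>"
    using assms(6) lipschitz_imp_piecewise_lipschitz by blast
  have "\<exists>\<V> \<theta>. local_decay \<V> \<theta>"
  proof (cases "local_superpoly_decay M f")
    case True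
    then show ?thesis unfolding local_superpoly_decay_def local_decay_def decay_on_def by blast
  next
    case False
    then obtain \<theta> where "superpoly_null \<theta>"
      "\<forall>\<phi> \<psi>. bounded_lipschitz \<phi> \<longrightarrow> bounded_lipschitz \<psi> \<longrightarrow> correlation_bound M f \<theta> \<phi> \<psi>"
      using assms(7) unfolding superpoly_decay_def by blast
    then have "local_decay {UNIV} (\<lambda>_. \<theta>)"
      by (simp add: local_decay_def decay_on_def open_partition_mod_def disjoint_def)
    then show ?thesis by blast
  qed
  then obtain \<V> \<theta> where "local_decay \<V> \<theta>" by blast
  then show ?thesis using AE_rates_eq_dims pl assms(5) by blast
qed

end
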